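(* Let $(\mathcal X,\mathfrak S)$ be a relatively hierarchically hyperbolic space. Then there exists $s_0$ such that for all $s\ge s_0$ there exist constants $C,K$ such that for all $x,y\in\mathcal X$, $$d_{\mathcal X}(x,y)\asymp_{K,C}\sum_{U\in\mathfrak S}\{\!\{d_U(x,y)\}\!\}_s .$$
   Context: Notation: for real $A,B$, $\{\!\{A\}\!\}_B$ is $A$ if $A\ge B$ and $0$ otherwise; $A\asymp_{K,C}B$ means $K^{-1}A-C\le B\le KA+C$. Hierarchical spaces. A $q$-quasigeodesic space is a metric space in which any two points are joined by a $(q,q)$-quasigeodesic. A hierarchical space $(\mathcal X,\mathfrak S)$ consists of a $q$-quasigeodesic space $(\mathcal X,d_{\mathcal X})$, an index set $\mathfrak S$ and geodesic metric spaces $(\mathcal CW,d_W)$, $W\in\mathfrak S$ (not required to be hyperbolic), such that (1)–(9) below hold. Conventions: the distance between two sets is the infimum of distances between their points; for $x,y\in\mathcal X$ and $p\subseteq\mathcal CW$, $d_W(x,y)=d_W(\pi_W(x),\pi_W(y))$ and $d_W(x,p)=d_W(\pi_W(x),p)$; $V\sqsubset W$ means $V\sqsubseteq W$ and $V\ne W$. (1) Projections: there are $\xi,K\ge 0$ and maps $\pi_W:\mathcal X\to2^{\mathcal CW}$ ($W\in\mathfrak S$) sending points to nonempty sets of diameter $\le\xi$; each $\pi_W$ is $(K,K)$-coarsely Lipschitz and $\pi_W(\mathcal X)$ is $K$-quasiconvex in $\mathcal CW$. (2) Nesting: $\mathfrak S$ has a partial order $\sqsubseteq$, and either $\mathfrak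 S=\emptyset$ or there is a unique $\sqsubseteq$-maximal element. Put $\mathfrak S_W=\{V:V\sqsubseteq W\}$. If $V\sqsubset W$ there is a specified subset $\rho^V_W\subset\mathcal CW$ of diameter $\le\xi$ and a map $\rho^W_V:\mathcal CW\to2^{\mathcal CV}$. (3) Orthogonality: $\mathfrak S$ has a symmetric anti-reflexive relation $\perp$. If $V\sqsubseteq W$ and $W\perp U$ then $V\perp U$. For each $T\in\mathfrak S$ and $U\in\mathfrak S_T$ with $\{V\in\mathfrak S_T:V\perp U\}\ne\emptyset$ there is $W\in\mathfrak S_T-\{T\}$ such that $V\sqsubseteq W$ whenever $V\perp U$ and $V\sqsubseteq T$. If $V\perp W$ then $V,W$ are not $\sqsubseteq$-comparable. (4) Transversality and consistency: if $V,W$ are not orthogonal and neither is nested in the other they are transverse, $V\pitchfork W$. There is $\kappa_0\ge0$ such that: if $V\pitchfork W$ there are sets $\rho^V_W\subseteq\mathcal CW$, $\rho^W_V\subseteq\mathcal CV$ of diameter $\le\xi$ with $\min\{d_W(\pi_W(x),\rho^V_W),d_V(\pi_V(x),\rho^W_V)\}\le\kappa_0$ for all $x\in\mathcal X$; if $V\sqsubset W$ then $\min\{d_W(\pi_W(x),\rho^V_W),\mathrm{diam}_{\mathcal CV}(\pi_V(x)\cup\rho^W_V(\pi_W(x)))\}\le\kappa_0$ for all $x$; and if $U\sqsubseteq V$ then $d_W(\rho^U_W,\rho^V_W)\le\kappa_0$ whenever $V\sqsubset W$, or $V\pitchfork W$ and $W\not\perp U$. (5) Finite complexity: there is $n\ge0$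 (the complexity) such that any set of pairwise $\sqsubseteq$-comparable elements has at most $n$ elements. (6) Large links: there are $\lambda\ge1$, $E\ge\max\{\xi,\kappa_0\}$ such that for $W\in\mathfrak S$, $x,x'\in\mathcal X$ and $N=\lambda d_W(x,x')+\lambda$ there is a collection $\{T_i\}\subseteq\mathfrak S_W-\{W\}$ of at most $\lfloor N\rfloor$ elements such that every $T\in\mathfrak S_W-\{W\}$ either lies in some $\mathfrak S_{T_i}$ or satisfies $d_T(x,x')<E$; moreover $d_W(x,\rho^{T_i}_W)\le N$ for all $i$. (7) Bounded geodesic image: there is $E>0$ such that for all $V\sqsubset W$ and all geodesics $\gamma$ of $\mathcal CW$, either $\mathrm{diam}_{\mathcal CV}(\rho^W_V(\gamma))\le E$ or $\gamma$ meets the $E$-neighborhood of $\rho^V_W$. (8) Partial realization: there is $\alpha$ such that for every family $\{V_j\}$ of pairwise orthogonal elements and $p_j\in\pi_{V_j}(\mathcal X)$ there is $x\in\mathcal X$ with $d_{V_j}(x,p_j)\le\alpha$ for all $j$, and $d_V(x,\rho^{V_j}_V)\le\alpha$ whenever $V_j\sqsubset V$ or $V\pitchfork V_j$ for some $j$. (9) Uniqueness: for each $\kappa\ge0$ there is $\theta_u(\kappa)$ such that $d_{\mathcal X}(x,y)\ge\theta_u(\kappa)$ implies $d_V(x,y)\ge\kappa$ for some $V\in\mathfrak S$. A hierarchical space $(\mathcal X,\mathfrak S)$ is relatively hierarchically hyperbolic if there exists $\delta$ such that for all $U\in\mathfrak S$, either $U$ is $\sqsubseteq$-minimal or $\mathcal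 CU$ is $\delta$-hyperbolic; and if $U$ is $\sqsubseteq$-minimal and $\mathcal CU$ is not ($\delta$-)hyperbolic, then $\pi_U$ is $E$-coarsely surjective, for a uniform constant $E$. *)

theory Defs
  imports "HOL-Analysis.Analysis"
begin

section \<open>Coarse geometry of carrier-based metric spaces\<close>

text \<open>Set distances and diameters take values in \<^typ>\<open>ennreal\<close>, so that the usual conventions
  hold without side conditions: the distance to the empty set is infinite, the diameter of the
  empty set is 0, and the diameter of an unbounded set is infinite.\<close>

definition set_dist :: "('a \<Rightarrow> 'a \<Rightarrow> real) \<Rightarrow> 'a set \<Rightarrow> 'a set \<Rightarrow> ennreal" where
  "set_dist d A B = (INF a\<in>A. INF b\<in>B. ennreal (d a b))"

definition set_diam :: "('a \<Rightarrow> 'a \<Rightarrow> real) \<Rightarrow> 'a set \<Rightarrow> ennreal" where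
  "set_diam d A = (SUP a\<in>A. SUP b\<in>A. ennreal (d a b))"

definition nbhd :: "'a set \<Rightarrow> ('a \<Rightarrow> 'a \<Rightarrow> real) \<Rightarrow> real \<Rightarrow> 'a set \<Rightarrow> 'a set" where
  "nbhd M d r A = {p \<in> M. set_dist d {p} A \<le> ennreal r}"

definition geodesic :: "'a set \<Rightarrow> ('a \<Rightarrow> 'a \<Rightarrow> real) \<Rightarrow> real \<Rightarrow> (real \<Rightarrow> 'a) \<Rightarrow> bool" where
  "geodesic M d L \<gamma> \<longleftrightarrow>
     0 \<le> L \<and> \<gamma> ` {0..L} \<subseteq> M \<and>
     (\<forall>s\<in>{0..L}. \<forall>t\<in>{0..L}. d (\<gamma> s) (\<gamma> t) = \<bar>s - t\<bar>)"

definition geodesic_space :: "'a set \<Rightarrow> ('a \<Rightarrow> 'a \<Rightarrow> real) \<Rightarrow> bool" where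
  "geodesic_space M d \<longleftrightarrow>
     Metric_space M d \<and>
     (\<forall>x\<in>M. \<forall>y\<in>M. \<exists>L \<gamma>. geodesic M d L \<gamma> \<and> \<gamma> 0 = x \<and> \<gamma> L = y)"

definition quasigeodesic ::
    "real \<Rightarrow> 'a set \<Rightarrow> ('a \<Rightarrow> 'a \<Rightarrow> real) \<Rightarrow> real \<Rightarrow> (real \<Rightarrow> 'a) \<Rightarrow> bool" where
  "quasigeodesic q M d L \<gamma> \<longleftrightarrow>
     0 \<le> L \<and> \<gamma> ` {0..L} \<subseteq> M \<and>
     (\<forall>s\<in>{0..L}. \<forall>t\<in>{0..L}.
        \<bar>s - t\<bar> / q - q \<le> d (\<gamma> s) (\<gamma> t) \<and> d (\<gamma> s) (\<gamma> t) \<le> q * \<bar>s - t\<bar> + q)"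

definition quasigeodesic_space :: "real \<Rightarrow> 'a set \<Rightarrow> ('a \<Rightarrow> 'a \<Rightarrow> real) \<Rightarrow> bool" where
  "quasigeodesic_space q M d \<longleftrightarrow>
     1 \<le> q \<and> Metric_space M d \<and>
     (\<forall>x\<in>M. \<forall>y\<in>M. \<exists>L \<gamma>. quasigeodesic q M d L \<gamma> \<and> \<gamma> 0 = x \<and> \<gamma> L = y)"

definition quasiconvex :: "real \<Rightarrow> 'a set \<Rightarrow> ('a \<Rightarrow> 'a \<Rightarrow> real) \<Rightarrow> 'a set \<Rightarrow> bool" where
  "quasiconvex K M d A \<longleftrightarrow>
     A \<subseteq> M \<and>
     (\<forall>L \<gamma>. geodesic M d L \<gamma> \<and> \<gamma> 0 \<in> A \<and> \<gamma> L \<in> A \<longrightarrow> \<gamma> ` {0..L} \<subseteq> nbhd M d K A)"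

text \<open>Hyperbolicity of a geodesic space is the slim-triangles condition. Only one side is
  singled out; the other two follow by reparametrising and permuting the sides.\<close>

definition hyperbolic :: "real \<Rightarrow> 'a set \<Rightarrow> ('a \<Rightarrow> 'a \<Rightarrow> real) \<Rightarrow> bool" where
  "hyperbolic \<delta> M d \<longleftrightarrow>
     geodesic_space M d \<and>
     (\<forall>L1 L2 L3 \<gamma>1 \<gamma>2 \<gamma>3.
        geodesic M d L1 \<gamma>1 \<and> geodesic M d L2 \<gamma>2 \<and> geodesic M d L3 \<gamma>3 \<and>
        \<gamma>1 L1 = \<gamma>2 0 \<and> \<gamma>2 L2 = \<gamma>3 0 \<and> \<gamma>3 L3 = \<gamma>1 0 \<longrightarrow>
        \<gamma>1 ` {0..L1} \<subseteq> nbhd M d \<delta> (\<gamma>2 ` {0..L2} \<union> \<gamma>3 ` {0..L3}))"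


section \<open>Hierarchical spaces\<close>

text \<open>The points of all the spaces \<open>\<C>W\<close> are drawn from one type \<open>'c\<close>; this loses nothing, since
  the carriers may be taken disjoint. \<open>rho V W\<close> is the set \<open>\<rho>\<^sup>V\<^sub>W \<subseteq> \<C>W\<close>, used when
  \<open>V\<close> is properly nested in \<open>W\<close> or transverse to \<open>W\<close>, and \<open>rhomap W V\<close> is the map
  \<open>\<rho>\<^sup>W\<^sub>V : \<C>W \<rightarrow> 2\<^sup>\<C>\<^sup>V\<close>, used when \<open>V\<close> is properly nested in \<open>W\<close>.
  Values at other arguments are irrelevant.\<close>

record ('x, 's, 'c) hierarchy =
  pts :: "'x set"
  dX :: "'x \<Rightarrow> 'x \<Rightarrow> real"
  idx :: "'s set"
  cspace :: "'s \<Rightarrow> 'c set"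
  dC :: "'s \<Rightarrow> 'c \<Rightarrow> 'c \<Rightarrow> real"
  proj :: "'s \<Rightarrow> 'x \<Rightarrow> 'c set"
  nest :: "'s \<Rightarrow> 's \<Rightarrow> bool"
  orth :: "'s \<Rightarrow> 's \<Rightarrow> bool"
  rho :: "'s \<Rightarrow> 's \<Rightarrow> 'c set"
  rhomap :: "'s \<Rightarrow> 's \<Rightarrow> 'c \<Rightarrow> 'c set"

definition pnest :: "('x, 's, 'c) hierarchy \<Rightarrow> 's \<Rightarrow> 's \<Rightarrow> bool" where
  "pnest H V W \<longleftrightarrow> nest H V W \<and> V \<noteq> W"

definition transverse :: "('x, 's, 'c) hierarchy \<Rightarrow> 's \<Rightarrow> 's \<Rightarrow> bool" where
  "transverse H V W \<longleftrightarrow> \<not> orth H V W \<and> \<not> nest H V W \<and> \<not> nest H W V"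

definition below :: "('x, 's, 'c) hierarchy \<Rightarrow> 's \<Rightarrow> 's set" where
  "below H W = {V \<in> idx H. nest H V W}"

definition proj_image :: "('x, 's, 'c) hierarchy \<Rightarrow> 's \<Rightarrow> 'c set" where
  "proj_image H W = (\<Union>x\<in>pts H. proj H W x)"

text \<open>The real number \<open>d\<^sub>W(x,y)\<close>; projections of points are nonempty, so the value
  converted to \<^typ>\<open>real\<close> is finite.\<close>

definition dproj :: "('x, 's, 'c) hierarchy \<Rightarrow> 's \<Rightarrow> 'x \<Rightarrow> 'x \<Rightarrow> real" where
  "dproj H W x y = enn2real (set_dist (dC H W) (proj H W x) (proj H W y))"

definition projections :: "('x, 's, 'c) hierarchy \<Rightarrow> real \<Rightarrow> real \<Rightarrow> bool" where
  "projections H \<xi> K \<longleftrightarrow>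
     (\<forall>W\<in>idx H.
        (\<forall>x\<in>pts H. proj H W x \<noteq> {} \<and> proj H W x \<subseteq> cspace H W \<and>
                   set_diam (dC H W) (proj H W x) \<le> ennreal \<xi>) \<and>
        (\<forall>x\<in>pts H. \<forall>y\<in>pts H. dproj H W x y \<le> K * dX H x y + K) \<and>
        quasiconvex K (cspace H W) (dC H W) (proj_image H W))"

definition nesting :: "('x, 's, 'c) hierarchy \<Rightarrow> real \<Rightarrow> bool" where
  "nesting H \<xi> \<longleftrightarrow>
     (\<forall>V\<in>idx H. nest H V V) \<and>
     (\<forall>V\<in>idx H. \<forall>W\<in>idx H. nest H V W \<and> nest H W V \<longrightarrow> V = W) \<and>
     (\<forall>U\<in>idx H. \<forall>V\<in>idx H. \<forall>W\<in>idx H. nest H U V \<and> nest H V W \<longrightarrow> nest H U W) \<and>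
     (idx H = {} \<or> (\<exists>!W. W \<in> idx H \<and> (\<forall>V\<in>idx H. \<not> pnest H W V))) \<and>
     (\<forall>V\<in>idx H. \<forall>W\<in>idx H. pnest H V W \<longrightarrow>
        rho H V W \<subseteq> cspace H W \<and> set_diam (dC H W) (rho H V W) \<le> ennreal \<xi> \<and>
        (\<forall>p\<in>cspace H W. rhomap H W V p \<subseteq> cspace H V))"

definition orthogonality :: "('x, 's, 'c) hierarchy \<Rightarrow> bool" where
  "orthogonality H \<longleftrightarrow>
     (\<forall>V\<in>idx H. \<forall>W\<in>idx H. orth H V W \<longrightarrow> orth H W V) \<and>
     (\<forall>V\<in>idx H. \<not> orth H V V) \<and>
     (\<forall>U\<in>idx H. \<forall>V\<in>idx H. \<forall>W\<in>idx H. nest H V W \<and> orth H W U \<longrightarrow> orth H V U) \<and>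
     (\<forall>T\<in>idx H. \<forall>U\<in>below H T. {V \<in> below H T. orth H V U} \<noteq> {} \<longrightarrow>
        (\<exists>W\<in>below H T - {T}. \<forall>V\<in>below H T. orth H V U \<longrightarrow> nest H V W)) \<and>
     (\<forall>V\<in>idx H. \<forall>W\<in>idx H. orth H V W \<longrightarrow> \<not> nest H V W \<and> \<not> nest H W V)"

definition consistency :: "('x, 's, 'c) hierarchy \<Rightarrow> real \<Rightarrow> real \<Rightarrow> bool" where
  "consistency H \<xi> \<kappa>\<^sub>0 \<longleftrightarrow>
     (\<forall>V\<in>idx H. \<forall>W\<in>idx H. transverse H V W \<longrightarrow>
        rho H V W \<subseteq> cspace H W \<and> set_diam (dC H W) (rho H V W) \<le> ennreal \<xi> \<and>
        rho H W V \<subseteq> cspace H V \<and> set_diam (dC H V) (rho H W V) \<le> ennreal \<xi> \<and>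
        (\<forall>x\<in>pts H. min (set_dist (dC H W) (proj H W x) (rho H V W))
                       (set_dist (dC H V) (proj H V x) (rho H W V)) \<le> ennreal \<kappa>\<^sub>0)) \<and>
     (\<forall>V\<in>idx H. \<forall>W\<in>idx H. pnest H V W \<longrightarrow>
        (\<forall>x\<in>pts H. min (set_dist (dC H W) (proj H W x) (rho H V W))
                       (set_diam (dC H V) (proj H V x \<union> (\<Union>p\<in>proj H W x. rhomap H W V p)))
                     \<le> ennreal \<kappa>\<^sub>0)) \<and>
     (\<forall>U\<in>idx H. \<forall>V\<in>idx H. \<forall>W\<in>idx H.
        nest H U V \<and> (pnest H V W \<or> transverse H V W \<and> \<not> orth H W U) \<longrightarrow>
        set_dist (dC H W) (rho H U W) (rho H V W) \<le> ennreal \<kappa>\<^sub>0)"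

definition finite_complexity :: "('x, 's, 'c) hierarchy \<Rightarrow> nat \<Rightarrow> bool" where
  "finite_complexity H n \<longleftrightarrow>
     (\<forall>A\<subseteq>idx H. (\<forall>V\<in>A. \<forall>W\<in>A. nest H V W \<or> nest H W V) \<longrightarrow> finite A \<and> card A \<le> n)"

definition large_links :: "('x, 's, 'c) hierarchy \<Rightarrow> real \<Rightarrow> real \<Rightarrow> bool" where
  "large_links H lam E \<longleftrightarrow>
     (\<forall>W\<in>idx H. \<forall>x\<in>pts H. \<forall>x'\<in>pts H.
        let N = lam * dproj H W x x' + lam in
        \<exists>\<T>\<subseteq>below H W - {W}. finite \<T> \<and> int (card \<T>) \<le> \<lfloor>N\<rfloor> \<and>
          (\<forall>T\<in>below H W - {W}. (\<exists>T'\<in>\<T>. T \<in> below H T') \<or> dproj H T x x' < E) \<and>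
          (\<forall>T\<in>\<T>. set_dist (dC H W) (proj H W x) (rho H T W) \<le> ennreal N))"

text \<open>Stating the next axiom for geodesic segments covers infinite geodesics too: if every
  subsegment of a ray or line misses the neighbourhood, the diameter bounds for the
  subsegments pass to their union.\<close>

definition bounded_geodesic_image :: "('x, 's, 'c) hierarchy \<Rightarrow> real \<Rightarrow> bool" where
  "bounded_geodesic_image H E \<longleftrightarrow>
     (\<forall>V\<in>idx H. \<forall>W\<in>idx H. pnest H V W \<longrightarrow>
        (\<forall>L \<gamma>. geodesic (cspace H W) (dC H W) L \<gamma> \<longrightarrow>
           set_diam (dC H V) (\<Union>p\<in>\<gamma> ` {0..L}. rhomap H W V p) \<le> ennreal E \<or>
           \<gamma> ` {0..L} \<inter> nbhd (cspace H W) (dC H W) E (rho H V W) \<noteq> {}))"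

text \<open>As orthogonality is anti-reflexive, a family of pairwise orthogonal elements is given
  by its set of members.\<close>

definition partial_realization :: "('x, 's, 'c) hierarchy \<Rightarrow> real \<Rightarrow> bool" where
  "partial_realization H \<alpha> \<longleftrightarrow>
     (\<forall>\<V> p. \<V> \<subseteq> idx H \<and> (\<forall>V\<in>\<V>. \<forall>W\<in>\<V>. V \<noteq> W \<longrightarrow> orth H V W) \<and>
             (\<forall>V\<in>\<V>. p V \<in> proj_image H V) \<longrightarrow>
        (\<exists>x\<in>pts H. \<forall>V\<in>\<V>.
           set_dist (dC H V) (proj H V x) {p V} \<le> ennreal \<alpha> \<and>
           (\<forall>W\<in>idx H. pnest H V W \<or> transverse H W V \<longrightarrow>
              set_dist (dC H W) (proj H W x) (rho H V W) \<le> ennreal \<alpha>)))"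

definition uniqueness :: "('x, 's, 'c) hierarchy \<Rightarrow> bool" where
  "uniqueness H \<longleftrightarrow>
     (\<forall>\<kappa>\<ge>0. \<exists>\<theta>. \<forall>x\<in>pts H. \<forall>y\<in>pts H. \<theta> \<le> dX H x y \<longrightarrow> (\<exists>V\<in>idx H. \<kappa> \<le> dproj H V x y))"

definition hierarchical_space :: "('x, 's, 'c) hierarchy \<Rightarrow> bool" where
  "hierarchical_space H \<longleftrightarrow>
     (\<exists>q. quasigeodesic_space q (pts H) (dX H)) \<and>
     (\<forall>W\<in>idx H. geodesic_space (cspace H W) (dC H W)) \<and>
     (\<exists>\<xi>\<ge>0. \<exists>K\<ge>0. \<exists>\<kappa>\<^sub>0\<ge>0.
        projections H \<xi> K \<and> nesting H \<xi> \<and> orthogonality H \<and> consistency H \<xi> \<kappa>\<^sub>0 \<and>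
        (\<exists>lam\<ge>1. \<exists>E\<ge>max \<xi> \<kappa>\<^sub>0. large_links H lam E)) \<and>
     (\<exists>n. finite_complexity H n) \<and>
     (\<exists>E>0. bounded_geodesic_image H E) \<and>
     (\<exists>\<alpha>\<ge>0. partial_realization H \<alpha>) \<and>
     uniqueness H"

definition nest_minimal :: "('x, 's, 'c) hierarchy \<Rightarrow> 's \<Rightarrow> bool" where
  "nest_minimal H U \<longleftrightarrow> (\<forall>V\<in>idx H. \<not> pnest H V U)"

definition coarsely_surjective :: "real \<Rightarrow> ('x, 's, 'c) hierarchy \<Rightarrow> 's \<Rightarrow> bool" where
  "coarsely_surjective E H U \<longleftrightarrow>
     cspace H U \<subseteq> nbhd (cspace H U) (dC H U) E (proj_image H U)"

definition relatively_hierarchically_hyperbolic :: "('x, 's, 'c) hierarchy \<Rightarrow> bool" where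
  "relatively_hierarchically_hyperbolic H \<longleftrightarrow>
     hierarchical_space H \<and>
     (\<exists>\<delta>\<ge>0. \<exists>E\<ge>0. \<forall>U\<in>idx H.
        (nest_minimal H U \<or> hyperbolic \<delta> (cspace H U) (dC H U)) \<and>
        (nest_minimal H U \<and> \<not> hyperbolic \<delta> (cspace H U) (dC H U) \<longrightarrow>
           coarsely_surjective E H U))"


section \<open>Thresholds and coarse equality\<close>

definition threshold :: "real \<Rightarrow> real \<Rightarrow> real" where
  "threshold B A = (if A \<ge> B then A else 0)"

definition coarse_eq :: "real \<Rightarrow> real \<Rightarrow> real \<Rightarrow> real \<Rightarrow> bool" where
  "coarse_eq K C A B \<longleftrightarrow> inverse K * A - C \<le> B \<and> B \<le> K * A + C"

end

theory Submission
  imports Defs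
begin

text \<open>For the bound of the sum by \<open>d\<^sub>\<X>(x,y)\<close>, follow a quasigeodesic from \<open>x\<close> to \<open>y\<close>. By
  transverse consistency, a point can be far from both \<open>x\<close> and \<open>y\<close> only in boundedly many of the
  domains that separate \<open>x\<close> from \<open>y\<close>, and each such domain \<open>U\<close> uses up at least a multiple of
  \<open>d\<^sub>U(x,y)\<close> points of the quasigeodesic.

  Conversely, a chain from \<open>x\<close> to \<open>y\<close> is built by induction on the depth \<open>k\<close> in the nesting order,
  its steps being bounded in all domains of depth less than \<open>k\<close>. By large links a step sees
  boundedly many domains of depth \<open>k\<close> that move a lot, and gates (points with prescribed
  coordinates in pairwise orthogonal domains, obtained from partial realization) separate these
  into single jumps. Freezing domains in which the chain jumps again later, one arranges that it
  jumps at most once in every domain \<open>T\<close>. A jump in \<open>T\<close> exceeding \<open>d\<^sub>T(x,y)\<close> must be undone by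
  drifting through small steps; as domains drift in a tree-like pattern, the total drift is
  linear in the number of steps. Subdividing the jumps gives a chain of depth \<open>k + 1\<close> whose
  length is linear in the sum. Uniqueness bounds the steps of the final chain in \<open>\<X>\<close>.\<close>

section \<open>Coarse hierarchies and relevant domains\<close>

text \<open>The obstacle to bounding the distance by the sum is backtracking. Cutting a chain at one
  more level yields few pieces, but these may run to and fro in one domain \<open>T\<close>, and
  subdividing them would then cost far more than \<open>d T x y\<close>. Hence the total length of
  the jumps has to be controlled, not only their number; with a single jump per domain, the excess
  over \<open>d T x y\<close> is the drift before and after that jump.

  Partial realization says nothing about domains orthogonal to the given family. Moving one
  coordinate while all others stay still needs points that are controlled there too; this is the
  purpose of gates.

  The induction runs downwards from the top of the nesting order because large links bound the
  number of relevant domains at a level only when the domains above them move a bounded amount. The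
  bound \<open>R\<close> on small steps grows at every level, which is harmless as there are
  finitely many levels. The threshold \<open>s\<close> enters where jumps are compared with the sum:
  each discarded term costs at most \<open>s\<close>, and there are no more of them than
  steps.\<close>

definition transversal :: "('s \<Rightarrow> 's \<Rightarrow> bool) \<Rightarrow> ('s \<Rightarrow> 's \<Rightarrow> bool) \<Rightarrow> 's \<Rightarrow> 's \<Rightarrow> bool" where
  "transversal nst ort U V \<longleftrightarrow> \<not> ort U V \<and> \<not> nst U V \<and> \<not> nst V U"

definition marks :: "('s \<Rightarrow> 's \<Rightarrow> bool) \<Rightarrow> ('s \<Rightarrow> 's \<Rightarrow> bool) \<Rightarrow> 's \<Rightarrow> 's \<Rightarrow> bool" where
  "marks nst ort U V \<longleftrightarrow> nst U V \<and> U \<noteq> V \<or> transversal nst ort U V"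

lemma crossing:
  fixes f :: "nat \<Rightarrow> real"
  assumes "f l \<le> a" "a < b" "b \<le> f m" "l \<le> m"
  obtains s t where "l \<le> s" "s < t" "t \<le> m" "f s \<le> a" "b \<le> f t"
    "\<And>i. s < i \<Longrightarrow> i < t \<Longrightarrow> a < f i \<and> f i < b"
proof -
  define t where "t = (LEAST i. l \<le> i \<and> b \<le> f i)"
  have t: "l \<le> t" "b \<le> f t"
    using LeastI[of "\<lambda>i. l \<le> i \<and> b \<le> f i" m] assms unfolding t_def by auto
  have tm: "t \<le> m"
    unfolding t_def using assms by (intro Least_le) auto
  have tl: "f i < b" if "l \<le> i" "i < t" for i
    using not_less_Least[of i "\<lambda>i. l \<le> i \<and> b \<le> f i"] that unfolding t_def by auto
  define S where "S = {i. l \<le> i \<and> i \<le> t \<and> f i \<le> a}"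
  have S: "finite S" "l \<in> S"
    using assms t by (auto simp: S_def)
  define s where "s = Max S"
  have "s \<in> S"
    using S Max_in[of S] unfolding s_def by blast
  then have s: "l \<le> s" "s \<le> t" "f s \<le> a"
    by (auto simp: S_def)
  have "s \<noteq> t"
    using s t assms by auto
  have "a < f i" if "s < i" "i < t" for i
  proof (rule ccontr)
    assume "\<not> a < f i"
    with that s have "i \<in> S"
      by (auto simp: S_def)
    then have "i \<le> s"
      using S unfolding s_def by simp
    with that show False by simp
  qed
  with \<open>s \<noteq> t\<close> s tm t tl show thesis
    by (intro that[of s t]) auto
qed

lemma steps_bound:
  fixes f :: "nat \<Rightarrow> real"
  assumes "s \<le> t" "\<And>i. s \<le> i \<Longrightarrow> i < t \<Longrightarrow> f (Suc i) \<le> f i + R"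
  shows "f t \<le> f s + R * real (t - s)"
  using assms
proof (induction t rule: dec_induct)
  case (step t)
  then have "f (Suc t) \<le> f t + R" "f t \<le> f s + R * real (t - s)" by auto
  with step(1) show ?case
    by (simp add: Suc_diff_le algebra_simps)
qed simp

text \<open>An abstract hierarchical space, remembering only coarse distances: \<open>d V x y\<close> is the
  distance of the projections to \<open>\<C>V\<close>, \<open>r V U x\<close> is the distance in \<open>\<C>V\<close> from the projection
  of \<open>x\<close> to \<open>\<rho>\<^sup>U\<^sub>V\<close>, which exists when \<open>marks nst orth U V\<close>, and \<open>lev\<close> is the depth below the
  maximal element. All coarse constants are merged into \<open>\<kappa>\<close>.\<close>

locale coarse_hierarchy =
  fixes X :: "'x set" and I :: "'s set"
    and nst orth :: "'s \<Rightarrow> 's \<Rightarrow> bool"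
    and lev :: "'s \<Rightarrow> nat" and n :: nat
    and d :: "'s \<Rightarrow> 'x \<Rightarrow> 'x \<Rightarrow> real"
    and r :: "'s \<Rightarrow> 's \<Rightarrow> 'x \<Rightarrow> real"
    and \<kappa> :: real
  assumes kappa: "1 \<le> \<kappa>"
    and nst_refl: "V \<in> I \<Longrightarrow> nst V V"
    and nst_trans: "U \<in> I \<Longrightarrow> V \<in> I \<Longrightarrow> W \<in> I \<Longrightarrow> nst U V \<Longrightarrow> nst V W \<Longrightarrow> nst U W"
    and nst_top: "I \<noteq> {} \<Longrightarrow> \<exists>S\<in>I. \<forall>V\<in>I. nst V S"
    and orth_sym: "V \<in> I \<Longrightarrow> W \<in> I \<Longrightarrow> orth V W \<Longrightarrow> orth W V"
    and orth_nst: "U \<in> I \<Longrightarrow> V \<in> I \<Longrightarrow> W \<in> I \<Longrightarrow> nst V W \<Longrightarrow> orth W U \<Longrightarrow> orth V U"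
    and orth_not_nst: "V \<in> I \<Longrightarrow> W \<in> I \<Longrightarrow> orth V W \<Longrightarrow> \<not> nst V W"
    and orth_card: "finite A \<Longrightarrow> A \<subseteq> I \<Longrightarrow> pairwise orth A \<Longrightarrow> card A \<le> n"
    and lev_less: "V \<in> I \<Longrightarrow> W \<in> I \<Longrightarrow> nst V W \<Longrightarrow> V \<noteq> W \<Longrightarrow> lev W < lev V"
    and lev_bound: "V \<in> I \<Longrightarrow> lev V < n"
    and d_nonneg: "0 \<le> d V x y"
    and d_refl: "V \<in> I \<Longrightarrow> x \<in> X \<Longrightarrow> d V x x = 0"
    and d_sym: "V \<in> I \<Longrightarrow> x \<in> X \<Longrightarrow> y \<in> X \<Longrightarrow> d V x y = d V y x"
    and d_tri: "V \<in> I \<Longrightarrow> x \<in> X \<Longrightarrow> y \<in> X \<Longrightarrow> z \<in> X \<Longrightarrow> d V x z \<le> d V x y + d V y z + \<kappa>"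
    and d_le_r: "U \<in> I \<Longrightarrow> V \<in> I \<Longrightarrow> marks nst orth U V \<Longrightarrow> x \<in> X \<Longrightarrow> y \<in> X \<Longrightarrow>
                   d V x y \<le> r V U x + r V U y + \<kappa>"
    and r_le_d: "U \<in> I \<Longrightarrow> V \<in> I \<Longrightarrow> marks nst orth U V \<Longrightarrow> x \<in> X \<Longrightarrow> y \<in> X \<Longrightarrow>
                   r V U y \<le> r V U x + d V x y + \<kappa>"
    and r_nst: "U \<in> I \<Longrightarrow> W \<in> I \<Longrightarrow> V \<in> I \<Longrightarrow> nst U W \<Longrightarrow> marks nst orth W V \<Longrightarrow> \<not> orth V U \<Longrightarrow>
                   x \<in> X \<Longrightarrow> \<bar>r V U x - r V W x\<bar> \<le> \<kappa>"
    and consistent: "V \<in> I \<Longrightarrow> W \<in> I \<Longrightarrow> transversal nst orth V W \<Longrightarrow> x \<in> X \<Longrightarrow>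
                   r W V x \<le> \<kappa> \<or> r V W x \<le> \<kappa>"
    and links: "W \<in> I \<Longrightarrow> x \<in> X \<Longrightarrow> y \<in> X \<Longrightarrow>
                   \<exists>\<T>\<subseteq>I. finite \<T> \<and> real (card \<T>) \<le> \<kappa> * d W x y + \<kappa> \<and>
                     (\<forall>T\<in>\<T>. nst T W \<and> T \<noteq> W \<and> r W T x \<le> \<kappa> * d W x y + \<kappa>) \<and>
                     (\<forall>T\<in>I. nst T W \<and> T \<noteq> W \<longrightarrow> (\<exists>T'\<in>\<T>. nst T T') \<or> d T x y < \<kappa>)"
    and realization: "A \<subseteq> I \<Longrightarrow> pairwise orth A \<Longrightarrow> (\<And>V. V \<in> A \<Longrightarrow> e V \<in> X) \<Longrightarrow>
                   \<exists>x\<in>X. \<forall>V\<in>A. d V x (e V) \<le> \<kappa> \<and> (\<forall>W\<in>I. marks nst orth V W \<longrightarrow> r W V x \<le> \<kappa>)"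
    and interpolation: "T \<in> I \<Longrightarrow> x \<in> X \<Longrightarrow> y \<in> X \<Longrightarrow>
                   \<exists>p m. p 0 = x \<and> p m = y \<and> (\<forall>i. p i \<in> X) \<and>
                     (\<forall>i. d T (p i) (p (Suc i)) \<le> \<kappa>) \<and> real m \<le> d T x y + \<kappa>"
    and connected: "x \<in> X \<Longrightarrow> y \<in> X \<Longrightarrow>
                   \<exists>p m. p 0 = x \<and> p m = y \<and> (\<forall>i. p i \<in> X) \<and>
                     (\<forall>i. \<forall>V\<in>I. d V (p i) (p (Suc i)) \<le> \<kappa>)"
begin

abbreviation tr where "tr \<equiv> transversal nst orth"
abbreviation mk where "mk \<equiv> marks nst orth"

lemma tr_sym: "V \<in> I \<Longrightarrow> W \<in> I \<Longrightarrow> tr V W \<Longrightarrow> tr W V"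
  using orth_sym by (auto simp: transversal_def)

lemma mk_tr: "tr V W \<Longrightarrow> mk V W"
  by (simp add: marks_def)

lemma orth_irrefl: "V \<in> I \<Longrightarrow> \<not> orth V V"
  using nst_refl orth_not_nst by blast

lemma same_level_cases:
  assumes "V \<in> I" "W \<in> I" "lev V = lev W"
  shows "V = W \<or> orth V W \<or> tr V W"
  using assms lev_less[of V W] lev_less[of W V] by (fastforce simp: transversal_def)

lemma level_cases:
  assumes "V \<in> I" "W \<in> I" "lev V \<le> lev W"
  shows "V = W \<or> orth V W \<or> mk W V"
  using assms lev_less[of V W] orth_sym[of W V] by (fastforce simp: transversal_def marks_def)

text \<open>Suppose \<open>z\<close> is near the marker of \<open>V\<close> in \<open>U\<close>; the
  other case is symmetric. Then \<open>x\<close> and \<open>y\<close>, being far from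
  \<open>z\<close> in \<open>U\<close>, are far from that marker, so consistency puts both near the
  marker of \<open>U\<close> in \<open>V\<close>, and \<open>V\<close> cannot separate them.\<close>

lemma middle_orth:
  assumes UV: "U \<in> I" "V \<in> I" "tr U V" and X: "x \<in> X" "y \<in> X" "z \<in> X"
    and U: "3 * \<kappa> < d U x z" "3 * \<kappa> < d U z y" "3 * \<kappa> < d U x y"
    and V: "3 * \<kappa> < d V x z" "3 * \<kappa> < d V z y" "3 * \<kappa> < d V x y"
  shows False
proof -
  have key: False
    if "A \<in> I" "B \<in> I" "tr A B" "r A B z \<le> \<kappa>"
      "3 * \<kappa> < d A x z" "3 * \<kappa> < d A z y" "3 * \<kappa> < d B x y" for A B
  proof -
    have m: "mk A B" "mk B A"
      using that tr_sym mk_tr by blast+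
    have "r A B x > \<kappa>" "r A B y > \<kappa>"
      using d_le_r[OF that(2,1) m(2) X(1,3)] d_le_r[OF that(2,1) m(2) X(3,2)] that by auto
    then have "r B A x \<le> \<kappa>" "r B A y \<le> \<kappa>"
      using consistent[OF that(1-3)] X by force+
    with d_le_r[OF that(1,2) m(1) X(1,2)] that show False by simp
  qed
  from consistent[OF UV X(3)] show False
    using key[of U V] key[of V U] UV U V tr_sym by blast
qed

text \<open>Along a chain from \<open>x\<close> to \<open>y\<close> each relevant domain \<open>U\<close> is crossed by at least a multiple of
  \<open>d U x y\<close> points that are far from both ends in \<open>U\<close>, while a fixed point plays this role only
  for pairwise orthogonal domains of each level.\<close>

lemma relevant_sum_finite:
  assumes p: "\<And>i. p i \<in> X" "\<And>i V. V \<in> I \<Longrightarrow> d V (p i) (p (Suc i)) \<le> \<kappa>"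
    and A: "finite A" "A \<subseteq> I" "\<And>U. U \<in> A \<Longrightarrow> 18 * \<kappa> \<le> d U (p 0) (p m)"
  shows "(\<Sum>U\<in>A. d U (p 0) (p m)) \<le> 4 * \<kappa> * (real (n * n) * real (Suc m))"
proof -
  define mid where
    "mid U i \<longleftrightarrow> 3 * \<kappa> < d U (p 0) (p i) \<and> 3 * \<kappa> < d U (p i) (p m)" for U i
  have D: "d U (p 0) (p m) \<le> 4 * \<kappa> * card {i \<in> {..m}. mid U i}" if U: "U \<in> A" for U
  proof -
    have UI: "U \<in> I" using U A by auto
    define f where "f i = d U (p 0) (p i)" for i
    let ?D = "d U (p 0) (p m)"
    have D18: "18 * \<kappa> \<le> ?D" using A U by blast
    have f0: "f 0 \<le> 3 * \<kappa>" using d_refl UI p kappa by (simp add: f_def)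
    \<comment> \<open>Staying below \<open>?D - 4 * \<kappa>\<close> keeps a point more than
      \<open>3 * \<kappa>\<close> away from \<open>p m\<close>, since the coarse triangle inequality
      loses one more \<open>\<kappa>\<close>.\<close>
    have fm: "?D - 4 * \<kappa> \<le> f m" using kappa by (simp add: f_def)
    obtain s t where st: "s < t" "t \<le> m" "f s \<le> 3 * \<kappa>" "?D - 4 * \<kappa> \<le> f t"
      "\<And>i. s < i \<Longrightarrow> i < t \<Longrightarrow> 3 * \<kappa> < f i \<and> f i < ?D - 4 * \<kappa>"
      by (rule crossing[OF f0 _ fm]) (use D18 kappa in auto)
    have step: "f (Suc i) \<le> f i + 2 * \<kappa>" for i
      unfolding f_def using d_tri[OF UI p(1) p(1) p(1), of 0 "Suc i" i] p(2)[OF UI, of i] by simp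
    have "f t \<le> f s + 2 * \<kappa> * real (t - s)"
      by (rule steps_bound) (use st step in auto)
    moreover have "{s<..<t} \<subseteq> {i \<in> {..m}. mid U i}"
    proof
      fix i assume i: "i \<in> {s<..<t}"
      then have fi: "3 * \<kappa> < f i" "f i < ?D - 4 * \<kappa>" using st by auto
      then have "3 * \<kappa> < d U (p i) (p m)"
        using d_tri[OF UI p(1) p(1) p(1), of 0 m i] unfolding f_def by linarith
      with fi i st show "i \<in> {i \<in> {..m}. mid U i}"
        by (simp add: mid_def f_def)
    qed
    then have "card {s<..<t} \<le> card {i \<in> {..m}. mid U i}"
      by (intro card_mono) auto
    then have "real (t - s) \<le> real (card {i \<in> {..m}. mid U i}) + 1"
      using st by (simp add: of_nat_diff)
    then have "2 * \<kappa> * real (t - s) \<le> 2 * \<kappa> * (real (card {i \<in> {..m}. mid U i}) + 1)"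
      using kappa by (intro mult_left_mono) auto
    \<comment> \<open>This fixes \<open>18 * \<kappa>\<close>: so far \<open>?D\<close> is at most
      \<open>2 * \<kappa>\<close> times the number of middle points plus
      \<open>9 * \<kappa>\<close>, and \<open>9 * \<kappa>\<close> is at most half of
      \<open>?D\<close>.\<close>
    ultimately show ?thesis
      using st D18 by (simp add: algebra_simps)
  qed
  have card_mid: "card {U \<in> A. mid U i} \<le> n * n" for i
  proof -
    have "card {U \<in> A. mid U i \<and> lev U = l} \<le> n" for l
    proof (rule orth_card)
      show "pairwise orth {U \<in> A. mid U i \<and> lev U = l}"
      proof (rule pairwiseI)
        fix U V assume UV: "U \<in> {U \<in> A. mid U i \<and> lev U = l}"
          "V \<in> {U \<in> A. mid U i \<and> lev U = l}" "U \<noteq> V"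
        then have I: "U \<in> I" "V \<in> I" using A by auto
        have "\<not> tr U V"
          using middle_orth[OF I _ p(1)[of 0] p(1)[of m] p(1)[of i]] UV A(3)[of U] A(3)[of V] kappa
          by (auto simp: mid_def)
        then show "orth U V"
          using same_level_cases[OF I] UV by auto
      qed
    qed (use A in auto)
    moreover have "{U \<in> A. mid U i} = (\<Union>l\<in>{..<n}. {U \<in> A. mid U i \<and> lev U = l})"
      using lev_bound A by auto
    ultimately have "card {U \<in> A. mid U i} \<le> (\<Sum>l\<in>{..<n}. n)"
      by (metis (no_types, lifting) card_UN_le finite_lessThan order_trans sum_mono)
    then show ?thesis by simp
  qed
  have "(\<Sum>U\<in>A. d U (p 0) (p m)) \<le> (\<Sum>U\<in>A. 4 * \<kappa> * card {i \<in> {..m}. mid U i})"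
    using D by (rule sum_mono)
  also have "\<dots> = 4 * \<kappa> * real (\<Sum>U\<in>A. card {i \<in> {..m}. mid U i})"
    by (simp add: sum_distrib_left)
  also have "(\<Sum>U\<in>A. card {i \<in> {..m}. mid U i}) = (\<Sum>i\<in>{..m}. card {U \<in> A. mid U i})"
    using sum.swap_restrict[OF A(1), of "{..m}" "\<lambda>_ _. 1::nat" mid] by simp
  also have "\<dots> \<le> (\<Sum>i\<in>{..m}. n * n)"
    by (rule sum_mono) (rule card_mid)
  finally have "(\<Sum>U\<in>A. d U (p 0) (p m)) \<le> 4 * \<kappa> * real (\<Sum>i\<in>{..m}. n * n)" 
    using kappa by (simp add: mult_left_mono)
  then show ?thesis by (simp add: algebra_simps)
qed

lemma relevant_sum:
  assumes p: "\<And>i. p i \<in> X" "\<And>i V. V \<in> I \<Longrightarrow> d V (p i) (p (Suc i)) \<le> \<kappa>"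
    and s: "18 * \<kappa> \<le> s"
  shows "finite {U \<in> I. s \<le> d U (p 0) (p m)}"
    and "(\<Sum>U | U \<in> I \<and> s \<le> d U (p 0) (p m). d U (p 0) (p m))
           \<le> 4 * \<kappa> * (real (n * n) * real (Suc m))"
proof -
  let ?S = "{U \<in> I. s \<le> d U (p 0) (p m)}"
  let ?C = "4 * \<kappa> * (real (n * n) * real (Suc m))"
  \<comment> \<open>Every term is at least 1, so the uniform bound on finite subsums also bounds the
    size of finite subsets.\<close>
  have "card A \<le> nat \<lfloor>?C\<rfloor>" if A: "A \<subseteq> ?S" "finite A" for A
  proof -
    have "real (card A) \<le> (\<Sum>U\<in>A. d U (p 0) (p m))"
      using sum_bounded_below[of A 1 "\<lambda>U. d U (p 0) (p m)"] A s kappa by fastforce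
    also have "\<dots> \<le> ?C"
      by (rule relevant_sum_finite[where p = p]) (use A s p in auto)
    finally show ?thesis by linarith
  qed
  then show fin: "finite ?S"
    using finite_if_finite_subsets_card_bdd by blast
  show "(\<Sum>U | U \<in> I \<and> s \<le> d U (p 0) (p m). d U (p 0) (p m)) \<le> ?C"
    by (rule relevant_sum_finite[where p = p]) (use fin s p in auto)
qed

lemma finite_relevant:
  assumes "x \<in> X" "y \<in> X" "18 * \<kappa> \<le> s"
  shows "finite {U \<in> I. s \<le> d U x y}"
proof -
  from connected[OF assms(1,2)] obtain p m where
    "p 0 = x" "p m = y" "\<And>i. p i \<in> X" "\<And>i V. V \<in> I \<Longrightarrow> d V (p i) (p (Suc i)) \<le> \<kappa>" by blast
  then show ?thesis
    using relevant_sum(1)[of p s m] assms(3) by simp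
qed

definition nearc :: "real \<Rightarrow> real" where
  "nearc R = \<kappa> * R + R + 4 * \<kappa>"

text \<open>Transverse case: if both points were far from the marker of \<open>T\<close> in
  \<open>V\<close>, consistency would put both near one marker in \<open>T\<close>, which separates
  them. Nested case: large links for \<open>V\<close> place \<open>T\<close> below some
  \<open>T'\<close> whose marker is near \<open>x\<close>, and \<open>r_nst\<close> passes from
  \<open>T'\<close> to \<open>T\<close>. The value \<open>nearc R\<close> covers both cases.\<close>

lemma near_marker:
  assumes I: "T \<in> I" "V \<in> I" "mk T V" and X: "x \<in> X" "y \<in> X"
    and R: "d V x y \<le> R" and T: "3 * \<kappa> < d T x y"
  shows "r V T x \<le> nearc R"
proof -
  have R0: "0 \<le> R" using d_nonneg[of V x y] R by linarith
  have kR: "\<kappa> * d V x y \<le> \<kappa> * R"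
    using R kappa by (intro mult_left_mono) auto
  have kR0: "0 \<le> \<kappa> * R" using R0 kappa by simp
  show ?thesis
  proof (cases "tr T V")
    case True
    have m: "mk V T" using True I tr_sym mk_tr by blast
    have "r V T x \<le> \<kappa> \<or> r V T y \<le> \<kappa>"
    proof (rule ccontr)
      assume "\<not> ?thesis"
      then have "r T V x \<le> \<kappa>" "r T V y \<le> \<kappa>"
        using consistent[OF I(1,2) True] X by blast+
      with d_le_r[OF I(2,1) m X] T show False by simp
    qed
    moreover have "r V T x \<le> r V T y + R + \<kappa>"
      using r_le_d[OF I X(2,1)] d_sym[OF I(2) X] R by simp
    ultimately show ?thesis
      using kR0 R0 kappa unfolding nearc_def by linarith
  next
    case False
    then have TV: "nst T V" "T \<noteq> V" using I by (auto simp: marks_def)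
    from links[OF I(2) X] obtain \<T> where \<T>: "\<T> \<subseteq> I"
      "\<forall>T\<in>\<T>. nst T V \<and> T \<noteq> V \<and> r V T x \<le> \<kappa> * d V x y + \<kappa>"
      "\<forall>T\<in>I. nst T V \<and> T \<noteq> V \<longrightarrow> (\<exists>T'\<in>\<T>. nst T T') \<or> d T x y < \<kappa>" by blast
    with I TV T kappa obtain T' where T': "T' \<in> \<T>" "nst T T'" by fastforce
    have "\<not> orth V T"
      using TV I orth_sym orth_not_nst by blast
    then have "\<bar>r V T x - r V T' x\<bar> \<le> \<kappa>"
      using r_nst[of T T' V] \<T> T' I X by (auto simp: marks_def)
    moreover have "r V T' x \<le> \<kappa> * d V x y + \<kappa>" using \<T> T' by blast
    ultimately show ?thesis
      using kR R0 kappa unfolding nearc_def by linarith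
  qed
qed

end

section \<open>Gates\<close>

context coarse_hierarchy begin

text \<open>This is the usual order on the domains separating two points: \<open>A\<close> has to be
  crossed before \<open>B\<close> on the way from \<open>w\<close>. Only the starting point enters
  the definition, so that one relation serves all endpoints along a path.\<close>

definition before :: "'x \<Rightarrow> 's \<Rightarrow> 's \<Rightarrow> bool" where
  "before w A B \<longleftrightarrow> tr A B \<and> r B A w \<le> \<kappa>"

lemma before_cases:
  assumes "A \<in> I" "B \<in> I" "tr A B" "w \<in> X"
  shows "before w A B \<or> before w B A"
  using consistent[OF assms] assms tr_sym[of A B] by (auto simp: before_def)

text \<open>In \<open>B\<close> the point \<open>z\<close> has left the marker of \<open>A\<close>,
  so consistency puts it near the marker of \<open>B\<close> in \<open>A\<close>: once
  \<open>B\<close> is crossed, \<open>A\<close> is finished.\<close>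

lemma before_target:
  assumes I: "A \<in> I" "B \<in> I" and X: "w \<in> X" "z \<in> X"
    and b: "before w A B" and B: "3 * \<kappa> < d B w z"
  shows "r A B z \<le> \<kappa>"
proof (rule ccontr)
  assume "\<not> ?thesis"
  then have "r B A z \<le> \<kappa>"
    using consistent[OF I _ X(2)] b by (auto simp: before_def)
  then show False
    using d_le_r[OF I mk_tr X] b B by (auto simp: before_def)
qed

lemma before_asym:
  assumes I: "A \<in> I" "B \<in> I" and X: "w \<in> X" "z \<in> X"
    and "3 * \<kappa> < d A w z" "3 * \<kappa> < d B w z" "before w A B"
  shows "\<not> before w B A"
proof
  assume "before w B A"
  with before_target[OF I X assms(7,6)] d_le_r[OF I(2,1) mk_tr X] assms(5)
  show False by (auto simp: before_def)
qed

text \<open>Partial realization supplies test points. If \<open>U\<close> and \<open>W\<close> were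
  orthogonal, a point realizing both would be near both their markers in \<open>V\<close>, and
  \<open>V\<close> could not separate \<open>w\<close> from \<open>z\<close>. If \<open>W\<close>
  came before \<open>U\<close>, consistency of \<open>U\<close> and \<open>W\<close> at a point
  realizing \<open>V\<close> would make \<open>U\<close> or \<open>W\<close> too small. The bound
  \<open>7 * \<kappa>\<close> is two estimates \<open>3 * \<kappa>\<close> plus the triangle
  error.\<close>

lemma before_trans:
  assumes I: "U \<in> I" "V \<in> I" "W \<in> I" and X: "w \<in> X" "z \<in> X"
    and big: "7 * \<kappa> < d U w z" "7 * \<kappa> < d V w z" "7 * \<kappa> < d W w z"
    and UV: "before w U V" and VW: "before w V W" and UW: "\<not> nst U W" "\<not> nst W U"
  shows "before w U W"
proof -
  have big3: "3 * \<kappa> < d U w z" "3 * \<kappa> < d V w z" "3 * \<kappa> < d W w z"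
    using big kappa by linarith+
  have rUV: "r U V z \<le> \<kappa>" and rVW: "r V W z \<le> \<kappa>"
    using before_target[OF I(1,2) X UV big3(2)] before_target[OF I(2,3) X VW big3(3)] by auto
  have m: "mk U V" "mk V U" "mk V W" "mk W V"
    using UV VW I tr_sym mk_tr unfolding before_def by blast+
  have nUW: "U \<noteq> W" using UW I nst_refl by blast
  have "\<not> orth U W"
  proof
    assume o: "orth U W"
    have pw: "pairwise orth {U, W}" using o orth_sym I by (auto simp: pairwise_def)
    have "{U, W} \<subseteq> I" using I by simp
    from realization[OF this pw, of "\<lambda>_. w"] X obtain q where
      q: "q \<in> X" "\<forall>A\<in>{U, W}. \<forall>B\<in>I. mk A B \<longrightarrow> r B A q \<le> \<kappa>" by blast
    then have "r V U q \<le> \<kappa>" "r V W q \<le> \<kappa>" using m I by auto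
    then have "d V w q \<le> 3 * \<kappa>" "d V q z \<le> 3 * \<kappa>"
      using d_le_r[OF I(1,2) m(1) X(1) q(1)] d_le_r[OF I(3,2) m(4) q(1) X(2)] UV rVW
      by (auto simp: before_def)
    then show False
      using d_tri[OF I(2) X(1) q(1) X(2)] big kappa by linarith
  qed
  with UW have trUW: "tr U W" by (auto simp: transversal_def)
  then have trWU: "tr W U" using tr_sym I by blast
  show ?thesis
  proof (rule ccontr)
    assume "\<not> ?thesis"
    then have WU: "before w W U" using before_cases[OF I(1,3) trUW X(1)] by blast
    have rWU: "r W U z \<le> \<kappa>" by (rule before_target[OF I(3,1) X WU big3(1)])
    from realization[of "{V}" "\<lambda>_. w"] I X obtain q where
      q: "q \<in> X" "\<forall>B\<in>I. mk V B \<longrightarrow> r B V q \<le> \<kappa>" by (auto simp: pairwise_def)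
    then have qU: "r U V q \<le> \<kappa>" and qW: "r W V q \<le> \<kappa>" using m I by auto
    from consistent[OF I(1,3) trUW q(1)] show False
    proof
      assume "r W U q \<le> \<kappa>"
      then have "d W z q \<le> 3 * \<kappa>"
        using d_le_r[OF I(1,3) mk_tr[OF trUW] X(2) q(1)] rWU by simp
      moreover have "d W w q \<le> 3 * \<kappa>"
        using d_le_r[OF I(2,3) m(3) X(1) q(1)] qW VW by (simp add: before_def)
      ultimately show False
        using d_tri[OF I(3) X(1) q(1) X(2)] d_sym[OF I(3) X(2) q(1)] big kappa by linarith
    next
      assume "r U W q \<le> \<kappa>"
      then have "d U w q \<le> 3 * \<kappa>"
        using d_le_r[OF I(3,1) mk_tr[OF trWU] X(1) q(1)] WU by (simp add: before_def)
      moreover have "d U z q \<le> 3 * \<kappa>"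
        using d_le_r[OF I(2,1) m(2) X(2) q(1)] qU rUV by simp
      ultimately show False
        using d_tri[OF I(1) X(1) q(1) X(2)] d_sym[OF I(1) X(2) q(1)] big kappa by linarith
    qed
  qed
qed

text \<open>The choice is a \<open>before\<close>-maximal \<open>g\<close> among the nest-maximal
  members of \<open>B\<close>. A member \<open>V\<close> transverse to \<open>g\<close> lies below a
  maximal \<open>W\<close> that comes before \<open>g\<close>; \<open>r_nst\<close> transfers this
  to \<open>V\<close>, so \<open>V\<close> is finished once \<open>g\<close> is crossed.\<close>

lemma last_relevant:
  assumes B: "finite B" "B \<noteq> {}" "B \<subseteq> I" and X: "w \<in> X" "z \<in> X"
    and big: "\<And>V. V \<in> B \<Longrightarrow> 7 * \<kappa> < d V w z"
  obtains g where "g \<in> B" "\<And>V. V \<in> B \<Longrightarrow> nst g V \<Longrightarrow> V = g"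
    "\<And>V. V \<in> B \<Longrightarrow> tr g V \<Longrightarrow> r V g z \<le> \<kappa>"
proof -
  have big3: "3 * \<kappa> < d V w z" if "V \<in> B" for V
    using big[OF that] kappa by linarith
  define M where "M = {V \<in> B. \<forall>W\<in>B. nst V W \<longrightarrow> W = V}"
  have above: "\<exists>W\<in>M. nst V W" if "V \<in> B" for V
    using that
  proof (induction "lev V" arbitrary: V rule: less_induct)
    case less
    show ?case
    proof (cases "V \<in> M")
      case True
      then show ?thesis using nst_refl less.prems B by blast
    next
      case False
      then obtain W where W: "W \<in> B" "nst V W" "W \<noteq> V"
        using less.prems by (auto simp: M_def)
      then have "lev W < lev V" using lev_less[of V W] less.prems B by blast
      from less.hyps[OF this W(1)] obtain W' where "W' \<in> M" "nst W W'" by blast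
      moreover have "W' \<in> I" using calculation B by (auto simp: M_def)
      ultimately show ?thesis using nst_trans[of V W W'] less.prems W B by blast
    qed
  qed
  have M: "finite M" "M \<noteq> {}" "M \<subseteq> B"
    using B above by (auto simp: M_def)
  have incomp: "\<not> nst U W" if "U \<in> M" "W \<in> M" "U \<noteq> W" for U W
    using that by (auto simp: M_def)
  have asym: "asymp_on M (before w)"
    using before_asym[OF _ _ X] big3 M B by (intro asymp_onI) blast
  moreover have "transp_on M (before w)"
  proof (rule transp_onI)
    fix U V W assume UVW: "U \<in> M" "V \<in> M" "W \<in> M" "before w U V" "before w V W"
    then have "U \<noteq> W" using asym by (meson asymp_onD)
    then show "before w U W"
      using before_trans[OF _ _ _ X, of U V W] big UVW M B incomp by blast
  qed
  ultimately obtain g where g: "g \<in> M" "\<And>V. V \<in> M \<Longrightarrow> V \<noteq> g \<Longrightarrow> \<not> before w g V"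
    using Finite_Set.bex_max_element[OF M(1) _ _ M(2)] by blast
  have gI: "g \<in> I" using g M B by blast
  show thesis
  proof (rule that)
    show "g \<in> B" using g M by blast
    show "V = g" if "V \<in> B" "nst g V" for V using g that by (auto simp: M_def)
    fix V assume V: "V \<in> B" "tr g V"
    then have VI: "V \<in> I" using B by blast
    obtain W where W: "W \<in> M" "nst V W" using above V by blast
    have WI: "W \<in> I" using W M B by blast
    have "W \<noteq> g" using V W by (auto simp: transversal_def)
    have "\<not> orth g V" using V by (simp add: transversal_def)
    then have "\<not> orth W g"
      using orth_nst[OF gI VI WI W(2)] orth_sym[OF VI gI] by blast
    then have Wg: "tr W g" using incomp W g \<open>W \<noteq> g\<close> by (auto simp: transversal_def)
    then have "before w W g"
      using before_cases[OF WI gI Wg X(1)] g(2)[OF W(1) \<open>W \<noteq> g\<close>] by blast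
    then have "r g W w \<le> \<kappa>" by (simp add: before_def)
    moreover have "\<bar>r g V w - r g W w\<bar> \<le> \<kappa>"
      using r_nst[OF VI WI gI W(2) mk_tr[OF Wg]] V X by (simp add: transversal_def)
    ultimately have gw: "r g V w \<le> 2 * \<kappa>" by simp
    show "r V g z \<le> \<kappa>"
    proof (rule ccontr)
      assume "\<not> ?thesis"
      then have "r g V z \<le> \<kappa>" using consistent[OF gI VI V(2) X(2)] by blast
      then have "d g w z \<le> 4 * \<kappa>"
        using d_le_r[OF VI gI mk_tr[OF tr_sym[OF gI VI V(2)]] X] gw by simp
      then show False using big[of g] g M kappa by fastforce
    qed
  qed
qed

text \<open>The known object is a gate of \<open>z\<close> in the standard product region of the
  family \<open>G\<close>, with the coordinates in \<open>G\<close> replaced by those of the points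
  \<open>e U\<close>.\<close>

definition is_gate :: "real \<Rightarrow> 's set \<Rightarrow> ('s \<Rightarrow> 'x) \<Rightarrow> 'x \<Rightarrow> 'x \<Rightarrow> bool" where
  "is_gate \<gamma> G e z w \<longleftrightarrow> w \<in> X \<and>
     (\<forall>U\<in>G. d U w (e U) \<le> \<gamma> \<and> (\<forall>V\<in>I. mk U V \<longrightarrow> r V U w \<le> \<gamma>)) \<and>
     (\<forall>V\<in>I. (\<forall>W\<in>G. orth V W) \<longrightarrow> d V w z \<le> \<gamma>)"

lemma is_gate_mono: "is_gate \<gamma> G e z w \<Longrightarrow> \<gamma> \<le> \<gamma>' \<Longrightarrow> is_gate \<gamma>' G e z w"
  unfolding is_gate_def by (meson order_trans)

text \<open>The point is obtained from partial realizations of ever finer families \<open>F\<close> orthogonal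
  to \<open>G\<close>: as long as some domain orthogonal to \<open>G\<close> sees the realized point far from \<open>z\<close>,
  the last such domain on the way to \<open>z\<close> is added to \<open>F\<close>, replacing the member above it.
  This increases \<open>\<Sum>U\<in>F. Suc (lev U)\<close>, which is at most \<open>n * n\<close>.\<close>

lemma gate_iteration:
  "\<exists>\<gamma>. \<forall>F G e z. finite (F \<union> G) \<longrightarrow> F \<union> G \<subseteq> I \<longrightarrow> F \<inter> G = {} \<longrightarrow>
     pairwise orth (F \<union> G) \<longrightarrow> (\<forall>U\<in>G. e U \<in> X) \<longrightarrow> z \<in> X \<longrightarrow>
     (\<forall>U\<in>F. \<forall>V\<in>I. (\<forall>W\<in>G. orth V W) \<and> mk U V \<longrightarrow> r V U z \<le> c) \<longrightarrow>
     n * n < (\<Sum>U\<in>F. Suc (lev U)) + j \<longrightarrow> (\<exists>w. is_gate \<gamma> G e z w)"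
proof (induction j arbitrary: c)
  case 0
  have "(\<Sum>U\<in>F. Suc (lev U)) \<le> n * n"
    if "finite (F \<union> G)" "F \<union> G \<subseteq> I" "pairwise orth (F \<union> G)" for F G
  proof -
    have "pairwise orth F" using that(3) by (rule pairwise_mono) auto
    then have "card F \<le> n" using orth_card[of F] that by auto
    have "(\<Sum>U\<in>F. Suc (lev U)) \<le> (\<Sum>U\<in>F. n)"
      using lev_bound that by (intro sum_mono) fastforce
    also have "\<dots> \<le> n * n" using \<open>card F \<le> n\<close> by simp
    finally show ?thesis .
  qed
  then show ?case by (auto simp: not_less[symmetric])
next
  case (Suc j)
  \<comment> \<open>Domains that belong to \<open>F\<close> or are marked by a member of
    \<open>F\<close> see \<open>w\<close> and \<open>z\<close> at distance at most
    \<open>c + 2 * \<kappa>\<close>, so \<open>c1\<close> excludes them as candidates for the next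
    member; \<open>18 * \<kappa>\<close> makes the candidates finite in number. The new invariant
    \<open>c2\<close> allows for the marker of the added domain.\<close>
  define c1 where "c1 = max c 0 + 18 * \<kappa>"
  define c2 where "c2 = max c (nearc c1)"
  obtain \<gamma> where IH: "\<forall>F G e z. finite (F \<union> G) \<longrightarrow> F \<union> G \<subseteq> I \<longrightarrow> F \<inter> G = {} \<longrightarrow>
     pairwise orth (F \<union> G) \<longrightarrow> (\<forall>U\<in>G. e U \<in> X) \<longrightarrow> z \<in> X \<longrightarrow>
     (\<forall>U\<in>F. \<forall>V\<in>I. (\<forall>W\<in>G. orth V W) \<and> mk U V \<longrightarrow> r V U z \<le> c2) \<longrightarrow>
     n * n < (\<Sum>U\<in>F. Suc (lev U)) + j \<longrightarrow> (\<exists>w. is_gate \<gamma> G e z w)"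
    using Suc[of c2] by (elim exE)
  show ?case
  proof (intro exI[of _ "max \<gamma> (max \<kappa> c1)"] allI impI)
    fix F G e z
    assume fin: "finite (F \<union> G)" and I: "F \<union> G \<subseteq> I" and disj: "F \<inter> G = {}"
      and pw: "pairwise orth (F \<union> G)" and e: "\<forall>U\<in>G. e U \<in> X" and z: "z \<in> X"
      and inv: "\<forall>U\<in>F. \<forall>V\<in>I. (\<forall>W\<in>G. orth V W) \<and> mk U V \<longrightarrow> r V U z \<le> c"
      and meas: "n * n < (\<Sum>U\<in>F. Suc (lev U)) + Suc j"
    let ?e = "\<lambda>U. if U \<in> G then e U else z"
    obtain w where w: "w \<in> X" "\<And>V. V \<in> F \<union> G \<Longrightarrow> d V w (?e V) \<le> \<kappa>"
      "\<And>V W. V \<in> F \<union> G \<Longrightarrow> W \<in> I \<Longrightarrow> mk V W \<Longrightarrow> r W V w \<le> \<kappa>"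
    proof -
      have "?e V \<in> X" for V using e z by simp
      from realization[OF I pw, of ?e, OF this] show thesis
        by (elim bexE) (rule that; blast)
    qed
    define B where "B = {V \<in> I. c1 \<le> d V w z} \<inter> {V. \<forall>W\<in>G. orth V W}"
    have k: "\<kappa> \<ge> 1" by (rule kappa)
    have finB: "finite B"
      unfolding B_def using finite_relevant[OF w(1) z, of c1] by (auto simp: c1_def)
    show "\<exists>w. is_gate (max \<gamma> (max \<kappa> c1)) G e z w"
    proof (cases "B = {}")
      case True
      have "is_gate (max \<kappa> c1) G e z w"
        unfolding is_gate_def
      proof (intro conjI ballI impI w(1))
        fix U assume U: "U \<in> G"
        then show "d U w (e U) \<le> max \<kappa> c1" using w(2)[of U] by auto
        fix V assume "V \<in> I" "mk U V"
        then show "r V U w \<le> max \<kappa> c1" using w(3)[of U V] U by auto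
      next
        fix V assume V: "V \<in> I" "\<forall>W\<in>G. orth V W"
        with True have "\<not> c1 \<le> d V w z" by (auto simp: B_def)
        then show "d V w z \<le> max \<kappa> c1" by linarith
      qed
      then show ?thesis using is_gate_mono max.cobounded2 by blast
    next
      case False
      have BI: "B \<subseteq> I" by (auto simp: B_def)
      have big: "7 * \<kappa> < d V w z" if "V \<in> B" for V
        using that k by (auto simp: B_def c1_def)
      obtain g where g: "g \<in> B" "\<And>V. V \<in> B \<Longrightarrow> nst g V \<Longrightarrow> V = g"
        "\<And>V. V \<in> B \<Longrightarrow> tr g V \<Longrightarrow> r V g z \<le> \<kappa>"
        using last_relevant[OF finB False BI w(1) z big] by metis
      have gI: "g \<in> I" and gG: "\<forall>W\<in>G. orth g W" and gc: "c1 \<le> d g w z"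
        using g by (auto simp: B_def)
      have "g \<notin> G" using gG orth_irrefl gI by blast
      have free: "orth g U \<or> nst g U \<and> g \<noteq> U" if U: "U \<in> F" for U
      proof (rule ccontr)
        assume neg: "\<not> ?thesis"
        have UI: "U \<in> I" and UG: "U \<notin> G" using U I disj by auto
        have "d g w z < c1"
        proof (cases "U = g")
          case True
          then show ?thesis using w(2)[of g] U UG k by (auto simp: c1_def)
        next
          case False
          then have m: "mk U g"
            using neg orth_sym[OF UI gI] by (auto simp: marks_def transversal_def)
          then have "r g U w \<le> \<kappa>" "r g U z \<le> c" using w(3)[of U g] U gI inv gG by auto
          then show ?thesis using d_le_r[OF UI gI m w(1) z] k by (simp add: c1_def)
        qed
        with gc show False by simp
      qed
      define F1 where "F1 = {U \<in> F. \<not> nst g U}"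
      have gF: "g \<notin> F1" using nst_refl gI by (auto simp: F1_def)
      have F1g: "orth g U" if "U \<in> F1" for U using free that by (auto simp: F1_def)
      have F1: "F1 \<subseteq> F" by (auto simp: F1_def)
      \<comment> \<open>Two members of \<open>F\<close> above \<open>g\<close> would be orthogonal
        to each other, which makes \<open>g\<close> orthogonal to a domain containing it. So adding
        \<open>g\<close> removes at most one member, and that one has smaller level.\<close>
      have rem: "F - F1 = {} \<or> (\<exists>U. F - F1 = {U} \<and> nst g U \<and> U \<noteq> g)"
      proof (rule ccontr)
        assume neg: "\<not> ?thesis"
        then obtain U where U: "U \<in> F - F1" by blast
        then have "nst g U" "U \<noteq> g" using free[of U] orth_irrefl gI by (auto simp: F1_def)
        with neg U obtain U' where U': "U' \<in> F - F1" "U' \<noteq> U" by blast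
        then have "nst g U'" by (auto simp: F1_def)
        have UI: "U \<in> I" "U' \<in> I" using U U' I by auto
        have "orth U U'" using pw U U' by (auto simp: pairwise_def)
        then have "orth g U'" using orth_nst[OF UI(2) gI UI(1) \<open>nst g U\<close>] by blast
        then show False using orth_not_nst[OF gI UI(2)] \<open>nst g U'\<close> by blast
      qed
      have finF: "finite F" using fin by simp
      have meas1: "(\<Sum>U\<in>F. Suc (lev U)) < (\<Sum>U\<in>insert g F1. Suc (lev U))"
      proof -
        have f1: "finite F1" using F1 finF finite_subset by blast
        have "(\<Sum>U\<in>F - F1. Suc (lev U)) < Suc (lev g)"
          using rem
        proof
          assume "\<exists>U. F - F1 = {U} \<and> nst g U \<and> U \<noteq> g"
          then obtain U where U: "F - F1 = {U}" "nst g U" "U \<noteq> g" by blast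
          then have "U \<in> I" using I by blast
          then have "lev U < lev g" using lev_less[OF gI] U by blast
          with U show ?thesis by simp
        next
          assume "F - F1 = {}"
          then show ?thesis by (simp only: sum.empty)
        qed
        moreover have "(\<Sum>U\<in>F. Suc (lev U)) = (\<Sum>U\<in>F - F1. Suc (lev U)) + (\<Sum>U\<in>F1. Suc (lev U))"
          by (rule sum.subset_diff[OF F1 finF])
        moreover have "(\<Sum>U\<in>insert g F1. Suc (lev U)) = Suc (lev g) + (\<Sum>U\<in>F1. Suc (lev U))"
          using f1 gF by (rule sum.insert)
        ultimately show ?thesis by linarith
      qed
      have "\<exists>w. is_gate \<gamma> G e z w"
      proof (rule IH[rule_format, of "insert g F1"])
        show "finite (insert g F1 \<union> G)" using fin F1 by (auto intro: finite_subset)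
        show "insert g F1 \<union> G \<subseteq> I" using I F1 gI by auto
        show "insert g F1 \<inter> G = {}" using disj F1 \<open>g \<notin> G\<close> by auto
        have "orth g U \<and> orth U g" if "U \<in> F1 \<union> G" for U
        proof -
          have "orth g U" using that F1g gG by blast
          moreover have "U \<in> I" using that F1 I by blast
          ultimately show ?thesis using orth_sym gI by blast
        qed
        moreover have "pairwise orth (F1 \<union> G)" using pw by (rule pairwise_mono) (use F1 in auto)
        ultimately show "pairwise orth (insert g F1 \<union> G)"
          by (simp add: pairwise_insert)
        show "e U \<in> X" if "U \<in> G" for U using e that by auto
        show "z \<in> X" by (rule z)
        show "n * n < (\<Sum>U\<in>insert g F1. Suc (lev U)) + j" using meas meas1 by linarith
        show "r V U z \<le> c2"
          if U: "U \<in> insert g F1" and VI: "V \<in> I" and "(\<forall>W\<in>G. orth V W) \<and> mk U V" for U V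
        proof -
          have V: "V \<in> I" "\<forall>W\<in>G. orth V W" "mk U V" using that by auto
          show ?thesis
          proof (cases "U = g")
            case False
            then show ?thesis using inv U F1 V unfolding c2_def by fastforce
          next
            case True
            show ?thesis
            \<comment> \<open>Inside \<open>B\<close>, nest-maximality of \<open>g\<close> leaves
              only transverse \<open>V\<close>, covered by the choice of \<open>g\<close>. Outside
              \<open>B\<close>, \<open>V\<close> sees \<open>z\<close> and \<open>w\<close> close
              together while \<open>g\<close> sees them far apart, so \<open>near_marker\<close>
              applies.\<close>
            proof (cases "V \<in> B")
              case True
              have "V \<noteq> g"
                using V \<open>U = g\<close> nst_refl gI by (auto simp: marks_def transversal_def)
              then have "tr g V" using V \<open>U = g\<close> g(2)[OF True] by (auto simp: marks_def)
              then have "r V g z \<le> \<kappa>" using g(3) True by blast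
              moreover have "\<kappa> \<le> nearc c1" unfolding nearc_def c1_def using k by simp
              ultimately show ?thesis using \<open>U = g\<close> unfolding c2_def by simp
            next
              case False
              then have "d V w z < c1" using V by (auto simp: B_def)
              then have "d V z w \<le> c1" using d_sym[OF V(1) z w(1)] by simp
              moreover have "3 * \<kappa> < d g z w"
                using gc d_sym[OF gI z w(1)] k by (simp add: c1_def)
              ultimately have "r V g z \<le> nearc c1"
                using near_marker[OF gI V(1) _ z w(1)] V(3) \<open>U = g\<close> by blast
              then show ?thesis using \<open>U = g\<close> unfolding c2_def by simp
            qed
          qed
        qed
      qed
      then show ?thesis using is_gate_mono max.cobounded1 by blast
    qed
  qed
qed

lemma gate_exists:
  "\<exists>\<gamma>. \<forall>G e z. finite G \<longrightarrow> G \<subseteq> I \<longrightarrow> pairwise orth G \<longrightarrow> (\<forall>U\<in>G. e U \<in> X) \<longrightarrow> z \<in> X \<longrightarrow>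
     (\<exists>w. is_gate \<gamma> G e z w)"
proof -
  obtain \<gamma> where \<gamma>: "\<forall>F G e z. finite (F \<union> G) \<longrightarrow> F \<union> G \<subseteq> I \<longrightarrow> F \<inter> G = {} \<longrightarrow>
     pairwise orth (F \<union> G) \<longrightarrow> (\<forall>U\<in>G. e U \<in> X) \<longrightarrow> z \<in> X \<longrightarrow>
     (\<forall>U\<in>F. \<forall>V\<in>I. (\<forall>W\<in>G. orth V W) \<and> mk U V \<longrightarrow> r V U z \<le> 0) \<longrightarrow>
     n * n < (\<Sum>U\<in>F. Suc (lev U)) + Suc (n * n) \<longrightarrow> (\<exists>w. is_gate \<gamma> G e z w)"
    using gate_iteration[of 0 "Suc (n * n)"] by (elim exE)
  then have "\<forall>G e z. finite G \<longrightarrow> G \<subseteq> I \<longrightarrow> pairwise orth G \<longrightarrow> (\<forall>U\<in>G. e U \<in> X) \<longrightarrow> z \<in> X \<longrightarrow>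
     (\<exists>w. is_gate \<gamma> G e z w)"
    using \<gamma>[THEN spec, of "{}"] by simp
  then show ?thesis by (rule exI)
qed

end

section \<open>Paths and single jumps\<close>

context coarse_hierarchy begin

definition gatec :: real where
  "gatec = max 0 (SOME \<gamma>. \<forall>G e z. finite G \<longrightarrow> G \<subseteq> I \<longrightarrow> pairwise orth G \<longrightarrow>
     (\<forall>U\<in>G. e U \<in> X) \<longrightarrow> z \<in> X \<longrightarrow> (\<exists>w. is_gate \<gamma> G e z w))"

abbreviation gate where "gate \<equiv> is_gate gatec"

lemma gatec_nonneg: "0 \<le> gatec"
  by (simp add: gatec_def)

lemma gateE:
  assumes "finite G" "G \<subseteq> I" "pairwise orth G" "\<And>U. U \<in> G \<Longrightarrow> e U \<in> X" "z \<in> X"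
  obtains w where "gate G e z w"
proof -
  have "\<exists>w. is_gate (SOME \<gamma>. \<forall>G e z. finite G \<longrightarrow> G \<subseteq> I \<longrightarrow> pairwise orth G \<longrightarrow>
     (\<forall>U\<in>G. e U \<in> X) \<longrightarrow> z \<in> X \<longrightarrow> (\<exists>w. is_gate \<gamma> G e z w)) G e z w"
    using someI_ex[OF gate_exists] assms by blast
  then show thesis
    using is_gate_mono[where \<gamma>' = gatec] that unfolding gatec_def by (meson max.cobounded2)
qed

lemma gate_in: "gate G e z w \<Longrightarrow> w \<in> X"
  by (simp add: is_gate_def)

lemma d_tri4:
  "V \<in> I \<Longrightarrow> a \<in> X \<Longrightarrow> b \<in> X \<Longrightarrow> c \<in> X \<Longrightarrow> e \<in> X \<Longrightarrow>
     d V a e \<le> d V a b + d V b c + d V c e + 2 * \<kappa>"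
  using d_tri[of V a b e] d_tri[of V b c e] by simp

lemma gate_mem:
  assumes "gate G e z w" "gate G' e' z' w'" "V \<in> G" "V \<in> G'" "V \<in> I" "e V \<in> X" "e' V \<in> X"
  shows "d V w w' \<le> 2 * gatec + 2 * \<kappa> + d V (e V) (e' V)"
  using assms d_tri4[of V w "e V" "e' V" w'] d_sym[of V w' "e' V"]
  by (fastforce simp: is_gate_def)

lemma gate_mk:
  assumes "gate G e z w" "gate G' e' z' w'" "U \<in> G" "U \<in> G'" "U \<in> I" "V \<in> I" "mk U V"
  shows "d V w w' \<le> 2 * gatec + \<kappa>"
  using assms d_le_r[of U V w w'] by (fastforce simp: is_gate_def)

lemma gate_orth:
  assumes "gate G e z w" "gate G' e' z' w'" "V \<in> I" "z \<in> X" "z' \<in> X"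
    "\<And>U. U \<in> G \<Longrightarrow> orth V U" "\<And>U. U \<in> G' \<Longrightarrow> orth V U"
  shows "d V w w' \<le> 2 * gatec + 2 * \<kappa> + d V z z'"
  using assms d_tri4[of V w z z' w'] d_sym[of V w' z'] by (fastforce simp: is_gate_def)

lemma gate_base:
  assumes "gate G e z w" "V \<in> I" "\<And>U. U \<in> G \<Longrightarrow> orth V U"
  shows "d V w z \<le> gatec"
  using assms by (simp add: is_gate_def)

lemma gate_marker:
  assumes "gate G e z w" "U \<in> G" "U \<in> I" "V \<in> I" "mk U V" "y \<in> X" "r V U y \<le> c"
  shows "d V w y \<le> gatec + c + \<kappa>"
  using assms d_le_r[of U V w y] by (fastforce simp: is_gate_def)

lemma nearc_nonneg: "0 \<le> R \<Longrightarrow> 0 \<le> nearc R"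
  using kappa by (simp add: nearc_def)

text \<open>Large links are iterated from the top domain. A domain of level below \<open>k\<close>
  moves at most \<open>R\<close> and so has at most \<open>N\<close> links, one of which contains
  any given relevant domain nested properly in it. Each link raises the level, so after
  \<open>k\<close> rounds at most \<open>N ^ k\<close> domains remain.\<close>

lemma bounded_relevant:
  "\<exists>B. \<forall>x\<in>X. \<forall>y\<in>X. (\<forall>V\<in>I. lev V < k \<longrightarrow> d V x y \<le> R) \<longrightarrow>
     finite {T \<in> I. lev T = k \<and> \<kappa> \<le> d T x y} \<and> card {T \<in> I. lev T = k \<and> \<kappa> \<le> d T x y} \<le> B"
proof (cases "I = {}")
  case True
  then show ?thesis by simp
next
  case False
  then obtain S where S: "S \<in> I" "\<forall>V\<in>I. nst V S" using nst_top by blast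
  define N where "N = Suc (nat \<lfloor>\<kappa> * R + \<kappa>\<rfloor>)"
  have N: "1 \<le> N" by (simp add: N_def)
  show ?thesis
  proof (intro exI[of _ "N ^ k"] ballI impI)
    fix x y assume X: "x \<in> X" "y \<in> X" and small: "\<forall>V\<in>I. lev V < k \<longrightarrow> d V x y \<le> R"
    define B where "B Q = {T \<in> I. lev T = k \<and> \<kappa> \<le> d T x y \<and> nst T Q}" for Q
    have base: "finite (B Q) \<and> card (B Q) \<le> 1" if Q: "Q \<in> I" "k \<le> lev Q" for Q
    proof -
      have "B Q \<subseteq> {Q}"
        using lev_less[OF _ Q(1)] Q(2) by (fastforce simp: B_def)
      then show ?thesis
        using card_mono[of "{Q}" "B Q"] finite_subset by auto
    qed
    have "finite (B Q) \<and> card (B Q) \<le> N ^ m" if "Q \<in> I" "k \<le> lev Q + m" for Q m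
      using that
    proof (induction m arbitrary: Q)
      case 0
      then show ?case using base by simp
    next
      case (Suc m)
      show ?case
      proof (cases "k \<le> lev Q")
        case True
        have "(1::nat) \<le> N ^ Suc m" using N by simp
        then show ?thesis using base[OF Suc.prems(1) True] by linarith
      next
        case False
        then have dQ: "d Q x y \<le> R" using small Suc.prems by simp
        from links[OF Suc.prems(1) X] obtain \<T> where \<T>: "\<T> \<subseteq> I" "finite \<T>"
          "real (card \<T>) \<le> \<kappa> * d Q x y + \<kappa>" "\<forall>T\<in>\<T>. nst T Q \<and> T \<noteq> Q"
          "\<forall>T\<in>I. nst T Q \<and> T \<noteq> Q \<longrightarrow> (\<exists>T'\<in>\<T>. nst T T') \<or> d T x y < \<kappa>" by blast
        have "\<kappa> * d Q x y \<le> \<kappa> * R" using dQ kappa by simp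
        then have "real (card \<T>) \<le> \<kappa> * R + \<kappa>" using \<T>(3) by linarith
        then have cT: "card \<T> \<le> N" unfolding N_def by linarith
        have sub: "B Q \<subseteq> (\<Union>T\<in>\<T>. B T)"
          using \<T>(5) False by (fastforce simp: B_def)
        have IH: "finite (B T) \<and> card (B T) \<le> N ^ m" if "T \<in> \<T>" for T
        proof (rule Suc.IH)
          show "T \<in> I" using that \<T> by blast
          then have "lev Q < lev T" using lev_less Suc.prems \<T> that by blast
          then show "k \<le> lev T + m" using Suc.prems by linarith
        qed
        have finU: "finite (\<Union>T\<in>\<T>. B T)" using \<T> IH by blast
        have "card (B Q) \<le> card (\<Union>T\<in>\<T>. B T)" by (rule card_mono[OF finU sub])
        also have "\<dots> \<le> (\<Sum>T\<in>\<T>. card (B T))" by (rule card_UN_le[OF \<T>(2)])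
        also have "\<dots> \<le> (\<Sum>T\<in>\<T>. N ^ m)" using IH by (intro sum_mono) blast
        also have "\<dots> \<le> N ^ Suc m" using cT by simp
        finally show ?thesis using finite_subset[OF sub finU] by blast
      qed
    qed
    moreover have "B S = {T \<in> I. lev T = k \<and> \<kappa> \<le> d T x y}" using S by (auto simp: B_def)
    ultimately show "finite {T \<in> I. lev T = k \<and> \<kappa> \<le> d T x y} \<and>
        card {T \<in> I. lev T = k \<and> \<kappa> \<le> d T x y} \<le> N ^ k"
      using S(1) by (metis le_add2)
  qed
qed

text \<open>A step at stage \<open>m\<close> moves a bounded amount in all domains of level below \<open>m\<close>,
  except for the domain that labels it.\<close>

definition step :: "nat \<Rightarrow> real \<Rightarrow> 's option \<Rightarrow> 'x \<Rightarrow> 'x \<Rightarrow> bool" where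
  "step m R l a b \<longleftrightarrow> a \<in> X \<and> b \<in> X \<and>
     (\<forall>V\<in>I. lev V < m \<and> l \<noteq> Some V \<longrightarrow> d V a b \<le> R) \<and>
     (\<forall>T. l = Some T \<longrightarrow> T \<in> I \<and> Suc (lev T) = m \<and> 3 * \<kappa> < d T a b)"

fun path :: "nat \<Rightarrow> real \<Rightarrow> 'x \<Rightarrow> ('s option \<times> 'x) list \<Rightarrow> 'x \<Rightarrow> bool" where
  "path m R x [] y \<longleftrightarrow> x = y"
| "path m R x ((l, z) # ps) y \<longleftrightarrow> step m R l x z \<and> path m R z ps y"

lemma step_mono: "step m R l a b \<Longrightarrow> R \<le> R' \<Longrightarrow> step m R' l a b"
  unfolding step_def by (meson order_trans)

lemma path_mono: "path m R x ps y \<Longrightarrow> R \<le> R' \<Longrightarrow> path m R' x ps y"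
  by (induction ps arbitrary: x) (auto intro: step_mono)

lemma path_append: "path m R x ps y \<Longrightarrow> path m R y qs z \<Longrightarrow> path m R x (ps @ qs) z"
  by (induction ps arbitrary: x) auto

lemma path_end: "path m R x ps y \<Longrightarrow> x \<in> X \<Longrightarrow> y \<in> X"
  by (induction ps arbitrary: x) (auto simp: step_def)

text \<open>A jump of length at most \<open>3 * \<kappa>\<close> counts as a small step and loses
  its label; a label thus always names a jump long enough for \<open>near_marker\<close>.\<close>

lemma step_relabel:
  assumes "a \<in> X" "b \<in> X" "3 * \<kappa> \<le> R" "\<And>V. V \<in> I \<Longrightarrow> lev V \<le> k \<Longrightarrow> l \<noteq> Some V \<Longrightarrow> d V a b \<le> R"
    "\<And>T. l = Some T \<Longrightarrow> T \<in> I \<and> lev T = k"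
  obtains l' where "l' = None \<or> l' = l" "step (Suc k) R l' a b"
proof (cases "\<exists>T. l = Some T \<and> 3 * \<kappa> < d T a b")
  case True
  then have "step (Suc k) R l a b" using assms by (auto simp: step_def)
  then show thesis using that by blast
next
  case False
  have "d V a b \<le> R" if V: "V \<in> I" "lev V \<le> k" for V
  proof (cases "l = Some V")
    case True
    then show ?thesis using False assms(3) by auto
  next
    case False
    then show ?thesis by (rule assms(4)[OF V])
  qed
  then have "step (Suc k) R None a b" using assms by (simp add: step_def)
  then show thesis using that by blast
qed

lemma step_Suc:
  assumes "x \<in> X" "y \<in> X" "\<forall>V\<in>I. lev V < k \<longrightarrow> d V x y \<le> R"
    "{T \<in> I. lev T = k \<and> R < d T x y} = {}"
  shows "step (Suc k) R None x y"
proof -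
  have "d V x y \<le> R" if "V \<in> I" "lev V < Suc k" for V
  proof (cases "lev V = k")
    case True
    then have "\<not> R < d V x y" using assms(4) that by blast
    then show ?thesis by simp
  qed (use assms that in auto)
  then show ?thesis using assms by (simp add: step_def)
qed

text \<open>Passing through the two gates of a relevant domain \<open>T\<close> isolates the jump in \<open>T\<close>; the
  remaining two steps have fewer relevant domains of level \<open>k\<close>.\<close>

lemma split_step_aux:
  "3 * \<kappa> \<le> R \<Longrightarrow> \<exists>R' M. \<forall>x\<in>X. \<forall>y\<in>X. (\<forall>V\<in>I. lev V < k \<longrightarrow> d V x y \<le> R) \<longrightarrow>
     finite {T \<in> I. lev T = k \<and> R < d T x y} \<longrightarrow> card {T \<in> I. lev T = k \<and> R < d T x y} \<le> q \<longrightarrow>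
     (\<exists>ps. path (Suc k) R' x ps y \<and> length ps \<le> M)"
proof (induction q arbitrary: R)
  case 0
  show ?case
  proof (intro exI[of _ R] exI[of _ 1] ballI impI)
    fix x y assume "x \<in> X" "y \<in> X" "\<forall>V\<in>I. lev V < k \<longrightarrow> d V x y \<le> R"
      "finite {T \<in> I. lev T = k \<and> R < d T x y}" "card {T \<in> I. lev T = k \<and> R < d T x y} \<le> 0"
    then have "step (Suc k) R None x y" using step_Suc by simp
    then show "\<exists>ps. path (Suc k) R x ps y \<and> length ps \<le> 1"
      by (intro exI[of _ "[(None, y)]"]) simp
  qed
next
  case (Suc q)
  note k1 = kappa
  have R0: "0 \<le> R" using Suc.prems k1 by linarith
  define R1 where "R1 = R + nearc R + 2 * gatec + 2 * \<kappa>"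
  have R1: "R \<le> R1" "nearc R + gatec + \<kappa> \<le> R1" "2 * gatec + 2 * \<kappa> \<le> R1" "gatec + R + \<kappa> \<le> R1"
    "gatec \<le> R1" "3 * \<kappa> \<le> R1"
    using nearc_nonneg[OF R0] gatec_nonneg R0 k1 Suc.prems unfolding R1_def by linarith+
  obtain R2 M where IH: "\<forall>x\<in>X. \<forall>y\<in>X. (\<forall>V\<in>I. lev V < k \<longrightarrow> d V x y \<le> R1) \<longrightarrow>
     finite {T \<in> I. lev T = k \<and> R1 < d T x y} \<longrightarrow> card {T \<in> I. lev T = k \<and> R1 < d T x y} \<le> q \<longrightarrow>
     (\<exists>ps. path (Suc k) R2 x ps y \<and> length ps \<le> M)"
    using Suc.IH[OF R1(6)] by (elim exE)
  define R3 where "R3 = max R1 R2"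
  show ?case
  proof (intro exI[of _ R3] exI[of _ "2 * M + 1"] ballI impI)
    fix x y assume X: "x \<in> X" "y \<in> X" and low: "\<forall>V\<in>I. lev V < k \<longrightarrow> d V x y \<le> R"
      and fin: "finite {T \<in> I. lev T = k \<and> R < d T x y}" (is "finite ?B")
      and crd: "card {T \<in> I. lev T = k \<and> R < d T x y} \<le> Suc q"
    show "\<exists>ps. path (Suc k) R3 x ps y \<and> length ps \<le> 2 * M + 1"
    proof (cases "?B = {}")
      case True
      then have "path (Suc k) R x [(None, y)] y"
        using step_Suc[OF X low] by simp
      then have "path (Suc k) R3 x [(None, y)] y"
        by (rule path_mono) (use R1 in \<open>simp add: R3_def\<close>)
      then show ?thesis by (intro exI[of _ "[(None, y)]"]) simp
    next
      case False
      then obtain T where T: "T \<in> I" "lev T = k" "R < d T x y" by blast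
      have bigT: "3 * \<kappa> < d T x y" "3 * \<kappa> < d T y x"
        using T Suc.prems d_sym[OF T(1) X] by linarith+
      have pw: "pairwise orth {T}" by (simp add: pairwise_def)
      obtain a where a: "gate {T} (\<lambda>_. x) x a"
        by (rule gateE[of "{T}" "\<lambda>_. x" x]) (use T pw X in auto)
      \<comment> \<open>Both gates have base point \<open>x\<close>, so \<open>a\<close> and
        \<open>b\<close> also agree coarsely in domains orthogonal to \<open>T\<close>, and the step
        from \<open>a\<close> to \<open>b\<close> moves only \<open>T\<close> among the levels up to
        \<open>k\<close>.\<close>
      obtain b where b: "gate {T} (\<lambda>_. y) x b"
        by (rule gateE[of "{T}" "\<lambda>_. y" x]) (use T pw X in auto)
      have abX: "a \<in> X" "b \<in> X" using gate_in a b by blast+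
      have xa: "d V x a \<le> R1" if V: "V \<in> I" "lev V \<le> k" "V = T \<or> d V x y \<le> R" for V
      proof -
        consider "V = T" | "orth V T" | "mk T V" "V \<noteq> T"
          using level_cases[OF V(1) T(1)] V T by auto
        then have "d V a x \<le> R1"
        proof cases
          case 1
          then show ?thesis using a R1 unfolding is_gate_def by force
        next
          case 2
          then show ?thesis using gate_base[OF a V(1)] R1 by fastforce
        next
          case 3
          then have "r V T x \<le> nearc R"
            using near_marker[OF T(1) V(1) 3(1) X _ bigT(1)] V by blast
          from gate_marker[OF a _ T(1) V(1) 3(1) X(1) this] show ?thesis using R1 by simp
        qed
        then show ?thesis using d_sym[OF V(1) X(1) abX(1)] by simp
      qed
      have bY: "d V b y \<le> R1" if V: "V \<in> I" "lev V \<le> k" "V = T \<or> d V x y \<le> R" for V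
      proof -
        consider "V = T" | "orth V T" "V \<noteq> T" | "mk T V" "V \<noteq> T"
          using level_cases[OF V(1) T(1)] V T by auto
        then show ?thesis
        proof cases
          case 1
          then show ?thesis using b R1 unfolding is_gate_def by force
        next
          case 2
          then have "d V b x \<le> gatec" using gate_base[OF b V(1)] by simp
          then show ?thesis using d_tri[OF V(1) abX(2) X] V 2 R1 by simp
        next
          case 3
          then have "r V T y \<le> nearc R"
            using near_marker[OF T(1) V(1) 3(1) X(2,1) _ bigT(2)] V d_sym[OF V(1) X] by simp
          from gate_marker[OF b _ T(1) V(1) 3(1) X(2) this] show ?thesis using R1 by simp
        qed
      qed
      have ab: "d V a b \<le> R1" if V: "V \<in> I" "lev V \<le> k" "V \<noteq> T" for V
      proof -
        consider "orth V T" | "mk T V" using level_cases[OF V(1) T(1)] V T by auto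
        then show ?thesis
        proof cases
          case 1
          then show ?thesis
            using gate_orth[OF a b V(1) X(1) X(1)] d_refl[OF V(1) X(1)] R1 by simp
        next
          case 2
          then show ?thesis using gate_mk[OF a b _ _ T(1) V(1)] R1 k1 by simp
        qed
      qed
      obtain l where l: "step (Suc k) R1 l a b"
        using step_relabel[of a b R1 k "Some T"] abX R1 ab T by auto
      have fewer: "\<exists>ps. path (Suc k) R2 u ps v \<and> length ps \<le> M"
        if uv: "u \<in> X" "v \<in> X"
          "\<And>V. V \<in> I \<Longrightarrow> lev V \<le> k \<Longrightarrow> V = T \<or> d V x y \<le> R \<Longrightarrow> d V u v \<le> R1" for u v
      proof -
        have sub: "{T \<in> I. lev T = k \<and> R1 < d T u v} \<subseteq> ?B - {T}"
        proof
          fix V assume "V \<in> {T \<in> I. lev T = k \<and> R1 < d T u v}"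
          then have V: "V \<in> I" "lev V = k" "R1 < d V u v" by auto
          then have "\<not> (V = T \<or> d V x y \<le> R)" using uv(3)[of V] by auto
          with V show "V \<in> ?B - {T}" by auto
        qed
        have finB: "finite (?B - {T})" using fin by simp
        have "card (?B - {T}) < card ?B" using fin T by (intro card_Diff1_less) auto
        then have "card {T \<in> I. lev T = k \<and> R1 < d T u v} \<le> q"
          using card_mono[OF finB sub] crd by linarith
        moreover have "\<forall>V\<in>I. lev V < k \<longrightarrow> d V u v \<le> R1" using uv(3) low by simp
        ultimately show ?thesis
          using IH uv(1,2) finite_subset[OF sub finB] by blast
      qed
      obtain ps where ps: "path (Suc k) R2 x ps a" "length ps \<le> M"
        using fewer[OF X(1) abX(1) xa] by blast
      obtain qs where qs: "path (Suc k) R2 b qs y" "length qs \<le> M"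
        using fewer[OF abX(2) X(2) bY] by blast
      have "path (Suc k) R3 x ps a" "path (Suc k) R3 b qs y" "step (Suc k) R3 l a b"
        using path_mono[OF ps(1)] path_mono[OF qs(1)] step_mono[OF l] by (auto simp: R3_def)
      then have "path (Suc k) R3 x (ps @ (l, b) # qs) y"
        by (intro path_append) auto
      then show ?thesis using ps(2) qs(2)
        by (intro exI[of _ "ps @ (l, b) # qs"]) simp
    qed
  qed
qed

text \<open>The number of domains to isolate is bounded by \<open>bounded_relevant\<close>
  independently of the step, which makes \<open>R'\<close> and \<open>M\<close> uniform.\<close>

lemma split_step:
  assumes "3 * \<kappa> \<le> R"
  shows "\<exists>R' M. \<forall>x y. step k R None x y \<longrightarrow> (\<exists>ps. path (Suc k) R' x ps y \<and> length ps \<le> M)"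
proof -
  obtain B where B: "\<forall>x\<in>X. \<forall>y\<in>X. (\<forall>V\<in>I. lev V < k \<longrightarrow> d V x y \<le> R) \<longrightarrow>
     finite {T \<in> I. lev T = k \<and> \<kappa> \<le> d T x y} \<and> card {T \<in> I. lev T = k \<and> \<kappa> \<le> d T x y} \<le> B"
    using bounded_relevant by blast
  obtain R' M where R': "\<forall>x\<in>X. \<forall>y\<in>X. (\<forall>V\<in>I. lev V < k \<longrightarrow> d V x y \<le> R) \<longrightarrow>
     finite {T \<in> I. lev T = k \<and> R < d T x y} \<longrightarrow> card {T \<in> I. lev T = k \<and> R < d T x y} \<le> B \<longrightarrow>
     (\<exists>ps. path (Suc k) R' x ps y \<and> length ps \<le> M)"
    using split_step_aux[OF assms, of k B] by blast
  have "\<exists>ps. path (Suc k) R' x ps y \<and> length ps \<le> M" if s: "step k R None x y" for x y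
  proof -
    have X: "x \<in> X" "y \<in> X" and low: "\<forall>V\<in>I. lev V < k \<longrightarrow> d V x y \<le> R"
      using s by (auto simp: step_def)
    have sub: "{T \<in> I. lev T = k \<and> R < d T x y} \<subseteq> {T \<in> I. lev T = k \<and> \<kappa> \<le> d T x y}"
      using assms kappa by auto
    have "finite {T \<in> I. lev T = k \<and> \<kappa> \<le> d T x y}" "card {T \<in> I. lev T = k \<and> \<kappa> \<le> d T x y} \<le> B"
      using B X low by blast+
    then have "finite {T \<in> I. lev T = k \<and> R < d T x y}" "card {T \<in> I. lev T = k \<and> R < d T x y} \<le> B"
      using finite_subset[OF sub] card_mono[OF _ sub] by auto
    then show ?thesis using R' X low by blast
  qed
  then show ?thesis by blast
qed

lemma split_path:
  assumes "3 * \<kappa> \<le> R"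
  shows "\<exists>R' M. \<forall>x ps y. path k R x ps y \<longrightarrow> fst ` set ps \<subseteq> {None} \<longrightarrow>
     (\<exists>qs. path (Suc k) R' x qs y \<and> length qs \<le> M * length ps)"
proof -
  obtain R' M where R': "\<forall>x y. step k R None x y \<longrightarrow>
      (\<exists>ps. path (Suc k) R' x ps y \<and> length ps \<le> M)"
    using split_step[OF assms] by blast
  have "\<exists>qs. path (Suc k) R' x qs y \<and> length qs \<le> M * length ps"
    if "path k R x ps y" "fst ` set ps \<subseteq> {None}" for x ps y
    using that
  proof (induction ps arbitrary: x)
    case Nil
    then show ?case by (intro exI[of _ "[]"]) simp
  next
    case (Cons p ps)
    obtain z where p: "p = (None, z)" using Cons.prems by (cases p) auto
    then have "step k R None x z" "path k R z ps y" using Cons.prems by auto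
    moreover obtain qs where "path (Suc k) R' z qs y" "length qs \<le> M * length ps"
      using Cons.IH[of z] Cons.prems calculation by auto
    moreover obtain qs' where "path (Suc k) R' x qs' z" "length qs' \<le> M"
      using R' calculation by blast
    ultimately show ?case
      by (intro exI[of _ "qs' @ qs"]) (auto intro: path_append)
  qed
  then show ?thesis by blast
qed

text \<open>The path is traversed with a set \<open>G\<close> of pairwise orthogonal overridden domains: a domain
  that will be jumped in again later is frozen by passing to the gate of \<open>G\<close>, and released
  with a single jump at its last occurrence. Domains transverse to a frozen one do not move.\<close>

lemma lazy_path_aux:
  assumes R: "3 * \<kappa> \<le> R" and R': "R' = R + nearc R + 2 * gatec + 2 * \<kappa>"
  shows "path (Suc k) R x ps y \<Longrightarrow> x \<in> X \<Longrightarrow> finite G \<Longrightarrow> G \<subseteq> I \<Longrightarrow> pairwise orth G \<Longrightarrow>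
    (\<And>U. U \<in> G \<Longrightarrow> lev U = k \<and> e U \<in> X \<and> Some U \<in> fst ` set ps) \<Longrightarrow> gate G e x u \<Longrightarrow>
    \<exists>qs. path (Suc k) R' u qs y \<and> length qs = Suc (length ps) \<and>
         distinct (filter (\<lambda>l. l \<noteq> None) (map fst qs)) \<and> fst ` set qs \<subseteq> insert None (fst ` set ps)"
proof (induction ps arbitrary: x G e u)
  case Nil
  \<comment> \<open>No label is left, so nothing is frozen and \<open>u\<close> agrees coarsely with
    \<open>x\<close> in every domain; the final correcting step accounts for the \<open>Suc\<close>
    in the length.\<close>
  then have "G = {}" by auto
  then have "\<forall>V\<in>I. d V u x \<le> gatec" using gate_base[OF Nil.prems(7)] by blast
  moreover have "gatec \<le> R'"
    using R' nearc_nonneg[of R] gatec_nonneg R kappa by simp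
  ultimately have "step (Suc k) R' None u x"
    using gate_in[OF Nil.prems(7)] Nil.prems(2) by (force simp: step_def)
  then show ?case using Nil.prems by (intro exI[of _ "[(None, x)]"]) simp
next
  case (Cons p ps)
  obtain l z where p: "p = (l, z)" by (cases p)
  have st: "step (Suc k) R l x z" and pz: "path (Suc k) R z ps y" using Cons.prems p by auto
  have X: "x \<in> X" "z \<in> X" "u \<in> X" using st gate_in[OF Cons.prems(7)] by (auto simp: step_def)
  have small: "d V x z \<le> R" if "V \<in> I" "lev V \<le> k" "l \<noteq> Some V" for V
    using st that by (auto simp: step_def)
  have k1: "1 \<le> \<kappa>" by (rule kappa)
  have bounds: "2 * gatec + 2 * \<kappa> + R \<le> R'" "2 * gatec + nearc R + 2 * \<kappa> \<le> R'"
    "2 * gatec + 2 * \<kappa> \<le> R'" "3 * \<kappa> \<le> R'"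
    using R' nearc_nonneg[of R] gatec_nonneg R kappa by simp_all
  have lT: "T \<in> I" "lev T = k" "3 * \<kappa> < d T x z" if "l = Some T" for T
    using st that by (auto simp: step_def)
  have near: "r V T x \<le> nearc R" "r V T z \<le> nearc R"
    if "l = Some T" "V \<in> I" "lev V \<le> k" "V \<noteq> T" "mk T V" for T V
    using near_marker[OF lT(1)[OF that(1)] that(2,5) X(1,2) small lT(3)[OF that(1)]]
      near_marker[OF lT(1)[OF that(1)] that(2,5) X(2,1), of R]
      small[OF that(2,3)] d_sym[OF that(2) X(1,2)] d_sym[OF lT(1) X(1,2)] lT(3) that by auto
  have "\<exists>G' e' L. finite G' \<and> G' \<subseteq> I \<and> pairwise orth G' \<and>
      (\<forall>U\<in>G'. lev U = k \<and> e' U \<in> X \<and> Some U \<in> fst ` set ps) \<and>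
      (L = None \<or> L = l \<and> L \<notin> fst ` set ps) \<and>
      (\<forall>w. gate G' e' z w \<longrightarrow> (\<forall>V\<in>I. lev V \<le> k \<and> L \<noteq> Some V \<longrightarrow> d V u w \<le> R'))"
  proof -
    have GI: "U \<in> I" "lev U = k" "e U \<in> X" if "U \<in> G" for U using Cons.prems that by auto
    have cases: "V \<in> G \<or> (\<exists>U\<in>G. mk U V) \<or> (\<forall>U\<in>G. orth V U)" if "V \<in> I" "lev V \<le> k" for V
      using level_cases[OF that(1)] that GI by metis
    have common: "d V u w \<le> R'"
      if V: "V \<in> I" "lev V \<le> k" and w: "gate G' e' z w" and "A \<subseteq> G" "A \<subseteq> G'" "\<forall>U\<in>A. e' U = e U"
        and sees: "V \<in> A \<or> (\<exists>U\<in>A. mk U V)" for V A G' e' w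
    proof (cases "V \<in> A")
      case True
      then have "V \<in> G" "V \<in> G'" "e' V = e V" using that by auto
      then show ?thesis
        using gate_mem[OF Cons.prems(7) w _ _ V(1)] GI(3) d_refl[OF V(1)] bounds by fastforce
    next
      case False
      then obtain U where U: "U \<in> A" "mk U V" using sees by blast
      then have "U \<in> G" "U \<in> G'" using that by auto
      then show ?thesis
        using gate_mk[OF Cons.prems(7) w _ _ GI(1) V(1) U(2)] bounds k1 by fastforce
    qed
    have free: "d V u w \<le> R'"
      if V: "V \<in> I" "lev V \<le> k" "l \<noteq> Some V" and w: "gate G' e' z w"
        and "\<forall>U\<in>G. orth V U" "\<forall>U\<in>G'. orth V U" for V G' e' w
      using gate_orth[OF Cons.prems(7) w V(1) X(1,2)] that(5,6) small[OF V] bounds by fastforce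
    \<comment> \<open>\<open>skip\<close> keeps \<open>G\<close>. It covers an unlabelled step, a
      frozen \<open>T\<close> that jumps again later, a \<open>T\<close> held still by a frozen
      domain that is not orthogonal to it, and the last jump in a \<open>T\<close> orthogonal to
      \<open>G\<close>; only this last one keeps its label.\<close>
    consider (skip) L where "L = None \<or> L = l \<and> L \<notin> fst ` set ps"
        "\<forall>T. l = Some T \<longrightarrow> (T \<in> G \<longrightarrow> Some T \<in> fst ` set ps) \<and> (L = l \<or> \<not> (\<forall>U\<in>G. orth T U))"
      | (release) T where "l = Some T" "T \<in> G" "Some T \<notin> fst ` set ps"
      | (freeze) T where "l = Some T" "\<forall>U\<in>G. orth T U" "Some T \<in> fst ` set ps"
    proof (cases l)
      case None
      then show ?thesis using skip[of None] by simp
    next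
      case (Some T)
      then show ?thesis
        using skip[of None] skip[of l] release[of T] freeze[of T] orth_irrefl lT(1)[OF Some]
        by blast
    qed
    then show ?thesis
    proof cases
      case skip
      have "Some U \<in> fst ` set ps" if "U \<in> G" for U
        using Cons.prems(6)[OF that] skip(2) that p by auto
      moreover have "d V u w \<le> R'"
        if w: "gate G e z w" and V: "V \<in> I" "lev V \<le> k" "L \<noteq> Some V" for w V
      proof (cases "V \<in> G \<or> (\<exists>U\<in>G. mk U V)")
        case True
        then show ?thesis using common[OF V(1,2) w, of G] by blast
      next
        case False
        then have o: "\<forall>U\<in>G. orth V U" using cases V by blast
        then have "l \<noteq> Some V" using skip(2) V(3) by auto
        then show ?thesis using free[OF V(1,2) _ w o o] by blast
      qed
      ultimately show ?thesis using Cons.prems(3-5) GI skip(1)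
        by (intro exI[of _ G] exI[of _ e] exI[of _ L]) simp
    next
      case release
      have "Some U \<in> fst ` set ps" if "U \<in> G - {T}" for U
        using Cons.prems(6)[of U] release that p by auto
      moreover have "d V u w \<le> R'"
        if w: "gate (G - {T}) e z w" and V: "V \<in> I" "lev V \<le> k" "l \<noteq> Some V" for w V
      proof (cases "V \<in> G - {T} \<or> (\<exists>U\<in>G - {T}. mk U V)")
        case True
        then show ?thesis using common[OF V(1,2) w, of "G - {T}"] by blast
      next
        case False
        have VT: "V \<noteq> T" using V release by auto
        have o: "\<forall>U\<in>G - {T}. orth V U"
        proof
          fix U assume U: "U \<in> G - {T}"
          then show "orth V U" using level_cases[OF V(1) GI(1)[of U]] GI(2)[of U] V(2) False by auto
        qed
        show ?thesis
        proof (cases "orth V T")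
          case True
          then show ?thesis using free[OF V w] o by blast
        next
          case False
          then have m: "mk T V"
            using level_cases[OF V(1) GI(1)[OF release(2)]] GI(2)[OF release(2)] V VT by auto
          have TI: "T \<in> I" using GI release by blast
          have wX: "w \<in> X" using gate_in w by blast
          \<comment> \<open>The gate \<open>u\<close> sits at the marker of the released
            \<open>T\<close> in \<open>V\<close>. The jump in \<open>T\<close> does not move
            \<open>V\<close>, so \<open>z\<close> is near the same marker.\<close>
          have "r V T z \<le> nearc R" using near[OF release(1) V(1,2) VT m] by blast
          from gate_marker[OF Cons.prems(7) release(2) TI V(1) m X(2) this]
          have "d V u z \<le> gatec + nearc R + \<kappa>" .
          moreover have "d V z w \<le> gatec"
            using gate_base[OF w V(1)] o d_sym[OF V(1) X(2) wX] by simp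
          ultimately show ?thesis using d_tri[OF V(1) X(3,2) wX] bounds by linarith
        qed
      qed
      moreover have "pairwise orth (G - {T})" using Cons.prems(5) by (rule pairwise_mono) auto
      ultimately show ?thesis
        using Cons.prems(3,4) GI release
        by (intro exI[of _ "G - {T}"] exI[of _ e] exI[of _ l]) auto
    next
      case freeze
      have TI: "T \<in> I" using lT freeze by blast
      have TG: "T \<notin> G" using freeze orth_irrefl TI by blast
      \<comment> \<open>The coordinate in \<open>T\<close> is frozen at its value at
        \<open>x\<close>, before the jump, so the present step does not move
        \<open>T\<close>.\<close>
      let ?G = "insert T G" and ?e = "e(T := x)"
      have "Some U \<in> fst ` set ps" if "U \<in> ?G" for U
        using Cons.prems(6)[of U] freeze that p by auto
      moreover have "d V u w \<le> R'"
        if w: "gate ?G ?e z w" and V: "V \<in> I" "lev V \<le> k" for w V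
      proof -
        have wX: "w \<in> X" using gate_in w by blast
        have eG: "\<forall>U\<in>G. ?e U = e U" using TG by auto
        show ?thesis
        proof (cases "V \<in> G \<or> (\<exists>U\<in>G. mk U V)")
          case True
          then show ?thesis using common[OF V w _ _ eG] by blast
        next
          case False
          then have o: "\<forall>U\<in>G. orth V U" using cases V by blast
          then have ux: "d V u x \<le> gatec" using gate_base[OF Cons.prems(7) V(1)] by blast
          have xu: "d V x w \<le> nearc R + gatec + \<kappa>" if "V = T \<or> mk T V" "\<not> orth V T"
          proof (cases "V = T")
            case True
            then have "d V w x \<le> gatec" using w by (auto simp: is_gate_def)
            then show ?thesis
              using d_sym[OF V(1) X(1) wX] nearc_nonneg[of R] R k1 by linarith
          next
            case False
            then have m: "mk T V" using that by blast
            have "r V T x \<le> nearc R" using near[OF freeze(1) V False m] by blast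
            from gate_marker[OF w _ TI V(1) m X(1) this] show ?thesis
              using d_sym[OF V(1) X(1) wX] by simp
          qed
          show ?thesis
          proof (cases "orth V T")
            case True
            then have "l \<noteq> Some V" using freeze orth_irrefl TI by auto
            then show ?thesis using free[OF V _ w] o True by blast
          next
            case False
            then have "V = T \<or> mk T V" using level_cases[OF V(1) TI] V lT freeze by auto
            then show ?thesis using xu False ux d_tri[OF V(1) X(3,1) wX] bounds by linarith
          qed
        qed
      qed
      moreover have "pairwise orth ?G"
        using Cons.prems(5) freeze orth_sym TI GI by (auto simp: pairwise_insert)
      ultimately show ?thesis
        using Cons.prems(3) GI TI lT freeze X TG
        by (intro exI[of _ ?G] exI[of _ ?e] exI[of _ None]) auto
    qed
  qed
  then obtain G' e' L where G': "finite G'" "G' \<subseteq> I" "pairwise orth G'"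
    "\<forall>U\<in>G'. lev U = k \<and> e' U \<in> X \<and> Some U \<in> fst ` set ps"
    and L: "L = None \<or> L = l \<and> L \<notin> fst ` set ps"
    and close: "\<forall>w. gate G' e' z w \<longrightarrow> (\<forall>V\<in>I. lev V \<le> k \<and> L \<noteq> Some V \<longrightarrow> d V u w \<le> R')"
    by (elim exE conjE)
  obtain w where w: "gate G' e' z w"
    by (rule gateE[OF G'(1-3), of e' z]) (use G' X in auto)
  obtain l' where l': "l' = None \<or> l' = L" "step (Suc k) R' l' u w"
  proof (rule step_relabel[of u w R' k L])
    show "L = Some T \<Longrightarrow> T \<in> I \<and> lev T = k" for T using L lT by auto
  qed (use X gate_in[OF w] bounds close w in blast)+
  obtain qs where qs: "path (Suc k) R' w qs y" "length qs = Suc (length ps)"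
    "distinct (filter (\<lambda>l. l \<noteq> None) (map fst qs))" "fst ` set qs \<subseteq> insert None (fst ` set ps)"
    using Cons.IH[OF pz X(2) G'(1-3) _ w] G'(4) by blast
  show ?case
  proof (intro exI[of _ "(l', w) # qs"] conjI)
    show "distinct (filter (\<lambda>l. l \<noteq> None) (map fst ((l', w) # qs)))"
      using qs(3,4) l'(1) L by auto
    show "fst ` set ((l', w) # qs) \<subseteq> insert None (fst ` set (p # ps))"
      using qs(4) l'(1) L p by auto
  qed (use qs l' in auto)
qed

lemma lazy_path:
  assumes R: "3 * \<kappa> \<le> R" and p: "path (Suc k) R x ps y" and x: "x \<in> X"
  shows "\<exists>qs. path (Suc k) (R + nearc R + 2 * gatec + 2 * \<kappa>) x qs y \<and>
     length qs = Suc (length ps) \<and> distinct (filter (\<lambda>l. l \<noteq> None) (map fst qs))"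
proof -
  have "gate {} (\<lambda>_. x) x x"
    using x d_refl gatec_nonneg by (simp add: is_gate_def)
  from lazy_path_aux[OF R refl p x _ _ _ _ this] show ?thesis by auto
qed

end

section \<open>Drift\<close>

lemma distinct_filter_nth:
  "distinct (filter P xs) \<Longrightarrow> i < j \<Longrightarrow> j < length xs \<Longrightarrow> P (xs ! i) \<Longrightarrow> xs ! i \<noteq> xs ! j"
proof (induction xs arbitrary: i j)
  case (Cons x xs)
  then obtain j' where j: "j = Suc j'" by (cases j) auto
  show ?case
  proof (cases i)
    case 0
    then show ?thesis using Cons.prems j nth_mem[of j' xs] by auto
  next
    case (Suc i')
    have "distinct (filter P xs)" using Cons.prems(1) by (cases "P x") auto
    then show ?thesis using Cons.IH[of i' j'] Cons.prems j Suc by simp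
  qed
qed simp

text \<open>Intervals \<open>[s a, t a]\<close> with cores \<open>J a\<close>: whenever \<open>b\<close> comes after \<open>a\<close> and meets the core
  of \<open>a\<close>, it lies inside \<open>a\<close>. An interval either has a point of its core that is covered by no
  later interval, or has more than \<open>2 * B\<close> immediate successors under it, while every interval
  has at most \<open>B\<close> immediate predecessors.\<close>

lemma interval_count:
  fixes s t :: "'i \<Rightarrow> nat" and J :: "'i \<Rightarrow> nat set"
  assumes fin: "finite A"
    and st: "\<And>a. a \<in> A \<Longrightarrow> s a \<le> t a" "\<And>a. a \<in> A \<Longrightarrow> t a \<le> M"
    and J: "\<And>a. a \<in> A \<Longrightarrow> J a \<subseteq> {s a<..<t a}"
    and under: "\<And>a b. \<lbrakk>a \<in> A; b \<in> A; lt a b; J a \<inter> {s b..t b} \<noteq> {}\<rbrakk> \<Longrightarrow> s a < s b \<and> t b < t a"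
    and anti: "\<And>D m. \<lbrakk>D \<subseteq> A; \<And>a. a \<in> D \<Longrightarrow> m \<in> {s a<..<t a};
        \<And>a b. a \<in> D \<Longrightarrow> b \<in> D \<Longrightarrow> a \<noteq> b \<Longrightarrow> \<not> lt a b\<rbrakk> \<Longrightarrow> card D \<le> B"
    and cover: "\<And>a D. \<lbrakk>a \<in> A; D \<subseteq> A; \<And>b. b \<in> D \<Longrightarrow> lt a b; J a \<subseteq> (\<Union>b\<in>D. {s b..t b})\<rbrakk> \<Longrightarrow>
        2 * B < card D"
  shows "card A \<le> 2 * B * Suc M"
proof -
  define unders where "unders a b \<longleftrightarrow> a \<in> A \<and> b \<in> A \<and> lt a b \<and> J a \<inter> {s b..t b} \<noteq> {}" for a b
  define imm where "imm a b \<longleftrightarrow> unders a b \<and> \<not> (\<exists>c. unders a c \<and> unders c b)" for a b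
  define cov where "cov = {a \<in> A. J a \<subseteq> (\<Union>b\<in>{b \<in> A. lt a b}. {s b..t b})}"
  have inside: "s a < s b \<and> t b < t a" if "unders a b" for a b
    using under that unfolding unders_def by blast
  have many: "2 * B < card {b \<in> A. imm a b}" if a: "a \<in> cov" for a
  proof (rule cover)
    show "a \<in> A" using a by (auto simp: cov_def)
    show "J a \<subseteq> (\<Union>b\<in>{b \<in> A. imm a b}. {s b..t b})"
    proof
      fix m assume m: "m \<in> J a"
      \<comment> \<open>A longest later interval over \<open>m\<close> is an immediate successor of
        \<open>a\<close>: any interval in between would also be later than \<open>a\<close>, contain
        \<open>m\<close>, and be longer.\<close>
      define S where "S = {b \<in> A. lt a b \<and> m \<in> {s b..t b}}"
      have S: "finite S" "S \<noteq> {}" using fin m a unfolding S_def cov_def by (simp, blast)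
      then have "Max ((\<lambda>b. t b - s b) ` S) \<in> (\<lambda>b. t b - s b) ` S" by (intro Max_in) auto
      then obtain b where b: "b \<in> S" "Max ((\<lambda>b. t b - s b) ` S) = t b - s b" by auto
      have max: "t c - s c \<le> t b - s b" if "c \<in> S" for c
        using S(1) that b(2)[symmetric] by simp
      have "unders a b" using a b(1) m by (auto simp: unders_def S_def cov_def)
      moreover have False if c: "unders a c" "unders c b" for c
      proof -
        have "s c < s b" "t b < t c" using inside[OF c(2)] by auto
        moreover from this have "c \<in> S" using c(1) b(1) by (auto simp: S_def unders_def)
        ultimately show False using max[of c] b(1) by (auto simp: S_def)
      qed
      ultimately have "imm a b" unfolding imm_def by blast
      then show "m \<in> (\<Union>b\<in>{b \<in> A. imm a b}. {s b..t b})" using b(1) by (auto simp: S_def)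
    qed
  qed (auto simp: imm_def unders_def)
  \<comment> \<open>Of two \<open>lt\<close>-related immediate predecessors of \<open>b\<close>, one
    would lie between the other and \<open>b\<close>. Hence they are incomparable, and all contain
    \<open>s b\<close> in their interior.\<close>
  have few: "card {a \<in> A. imm a b} \<le> B" if b: "b \<in> A" for b
  proof (rule anti[where m = "s b"])
    show "s b \<in> {s a<..<t a}" if "a \<in> {a \<in> A. imm a b}" for a
      using inside[of a b] that st(1)[OF b] by (auto simp: imm_def)
    fix a c assume ac: "a \<in> {a \<in> A. imm a b}" "c \<in> {a \<in> A. imm a b}" "a \<noteq> c"
    show "\<not> lt a c"
    proof
      assume "lt a c"
      have "unders a b" "unders c b" using ac by (auto simp: imm_def)
      moreover from inside[OF this(2)] have "{s b..t b} \<subseteq> {s c..t c}" by auto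
      ultimately have "unders a c" using \<open>lt a c\<close> ac by (auto simp: unders_def)
      then show False using ac \<open>unders c b\<close> unfolding imm_def by blast
    qed
  qed auto
  have cA: "cov \<subseteq> A" by (auto simp: cov_def)
  have fc: "finite cov" using finite_subset[OF cA fin] .
  \<comment> \<open>Counting the immediate pairs from both ends shows that at most half of the
    intervals have a covered core.\<close>
  have "(2 * B + 1) * card cov = (\<Sum>a\<in>cov. 2 * B + 1)" by simp
  also have "\<dots> \<le> (\<Sum>a\<in>cov. card {b \<in> A. imm a b})"
    using many by (intro sum_mono) fastforce
  also have "\<dots> \<le> (\<Sum>a\<in>A. card {b \<in> A. imm a b})"
    by (rule sum_mono2[OF fin cA]) simp
  also have "\<dots> = (\<Sum>b\<in>A. card {a \<in> A. imm a b})"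
    using sum.swap_restrict[OF fin fin, of "\<lambda>_ _. 1::nat" imm] by simp
  also have "\<dots> \<le> (\<Sum>b\<in>A. B)" using few by (rule sum_mono)
  finally have edges: "(2 * B + 1) * card cov \<le> card A * B" by simp
  define unc where "unc = A - cov"
  \<comment> \<open>An uncovered interval has a core point outside all later ones. Uncovered
    intervals with the same chosen point are incomparable, so each point is chosen at most
    \<open>B\<close> times.\<close>
  have "\<exists>m. m \<in> J a \<and> (\<forall>b\<in>A. lt a b \<longrightarrow> m \<notin> {s b..t b})" if "a \<in> unc" for a
    using that by (auto simp: unc_def cov_def)
  then obtain \<mu> where \<mu>: "\<And>a. a \<in> unc \<Longrightarrow> \<mu> a \<in> J a"
    "\<And>a b. a \<in> unc \<Longrightarrow> b \<in> A \<Longrightarrow> lt a b \<Longrightarrow> \<mu> a \<notin> {s b..t b}" by metis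
  have \<mu>in: "\<mu> a \<in> {s a<..<t a}" if "a \<in> unc" for a
    using J[of a] \<mu>(1)[OF that] that unfolding unc_def by blast
  have level: "card {a \<in> unc. \<mu> a = m} \<le> B" for m
  proof (rule anti[where m = m])
    fix a b assume ab: "a \<in> {a \<in> unc. \<mu> a = m}" "b \<in> {a \<in> unc. \<mu> a = m}"
    have "\<mu> a \<in> {s b..t b}" using \<mu>in[of b] ab by auto
    then show "\<not> lt a b" using \<mu>(2)[of a b] ab by (auto simp: unc_def)
  qed (use \<mu>in in \<open>auto simp: unc_def\<close>)
  have unc_eq: "unc = (\<Union>m\<in>{..M}. {a \<in> unc. \<mu> a = m})"
  proof -
    have "\<mu> a \<le> M" if "a \<in> unc" for a
      using \<mu>in[OF that] st(2)[of a] that by (auto simp: unc_def)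
    then show ?thesis by auto
  qed
  have "card unc = card (\<Union>m\<in>{..M}. {a \<in> unc. \<mu> a = m})"
    using unc_eq by (rule arg_cong)
  also have "\<dots> \<le> (\<Sum>m\<in>{..M}. card {a \<in> unc. \<mu> a = m})"
    by (rule card_UN_le) simp
  also have "\<dots> \<le> (\<Sum>m\<in>{..M}. B)" using level by (rule sum_mono)
  finally have unc: "card unc \<le> B * Suc M" by (simp add: mult.commute)
  have tot: "card A = card cov + card unc"
    using card_Diff_subset[OF fc cA] card_mono[OF fin cA] by (simp add: unc_def)
  have "card cov \<le> card unc"
  proof (rule ccontr)
    assume neg: "\<not> card cov \<le> card unc"
    then have "B * card A \<le> B * (2 * card cov)" using tot by (intro mult_left_mono) auto
    moreover have "(2 * B + 1) * card cov = B * (2 * card cov) + card cov" by (simp add: algebra_simps)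
    ultimately show False using edges neg mult.commute[of "card A" B] by linarith
  qed
  then show ?thesis using tot unc by simp
qed

section \<open>Subdividing jumps into small steps\<close>

context coarse_hierarchy begin

lemma path_of_chain:
  "(\<And>i. i < m \<Longrightarrow> step k R None (u i) (u (Suc i))) \<Longrightarrow>
     path k R (u 0) (map (\<lambda>i. (None, u (Suc i))) [0..<m]) (u m)"
proof (induction m)
  case (Suc m)
  then have "path k R (u 0) (map (\<lambda>i. (None, u (Suc i))) [0..<m] @ [(None, u (Suc m))]) (u (Suc m))"
    by (intro path_append[of _ _ _ _ "u m"]) auto
  then show ?case by simp
qed simp

fun jump :: "'s option \<Rightarrow> 'x \<Rightarrow> 'x \<Rightarrow> real" where
  "jump None x y = 0"
| "jump (Some T) x y = d T x y"

text \<open>The jump in \<open>T\<close> follows gates of \<open>{T}\<close> whose coordinates run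
  through an interpolation between \<open>x\<close> and \<open>y\<close>. All have base point
  \<open>x\<close>, so the other domains of level up to \<open>k\<close> stay still. Two further
  steps join the ends of the chain of gates to \<open>x\<close> and \<open>y\<close>.\<close>

lemma subdivide_step:
  assumes R: "3 * \<kappa> \<le> R" and s: "step (Suc k) R l x y"
  shows "\<exists>qs. path (Suc k) (R + nearc R + 2 * gatec + 3 * \<kappa>) x qs y \<and> fst ` set qs \<subseteq> {None} \<and>
     real (length qs) \<le> \<kappa> + 2 + jump l x y"
proof -
  define R' where "R' = R + nearc R + 2 * gatec + 3 * \<kappa>"
  note k1 = kappa
  have bounds: "R \<le> R'" "gatec + nearc R + \<kappa> \<le> R'" "gatec + R + \<kappa> \<le> R'" "2 * gatec + 3 * \<kappa> \<le> R'"
    using nearc_nonneg[of R] gatec_nonneg R k1 by (simp_all add: R'_def)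
  have X: "x \<in> X" "y \<in> X" using s by (auto simp: step_def)
  show ?thesis
    unfolding R'_def[symmetric]
  proof (cases l)
    case None
    then have "path (Suc k) R' x [(None, y)] y"
      using step_mono[OF s bounds(1)] by simp
    then show "\<exists>qs. path (Suc k) R' x qs y \<and> fst ` set qs \<subseteq> {None} \<and>
        real (length qs) \<le> \<kappa> + 2 + jump l x y"
      using None k1 by (intro exI[of _ "[(None, y)]"]) simp
  next
    case (Some T)
    have T: "T \<in> I" "lev T = k" "3 * \<kappa> < d T x y" "3 * \<kappa> < d T y x"
      using s Some d_sym[OF _ X] by (auto simp: step_def)
    have small: "d V x y \<le> R" if "V \<in> I" "lev V \<le> k" "V \<noteq> T" for V
      using s Some that by (auto simp: step_def)
    from interpolation[OF T(1) X] obtain p m where p: "p 0 = x" "p m = y" "\<And>i. p i \<in> X"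
      "\<And>i. d T (p i) (p (Suc i)) \<le> \<kappa>" "real m \<le> d T x y + \<kappa>" by blast
    have "\<exists>w. gate {T} (\<lambda>_. p i) x w" for i
      by (rule gateE[of "{T}" "\<lambda>_. p i" x]) (use T X p in \<open>auto simp: pairwise_def\<close>)
    then obtain u where u: "\<And>i. gate {T} (\<lambda>_. p i) x (u i)" by metis
    have uX: "u i \<in> X" for i using gate_in[OF u] .
    have cases: "V = T \<or> orth V T \<or> mk T V" if "V \<in> I" "lev V \<le> k" for V
      using level_cases[OF that(1) T(1)] that T by auto
    have uT: "d T (u i) (p i) \<le> gatec" for i using u[of i] by (simp add: is_gate_def)
    have "d V (u 0) x \<le> R'" if V: "V \<in> I" "lev V \<le> k" for V
    proof (cases "V = T")
      case True
      then show ?thesis using uT[of 0] p(1) bounds k1 gatec_nonneg by simp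
    next
      case False
      from cases[OF V] False consider "orth V T" | "mk T V" by blast
      then show ?thesis
      proof cases
        case 1
        then have "d V (u 0) x \<le> gatec" using gate_base[OF u V(1)] by simp
        then show ?thesis using bounds k1 gatec_nonneg by linarith
      next
        case 2
        from near_marker[OF T(1) V(1) 2 X small[OF V False] T(3)]
        have "d V (u 0) x \<le> gatec + nearc R + \<kappa>"
          using gate_marker[OF u _ T(1) V(1) 2 X(1)] by simp
        then show ?thesis using bounds by simp
      qed
    qed
    then have start: "step (Suc k) R' None x (u 0)"
      using X uX d_sym[OF _ X(1) uX] by (simp add: step_def)
    have "d V (u m) y \<le> R'" if V: "V \<in> I" "lev V \<le> k" for V
    proof (cases "V = T")
      case True
      then show ?thesis using uT[of m] p(2) bounds k1 gatec_nonneg by simp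
    next
      case False
      from cases[OF V] False consider "orth V T" | "mk T V" by blast
      then show ?thesis
      proof cases
        case 1
        then have "d V (u m) x \<le> gatec" using gate_base[OF u V(1)] by simp
        then show ?thesis using d_tri[OF V(1) uX[of m] X] small[OF V False] bounds by simp
      next
        case 2
        have "d V y x \<le> R" using small[OF V False] d_sym[OF V(1) X] by simp
        from near_marker[OF T(1) V(1) 2 X(2,1) this T(4)]
        have "d V (u m) y \<le> gatec + nearc R + \<kappa>"
          using gate_marker[OF u _ T(1) V(1) 2 X(2)] by simp
        then show ?thesis using bounds by simp
      qed
    qed
    then have finish: "step (Suc k) R' None (u m) y"
      using X uX by (simp add: step_def)
    have "d V (u i) (u (Suc i)) \<le> R'" if V: "V \<in> I" "lev V \<le> k" for V i
    proof (cases "V = T")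
      case True
      then show ?thesis
        using gate_mem[OF u[of i] u[of "Suc i"], of T] T p(3,4)[of i] p(3)[of "Suc i"] bounds by simp
    next
      case False
      from cases[OF V] False consider "orth V T" | "mk T V" by blast
      then show ?thesis
      proof cases
        case 1
        then show ?thesis
          using gate_orth[OF u[of i] u[of "Suc i"] V(1) X(1) X(1)] d_refl[OF V(1) X(1)] bounds k1
          by simp
      next
        case 2
        then show ?thesis
          using gate_mk[OF u[of i] u[of "Suc i"] _ _ T(1) V(1)] bounds k1 by simp
      qed
    qed
    then have "path (Suc k) R' (u 0) (map (\<lambda>i. (None, u (Suc i))) [0..<m]) (u m)"
      using uX by (intro path_of_chain) (simp add: step_def)
    then have "path (Suc k) R' x ((None, u 0) # map (\<lambda>i. (None, u (Suc i))) [0..<m] @ [(None, y)]) y"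
      using start finish by (auto intro!: path_append)
    then show "\<exists>qs. path (Suc k) R' x qs y \<and> fst ` set qs \<subseteq> {None} \<and>
        real (length qs) \<le> \<kappa> + 2 + jump l x y"
      using p(5) Some
      by (intro exI[of _ "(None, u 0) # map (\<lambda>i. (None, u (Suc i))) [0..<m] @ [(None, y)]"]) auto
  qed
qed

abbreviation vertex :: "'x \<Rightarrow> ('s option \<times> 'x) list \<Rightarrow> nat \<Rightarrow> 'x" where
  "vertex x ps i \<equiv> (x # map snd ps) ! i"

lemma path_nth:
  "path m R x ps y \<Longrightarrow> i < length ps \<Longrightarrow>
     step m R (fst (ps ! i)) (vertex x ps i) (vertex x ps (Suc i))"
proof (induction ps arbitrary: x i)
  case (Cons p ps)
  obtain l z where p: "p = (l, z)" by (cases p)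
  show ?case
  proof (cases i)
    case 0
    then show ?thesis using Cons.prems p by simp
  next
    case (Suc i')
    then show ?thesis using Cons.IH[of z i'] Cons.prems p by simp
  qed
qed simp

lemma path_last: "path m R x ps y \<Longrightarrow> vertex x ps (length ps) = y"
  by (induction ps arbitrary: x) auto

lemma subdivide_path:
  assumes "3 * \<kappa> \<le> R" "path (Suc k) R x ps y"
  shows "\<exists>qs. path (Suc k) (R + nearc R + 2 * gatec + 3 * \<kappa>) x qs y \<and> fst ` set qs \<subseteq> {None} \<and>
     real (length qs) \<le> (\<kappa> + 2) * length ps +
       (\<Sum>i<length ps. jump (fst (ps ! i)) (vertex x ps i) (vertex x ps (Suc i)))"
  using assms(2)
proof (induction ps arbitrary: x)
  case Nil
  then show ?case by (intro exI[of _ "[]"]) simp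
next
  case (Cons p ps)
  obtain l z where p: "p = (l, z)" by (cases p)
  have pz: "path (Suc k) R z ps y" using Cons.prems p by simp
  obtain qs where qs: "path (Suc k) (R + nearc R + 2 * gatec + 3 * \<kappa>) z qs y"
    "fst ` set qs \<subseteq> {None}" "real (length qs) \<le> (\<kappa> + 2) * length ps +
       (\<Sum>i<length ps. jump (fst (ps ! i)) (vertex z ps i) (vertex z ps (Suc i)))"
    using Cons.IH[OF pz] by blast
  obtain qs' where qs': "path (Suc k) (R + nearc R + 2 * gatec + 3 * \<kappa>) x qs' z"
    "fst ` set qs' \<subseteq> {None}" "real (length qs') \<le> \<kappa> + 2 + jump l x z"
    using subdivide_step[OF assms(1), of k l x z] Cons.prems p by auto
  have "path (Suc k) (R + nearc R + 2 * gatec + 3 * \<kappa>) x (qs' @ qs) y"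
    using qs(1) qs'(1) by (rule path_append[rotated])
  then show ?case
    using qs(2,3) qs'(2,3) p
    by (intro exI[of _ "qs' @ qs"]) (auto simp: sum.lessThan_Suc_shift algebra_simps simp del: sum.lessThan_Suc)
qed

section \<open>Total drift is linear in the number of steps\<close>

text \<open>A domain whose coordinate drifts far from \<open>z 0\<close> by small steps crosses many consecutive
  ranges of width \<open>w\<close>. While \<open>U\<close> is away from \<open>z 0\<close>, every domain between \<open>z 0\<close> and \<open>U\<close> stays
  still, which makes the time intervals of these crossings nested as in \<open>interval_count\<close>.\<close>

lemma drift_crossings:
  assumes R: "0 \<le> R" and g: "g = 4 * \<kappa> + (R + \<kappa>) + 1"
    and w: "w = 3 * (2 * real n * g + (R + \<kappa>) + 8 * \<kappa>)"
    and A: "finite A" "A \<subseteq> I" "\<And>T. T \<in> A \<Longrightarrow> lev T = k" and z: "\<And>i. z i \<in> X"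
    and \<tau>: "\<And>T. T \<in> A \<Longrightarrow> \<tau> T \<le> M"
    and steps: "\<And>T i. T \<in> A \<Longrightarrow> i < \<tau> T \<Longrightarrow> d T (z i) (z (Suc i)) \<le> R"
    and P: "P = (SIGMA T:A. {j. 1 \<le> j \<and> real (Suc j) * w \<le> d T (z 0) (z (\<tau> T))})"
    and finP: "finite P"
  shows "card P \<le> 2 * n * Suc M"
proof -
  note k1 = kappa
  \<comment> \<open>\<open>S\<close> bounds the growth of \<open>f\<close> in one step. The gap
    \<open>g\<close> exceeds \<open>S + 4 * \<kappa>\<close>, and a third of \<open>w\<close> holds
    \<open>2 * n + 1\<close> values with gaps \<open>g\<close>.\<close>
  define S where "S = R + \<kappa>"
  define f where "f T i = d T (z 0) (z i)" for T i
  have S0: "1 \<le> S" and g0: "1 \<le> g" using R k1 by (simp_all add: S_def g)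
  have ng: "0 \<le> 2 * real n * g" using g0 by simp
  have w3: "w / 3 = 2 * real n * g + S + 8 * \<kappa>" by (simp add: w S_def)
  have w0: "0 < w" "3 * \<kappa> < w - S" "4 * \<kappa> < w / 3"
    using ng S0 k1 w3 by linarith+
  have AI: "T \<in> I" if "T \<in> A" for T using that A by blast
  have fstep: "f T (Suc i) \<le> f T i + S" if "T \<in> A" "i < \<tau> T" for T i
    using d_tri[OF AI[OF that(1)] z[of 0] z[of i] z[of "Suc i"]] steps[OF that]
    unfolding f_def S_def by linarith
  have PA: "fst p \<in> A" "1 \<le> snd p" "real (Suc (snd p)) * w \<le> f (fst p) (\<tau> (fst p))" if "p \<in> P" for p
    using that by (auto simp: P f_def)
  have "\<exists>s t. s < t \<and> t \<le> \<tau> (fst p) \<and> f (fst p) s \<le> real (snd p) * w \<and>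
      real (Suc (snd p)) * w \<le> f (fst p) t \<and>
      (\<forall>i. s < i \<longrightarrow> i < t \<longrightarrow> real (snd p) * w < f (fst p) i \<and> f (fst p) i < real (Suc (snd p)) * w)"
    if p: "p \<in> P" for p
  proof -
    have f0: "f (fst p) 0 \<le> real (snd p) * w"
      using d_refl[OF AI[OF PA(1)[OF p]] z] w0 by (simp add: f_def)
    have "real (snd p) * w < real (Suc (snd p)) * w" using w0 by simp
    then obtain s t where "s < t" "t \<le> \<tau> (fst p)" "f (fst p) s \<le> real (snd p) * w"
      "real (Suc (snd p)) * w \<le> f (fst p) t"
      "\<And>i. s < i \<Longrightarrow> i < t \<Longrightarrow> real (snd p) * w < f (fst p) i \<and> f (fst p) i < real (Suc (snd p)) * w"
      using crossing[OF f0 _ PA(3)[OF p] le0] by metis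
    then show ?thesis by blast
  qed
  then obtain s t where st: "\<And>p. p \<in> P \<Longrightarrow> s p < t p \<and> t p \<le> \<tau> (fst p) \<and>
      f (fst p) (s p) \<le> real (snd p) * w \<and> real (Suc (snd p)) * w \<le> f (fst p) (t p) \<and>
      (\<forall>i. s p < i \<longrightarrow> i < t p \<longrightarrow> real (snd p) * w < f (fst p) i \<and> f (fst p) i < real (Suc (snd p)) * w)"
    by metis
  \<comment> \<open>The core of a crossing consists of the times at which its value lies in the
    middle third of the range.\<close>
  define lo where "lo p = real (snd p) * w + w / 3" for p :: "'s \<times> nat"
  define J where "J p = {m. s p < m \<and> m < t p \<and> lo p \<le> f (fst p) m \<and> f (fst p) m \<le> lo p + w / 3}"
    for p :: "'s \<times> nat"
  define lt where "lt p q \<longleftrightarrow> before (z 0) (fst p) (fst q)" for p q :: "'s \<times> nat"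
  \<comment> \<open>Since \<open>1 \<le> snd p\<close>, the range lies above \<open>w\<close>. At
    the left end the value may be lower, but it is followed by a value in or above the range, so it
    falls short by at most \<open>S\<close>.\<close>
  have away: "3 * \<kappa> < f (fst p) m" if p: "p \<in> P" and m: "m \<in> {s p..t p}" for p m
  proof -
    have "real 1 * w \<le> real (snd p) * w" using PA(2)[OF p] w0 by (intro mult_right_mono) auto
    then have lw: "w \<le> real (snd p) * w" by simp
    have up: "real (snd p) * w \<le> f (fst p) i" if "s p < i" "i \<le> t p" for i
    proof (cases "i = t p")
      case True
      have "real (snd p) * w \<le> real (Suc (snd p)) * w" using w0 by (intro mult_right_mono) auto
      with True st[OF p] show ?thesis by simp
    next
      case False
      then show ?thesis using st[OF p] that by fastforce
    qed
    show ?thesis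
    proof (cases "m = s p")
      case True
      have "f (fst p) (Suc m) \<le> f (fst p) m + S"
        using fstep[OF PA(1)[OF p]] st[OF p] True by auto
      moreover have "real (snd p) * w \<le> f (fst p) (Suc m)" using up[of "Suc m"] st[OF p] True by auto
      ultimately show ?thesis using lw w0 by linarith
    next
      case False
      then have "real (snd p) * w \<le> f (fst p) m" using up m by auto
      then show ?thesis using lw w0 S0 by linarith
    qed
  qed
  \<comment> \<open>While \<open>fst q\<close> is away from \<open>z 0\<close>,
    \<open>before_target\<close> keeps the coordinate in \<open>fst p\<close> near the marker of
    \<open>fst q\<close>; it moves at most \<open>3 * \<kappa>\<close>, and the triangle error is
    one more.\<close>
  have still: "f (fst p) m \<le> f (fst p) m' + 4 * \<kappa>"
    if p: "p \<in> P" and q: "q \<in> P" and lt: "lt p q" and m: "m \<in> {s q..t q}" "m' \<in> {s q..t q}"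
    for p q m m'
  proof -
    have I: "fst p \<in> I" "fst q \<in> I" using AI PA p q by blast+
    have trpq: "tr (fst p) (fst q)" and r0: "r (fst q) (fst p) (z 0) \<le> \<kappa>"
      using lt by (auto simp: lt_def before_def)
    have pin: "r (fst p) (fst q) (z i) \<le> \<kappa>" if "i \<in> {s q..t q}" for i
      by (rule before_target[OF I z z _ away[OF q that, unfolded f_def]])
        (use lt in \<open>simp add: lt_def\<close>)
    have "d (fst p) (z m') (z m) \<le> 3 * \<kappa>"
      using d_le_r[OF I(2,1) mk_tr[OF tr_sym[OF I trpq]] z z, of m' m] pin[OF m(1)] pin[OF m(2)]
      by simp
    then show ?thesis using d_tri[OF I(1) z[of 0] z[of m'] z[of m]] by (simp add: f_def)
  qed
  show ?thesis
  proof (rule interval_count[where s = s and t = t and J = J and lt = lt])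
    show "finite P" by (rule finP)
    show "s p \<le> t p" "t p \<le> M" if "p \<in> P" for p
      using st[OF that] \<tau>[OF PA(1)[OF that]] by linarith+
    show "J p \<subseteq> {s p<..<t p}" if "p \<in> P" for p by (auto simp: J_def)
    show "s p < s q \<and> t q < t p"
      if p: "p \<in> P" and q: "q \<in> P" and lt: "lt p q" and meet: "J p \<inter> {s q..t q} \<noteq> {}" for p q
    proof -
      obtain m where m: "m \<in> J p" "m \<in> {s q..t q}" using meet by blast
      have mJ: "s p < m" "m < t p" "lo p \<le> f (fst p) m" "f (fst p) m \<le> lo p + w / 3"
        using m(1) by (auto simp: J_def)
      \<comment> \<open>The values at both ends of \<open>p\<close> differ from a core value by at
        least \<open>w / 3\<close>, which exceeds the \<open>4 * \<kappa>\<close> of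
        \<open>still\<close>. An interval that meets the core and misses both ends lies
        inside.\<close>
      have "s p \<notin> {s q..t q}"
        using still[OF p q lt m(2), of "s p"] st[OF p] mJ(3) w0 by (auto simp: lo_def)
      moreover have "t p \<notin> {s q..t q}"
        using still[OF p q lt _ m(2), of "t p"] st[OF p] mJ(4) w0
        by (auto simp: lo_def algebra_simps)
      ultimately show ?thesis using m(2) mJ by auto
    qed
    show "card D \<le> n"
      if D: "D \<subseteq> P" and m: "\<And>p. p \<in> D \<Longrightarrow> m \<in> {s p<..<t p}"
        and nlt: "\<And>p q. p \<in> D \<Longrightarrow> q \<in> D \<Longrightarrow> p \<noteq> q \<Longrightarrow> \<not> lt p q" for D m
    proof -
      \<comment> \<open>At time \<open>m\<close> one domain can be strictly inside only one of its
        disjoint ranges.\<close>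
      have inj: "inj_on fst D"
      proof (rule inj_onI)
        fix p q assume pq: "p \<in> D" "q \<in> D" "fst p = fst q"
        have "real (snd p) * w < f (fst p) m" "f (fst p) m < real (Suc (snd p)) * w"
          "real (snd q) * w < f (fst p) m" "f (fst p) m < real (Suc (snd q)) * w"
          using st[of p] st[of q] m[OF pq(1)] m[OF pq(2)] D pq by auto
        then have "real (snd p) * w < real (Suc (snd q)) * w" "real (snd q) * w < real (Suc (snd p)) * w"
          by linarith+
        then have "real (snd p) < real (Suc (snd q))" "real (snd q) < real (Suc (snd p))"
          using w0(1) by (simp_all only: mult_less_cancel_right_pos)
        then show "p = q" using pq(3) by (simp add: prod_eq_iff)
      qed
      have finD: "finite D" using finite_subset[OF D finP] .
      have sub: "fst ` D \<subseteq> I" using D PA(1) AI by blast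
      have "pairwise orth (fst ` D)"
      proof (rule pairwiseI)
        fix T U assume TU: "T \<in> fst ` D" "U \<in> fst ` D" "T \<noteq> U"
        then obtain p q where pq: "p \<in> D" "q \<in> D" "T = fst p" "U = fst q" by blast
        then have "T \<in> A" "U \<in> A" using D PA(1) by blast+
        then have I: "T \<in> I" "U \<in> I" and lev: "lev T = lev U" using AI A(3) by auto
        have "\<not> tr T U"
        proof
          assume "tr T U"
          from before_cases[OF I this z[of 0]] show False
            using nlt[OF pq(1,2)] nlt[OF pq(2,1)] TU(3) pq(3,4) by (auto simp: lt_def)
        qed
        then show "orth T U" using same_level_cases[OF I lev] TU(3) by blast
      qed
      then have "card (fst ` D) \<le> n" using orth_card[OF _ sub] finD by blast
      then show ?thesis using card_image[OF inj] by simp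
    qed
    show "2 * n < card D"
      if p: "p \<in> P" and D: "D \<subseteq> P" and lt: "\<And>q. q \<in> D \<Longrightarrow> lt p q"
        and cov: "J p \<subseteq> (\<Union>q\<in>D. {s q..t q})" for p D
    proof -
      \<comment> \<open>These \<open>2 * n + 1\<close> target values are each visited in the core up
        to an overshoot \<open>S\<close>. As consecutive targets differ by more than
        \<open>S + 4 * \<kappa>\<close>, no interval of \<open>D\<close> can cover the visits to two
        of them.\<close>
      let ?v = "\<lambda>i. lo p + real i * g"
      have "\<exists>m\<in>J p. ?v i \<le> f (fst p) m \<and> f (fst p) m \<le> ?v i + S" if i: "i \<le> 2 * n" for i
      proof -
        have "real i * g \<le> real (2 * n) * g" using i g0 by (intro mult_right_mono) auto
        then have ig: "real i * g \<le> 2 * real n * g" "0 \<le> real i * g" using g0 by auto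
        have v1: "lo p \<le> ?v i" using ig(2) by simp
        have v2: "?v i + S \<le> lo p + w / 3" using ig(1) w3 k1 by linarith
        have "real (Suc (snd p)) * w = real (snd p) * w + w" by (simp add: algebra_simps)
        then have v3: "?v i + S < real (Suc (snd p)) * w" using v2 w0(1) unfolding lo_def by linarith
        note v = v1 v2 v3
        define m where "m = (LEAST m. s p \<le> m \<and> ?v i \<le> f (fst p) m)"
        have tp: "s p \<le> t p" "?v i \<le> f (fst p) (t p)" using st[OF p] v(3) S0 by auto
        have m: "s p \<le> m" "?v i \<le> f (fst p) m"
          using LeastI[of "\<lambda>m. s p \<le> m \<and> ?v i \<le> f (fst p) m" "t p"] tp unfolding m_def by auto
        have mt: "m \<le> t p" unfolding m_def using tp by (intro Least_le) simp
        have "f (fst p) (s p) < ?v i" using st[OF p] v(1) w0 by (simp add: lo_def)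
        then have ms: "m \<noteq> s p" using m by auto
        then obtain m' where m': "m = Suc m'" "s p \<le> m'" using m(1) by (cases m) auto
        have "\<not> ?v i \<le> f (fst p) m'"
          using not_less_Least[of m' "\<lambda>m. s p \<le> m \<and> ?v i \<le> f (fst p) m"] m' unfolding m_def by auto
        moreover have "f (fst p) m \<le> f (fst p) m' + S"
          using fstep[OF PA(1)[OF p], of m'] m' mt st[OF p] by simp
        ultimately have up: "f (fst p) m \<le> ?v i + S" by linarith
        have "m \<noteq> t p" using up v(3) st[OF p] by auto
        then have "m \<in> J p" using m ms mt up v by (auto simp: J_def)
        then show ?thesis using m(2) up by blast
      qed
      then obtain h where h: "\<And>i. i \<le> 2 * n \<Longrightarrow> h i \<in> J p"
        "\<And>i. i \<le> 2 * n \<Longrightarrow> ?v i \<le> f (fst p) (h i)" "\<And>i. i \<le> 2 * n \<Longrightarrow> f (fst p) (h i) \<le> ?v i + S"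
        by metis
      have "\<exists>q\<in>D. h i \<in> {s q..t q}" if "i \<le> 2 * n" for i using cov h(1)[OF that] by blast
      then obtain b where b: "\<And>i. i \<le> 2 * n \<Longrightarrow> b i \<in> D" "\<And>i. i \<le> 2 * n \<Longrightarrow> h i \<in> {s (b i)..t (b i)}"
        by metis
      have ne: "b i \<noteq> b j" if ij: "i < j" "j \<le> 2 * n" for i j
      proof
        assume eq: "b i = b j"
        have i: "i \<le> 2 * n" using ij by simp
        have "b i \<in> P" using b(1)[OF i] D by blast
        then have "f (fst p) (h j) \<le> f (fst p) (h i) + 4 * \<kappa>"
          using still[OF p _ lt[OF b(1)[OF i]], of "h j" "h i"] b(2)[OF i] b(2)[OF ij(2)] eq by simp
        moreover have "real (i + 1) * g \<le> real j * g" using ij g0 by (intro mult_right_mono) auto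
        ultimately show False
          using h(3)[OF i] h(2)[OF ij(2)] g by (simp add: S_def algebra_simps)
      qed
      have "inj_on b {..2 * n}"
      proof (rule inj_onI)
        fix i j assume "i \<in> {..2 * n}" "j \<in> {..2 * n}" "b i = b j"
        then show "i = j" using ne[of i j] ne[of j i] by (cases i j rule: linorder_cases) auto
      qed
      moreover have "b ` {..2 * n} \<subseteq> D" using b(1) by auto
      ultimately have "card {..2 * n} \<le> card D"
        using card_inj_on_le finite_subset[OF D finP] by blast
      then show ?thesis by simp
    qed
  qed
qed

text \<open>Each distance is measured by the ranges of width \<open>w\<close> that are crossed
  completely. Up to two ranges per domain are not counted, the lowest and the incomplete top one;
  the term \<open>card A\<close> pays for them.\<close>

lemma drift_bound:
  assumes R: "0 \<le> R"
  shows "\<exists>C\<ge>0. \<forall>A z \<tau> M. finite A \<longrightarrow> A \<subseteq> I \<longrightarrow> (\<forall>T\<in>A. lev T = k) \<longrightarrow> (\<forall>i. z i \<in> X) \<longrightarrow>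
     (\<forall>T\<in>A. \<tau> T \<le> M \<and> (\<forall>i<\<tau> T. d T (z i) (z (Suc i)) \<le> R)) \<longrightarrow>
     (\<Sum>T\<in>A. d T (z 0) (z (\<tau> T))) \<le> C * real (Suc M + card A)"
proof -
  define g where "g = 4 * \<kappa> + (R + \<kappa>) + 1"
  define w where "w = 3 * (2 * real n * g + (R + \<kappa>) + 8 * \<kappa>)"
  have g0: "0 \<le> g" using R kappa by (simp add: g_def)
  have "0 \<le> 2 * real n * g" using g0 by simp
  then have "0 < 2 * real n * g + (R + \<kappa>) + 8 * \<kappa>" using R kappa by linarith
  then have w0: "0 < w" by (simp add: w_def)
  have "(\<Sum>T\<in>A. d T (z 0) (z (\<tau> T))) \<le> (w * (2 * n + 2)) * real (Suc M + card A)"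
    if A: "finite A" "A \<subseteq> I" "\<forall>T\<in>A. lev T = k" and z: "\<forall>i. z i \<in> X"
      and \<tau>: "\<forall>T\<in>A. \<tau> T \<le> M \<and> (\<forall>i<\<tau> T. d T (z i) (z (Suc i)) \<le> R)" for A z \<tau> M
  proof -
    define L where "L T = {j. 1 \<le> j \<and> real (Suc j) * w \<le> d T (z 0) (z (\<tau> T))}" for T
    have L: "L T = {1..<nat \<lfloor>d T (z 0) (z (\<tau> T)) / w\<rfloor>}" for T
    proof (rule set_eqI)
      fix j
      have "real (Suc j) * w \<le> d T (z 0) (z (\<tau> T)) \<longleftrightarrow> real (Suc j) \<le> d T (z 0) (z (\<tau> T)) / w"
        using w0 by (simp add: pos_le_divide_eq)
      also have "\<dots> \<longleftrightarrow> int (Suc j) \<le> \<lfloor>d T (z 0) (z (\<tau> T)) / w\<rfloor>"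
        by (simp add: le_floor_iff)
      also have "\<dots> \<longleftrightarrow> j < nat \<lfloor>d T (z 0) (z (\<tau> T)) / w\<rfloor>" by linarith
      finally show "j \<in> L T \<longleftrightarrow> j \<in> {1..<nat \<lfloor>d T (z 0) (z (\<tau> T)) / w\<rfloor>}"
        by (auto simp: L_def)
    qed
    have finL: "finite (L T)" for T by (simp add: L)
    have "card (Sigma A L) \<le> 2 * n * Suc M"
    proof (rule drift_crossings[OF R g_def w_def A(1,2)])
      show "Sigma A L = (SIGMA T:A. {j. 1 \<le> j \<and> real (Suc j) * w \<le> d T (z 0) (z (\<tau> T))})"
        by (intro Sigma_cong refl) (simp only: L_def)
      show "finite (Sigma A L)" using A(1) finL by blast
    qed (use A z \<tau> in auto)
    then have cL: "(\<Sum>T\<in>A. card (L T)) \<le> 2 * n * Suc M"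
      using card_SigmaI[OF A(1), of L] finL by simp
    have "d T (z 0) (z (\<tau> T)) \<le> w * (card (L T) + 2)" if "T \<in> A" for T
    proof -
      have "0 \<le> d T (z 0) (z (\<tau> T)) / w" using d_nonneg w0 by simp
      then have "d T (z 0) (z (\<tau> T)) / w \<le> real (card (L T)) + 2"
        unfolding L by simp linarith
      then have "d T (z 0) (z (\<tau> T)) \<le> (real (card (L T)) + 2) * w"
        using w0 by (simp only: pos_divide_le_eq)
      then show ?thesis by (simp add: algebra_simps)
    qed
    then have "(\<Sum>T\<in>A. d T (z 0) (z (\<tau> T))) \<le> (\<Sum>T\<in>A. w * (card (L T) + 2))"
      by (rule sum_mono)
    also have "\<dots> = w * (real (\<Sum>T\<in>A. card (L T)) + 2 * card A)"
      by (simp add: sum_distrib_left[symmetric] sum.distrib)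
    also have "\<dots> \<le> w * (real (2 * n * Suc M) + 2 * card A)"
      using cL w0 by (intro mult_left_mono add_mono) (auto simp only: of_nat_le_iff)
    also have "\<dots> \<le> w * (real (2 * n + 2) * real (Suc M + card A))"
    proof (rule mult_left_mono)
      have "2 * n * Suc M + 2 * card A \<le> (2 * n + 2) * (Suc M + card A)"
        by (simp add: algebra_simps)
      then show "real (2 * n * Suc M) + 2 * card A \<le> real (2 * n + 2) * real (Suc M + card A)"
        by (metis of_nat_add of_nat_le_iff of_nat_mult of_nat_numeral)
    qed (use w0 in simp)
    finally show ?thesis by (simp add: mult.assoc)
  qed
  then show ?thesis
    using w0 by (intro exI[of _ "w * (2 * n + 2)"]) simp
qed

end

section \<open>The distance formula for coarse hierarchies\<close>

context coarse_hierarchy begin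

definition rel_sum :: "real \<Rightarrow> 'x \<Rightarrow> 'x \<Rightarrow> real" where
  "rel_sum s x y = (\<Sum>U | U \<in> I \<and> s \<le> d U x y. d U x y)"

lemma rel_sum_nonneg: "0 \<le> rel_sum s x y"
  unfolding rel_sum_def by (rule sum_nonneg) (rule d_nonneg)

lemma sum_le_rel_sum:
  assumes "x \<in> X" "y \<in> X" "18 * \<kappa> \<le> s" "finite A" "A \<subseteq> I"
  shows "(\<Sum>T\<in>A. d T x y) \<le> rel_sum s x y + s * card A"
proof -
  have s0: "0 \<le> s" using assms(3) kappa by simp
  have "(\<Sum>T\<in>A. d T x y) = (\<Sum>T\<in>A \<inter> {T. s \<le> d T x y}. d T x y) + (\<Sum>T\<in>A - {T. s \<le> d T x y}. d T x y)"
    using assms(4) by (metis add.commute sum.Int_Diff)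
  also have "(\<Sum>T\<in>A \<inter> {T. s \<le> d T x y}. d T x y) \<le> rel_sum s x y"
    unfolding rel_sum_def using finite_relevant[OF assms(1-3)] assms(5) d_nonneg
    by (intro sum_mono2) auto
  also have "(\<Sum>T\<in>A - {T. s \<le> d T x y}. d T x y) \<le> (\<Sum>T\<in>A - {T. s \<le> d T x y}. s)"
    by (rule sum_mono) auto
  also have "\<dots> \<le> s * card A"
    using assms(4) s0 by (simp add: mult.commute card_mono mult_left_mono)
  finally show ?thesis by simp
qed

text \<open>A jump in \<open>T\<close> is at most \<open>d T x y\<close> plus the distances from
  \<open>x\<close> to its start and from \<open>y\<close> to its end. As labels do not repeat, all
  other steps are small in \<open>T\<close>, so \<open>drift_bound\<close> estimates the first
  distances along the path and the second along the reversed path.\<close>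

lemma jump_sum_bound:
  assumes R: "3 * \<kappa> \<le> R" and s: "18 * \<kappa> \<le> s"
  shows "\<exists>C\<ge>0. \<forall>x ps y. path (Suc k) R x ps y \<longrightarrow> x \<in> X \<longrightarrow>
     distinct (filter (\<lambda>l. l \<noteq> None) (map fst ps)) \<longrightarrow>
     (\<Sum>i<length ps. jump (fst (ps ! i)) (vertex x ps i) (vertex x ps (Suc i)))
       \<le> rel_sum s x y + C * real (Suc (length ps))"
proof -
  have k1: "1 \<le> \<kappa>" by (rule kappa)
  have R0: "0 \<le> R" using R k1 by simp
  obtain C where C: "0 \<le> C" "\<forall>A z \<tau> M. finite A \<longrightarrow> A \<subseteq> I \<longrightarrow> (\<forall>T\<in>A. lev T = k) \<longrightarrow>
     (\<forall>i. z i \<in> X) \<longrightarrow> (\<forall>T\<in>A. \<tau> T \<le> M \<and> (\<forall>i<\<tau> T. d T (z i) (z (Suc i)) \<le> R)) \<longrightarrow>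
     (\<Sum>T\<in>A. d T (z 0) (z (\<tau> T))) \<le> C * real (Suc M + card A)"
    using drift_bound[OF R0, of k] by blast
  have bound: "(\<Sum>i<length ps. jump (fst (ps ! i)) (vertex x ps i) (vertex x ps (Suc i)))
       \<le> rel_sum s x y + (4 * C + s + 2 * \<kappa>) * real (Suc (length ps))"
    if p: "path (Suc k) R x ps y" and x: "x \<in> X"
      and dist: "distinct (filter (\<lambda>l. l \<noteq> None) (map fst ps))" for x ps y
  proof -
    define M where "M = length ps"
    \<comment> \<open>The path is continued by its last vertex, since \<open>drift_bound\<close>
      takes infinite sequences.\<close>
    define z where "z i = vertex x ps (min i M)" for i
    have st: "step (Suc k) R (fst (ps ! i)) (z i) (z (Suc i))" if "i < M" for i
      using path_nth[OF p] that by (simp add: z_def M_def)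
    have z0: "z 0 = x" by (simp add: z_def)
    have zM: "z M = y" using path_last[OF p] by (simp add: z_def M_def)
    have y: "y \<in> X" by (rule path_end[OF p x])
    have zX: "z i \<in> X" for i
    proof (cases "i < M")
      case True
      then show ?thesis using st by (simp add: step_def)
    next
      case False
      then have "z i = z M" by (simp add: z_def)
      then show ?thesis using zM y by simp
    qed
    have uniq: "i = j" if "i < M" "j < M" "fst (ps ! i) = Some T" "fst (ps ! j) = Some T" for i j T
    proof (rule ccontr)
      have no: False if "a < b" "b < M" "fst (ps ! a) = Some T" "fst (ps ! b) = Some T" for a b
        using distinct_filter_nth[OF dist, of a b] that by (simp add: M_def)
      assume "i \<noteq> j"
      then show False using no[of i j] no[of j i] that by linarith
    qed
    define L where "L = {i. i < M \<and> fst (ps ! i) \<noteq> None}"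
    define A where "A = (\<lambda>i. the (fst (ps ! i))) ` L"
    define \<tau> where "\<tau> T = (THE i. i < M \<and> fst (ps ! i) = Some T)" for T
    have \<tau>: "\<tau> T = i" if "i < M" "fst (ps ! i) = Some T" for T i
      unfolding \<tau>_def using uniq that by blast
    have finL: "finite L" by (simp add: L_def)
    then have finA: "finite A" by (simp add: A_def)
    have A\<tau>: "\<tau> T < M \<and> fst (ps ! \<tau> T) = Some T" if "T \<in> A" for T
      using that \<tau> by (auto simp: A_def L_def)
    have AI: "T \<in> I" "lev T = k" if "T \<in> A" for T
      using st[of "\<tau> T"] A\<tau>[OF that] by (auto simp: step_def)
    have cA: "card A \<le> M"
    proof -
      have "card A \<le> card L" unfolding A_def by (rule card_image_le[OF finL])
      also have "\<dots> \<le> card {..<M}" by (rule card_mono) (auto simp: L_def)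
      finally show ?thesis by simp
    qed
    have other: "d T (z i) (z (Suc i)) \<le> R" if "T \<in> A" "i < M" "i \<noteq> \<tau> T" for T i
      using st[OF that(2)] AI[OF that(1)] \<tau>[OF that(2), of T] that(3) by (auto simp: step_def)
    have sum_eq: "(\<Sum>i<M. jump (fst (ps ! i)) (z i) (z (Suc i))) = (\<Sum>T\<in>A. d T (z (\<tau> T)) (z (Suc (\<tau> T))))"
    proof -
      have "(\<Sum>i<M. jump (fst (ps ! i)) (z i) (z (Suc i))) = (\<Sum>i\<in>L. jump (fst (ps ! i)) (z i) (z (Suc i)))"
        by (rule sum.mono_neutral_right) (auto simp: L_def)
      also have "\<dots> = (\<Sum>T\<in>A. d T (z (\<tau> T)) (z (Suc (\<tau> T))))"
      proof (rule sum.reindex_bij_witness[of _ \<tau> "\<lambda>i. the (fst (ps ! i))"])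
        fix i assume "i \<in> L"
        then obtain T where i: "i < M" "fst (ps ! i) = Some T" by (auto simp: L_def)
        then show "\<tau> (the (fst (ps ! i))) = i" using \<tau> by simp
        show "the (fst (ps ! i)) \<in> A" using \<open>i \<in> L\<close> by (simp add: A_def)
        show "d (the (fst (ps ! i))) (z (\<tau> (the (fst (ps ! i))))) (z (Suc (\<tau> (the (fst (ps ! i)))))) =
            jump (fst (ps ! i)) (z i) (z (Suc i))"
          using i \<tau> by simp
      next
        fix T assume "T \<in> A"
        then show "the (fst (ps ! \<tau> T)) = T" "\<tau> T \<in> L" using A\<tau> by (auto simp: L_def)
      qed
      finally show ?thesis .
    qed
    have fwd: "(\<Sum>T\<in>A. d T (z 0) (z (\<tau> T))) \<le> C * real (Suc M + card A)"
    proof (rule C(2)[rule_format])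
      show "A \<subseteq> I" using AI by blast
      show "\<tau> T \<le> M \<and> (\<forall>i<\<tau> T. d T (z i) (z (Suc i)) \<le> R)" if "T \<in> A" for T
        using other[OF that] A\<tau>[OF that] by auto
    qed (use finA AI zX in auto)
    define z' where "z' i = z (M - i)" for i
    \<comment> \<open>The reversed path stops at \<open>z (Suc (\<tau> T))\<close>, just before it
      would make the jump in \<open>T\<close> backwards.\<close>
    define \<tau>' where "\<tau>' T = M - Suc (\<tau> T)" for T
    have small: "d T (z' i) (z' (Suc i)) \<le> R" if T: "T \<in> A" and i: "i < \<tau>' T" for T i
    proof -
      have j: "M - i = Suc (M - Suc i)" "M - Suc i < M" "M - Suc i \<noteq> \<tau> T"
        using i A\<tau>[OF T] by (auto simp: \<tau>'_def)
      then show ?thesis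
        using other[OF T j(2,3)] d_sym[OF AI(1)[OF T] zX zX, of "M - i" "M - Suc i"]
        by (simp add: z'_def)
    qed
    have "(\<Sum>T\<in>A. d T (z' 0) (z' (\<tau>' T))) \<le> C * real (Suc M + card A)"
    proof (rule C(2)[rule_format])
      show "A \<subseteq> I" using AI by blast
      show "\<tau>' T \<le> M \<and> (\<forall>i<\<tau>' T. d T (z' i) (z' (Suc i)) \<le> R)" if "T \<in> A" for T
        using small[OF that] by (auto simp: \<tau>'_def)
      show "z' i \<in> X" for i using zX by (simp add: z'_def)
    qed (use finA AI in auto)
    moreover have "z' 0 = y" "T \<in> A \<Longrightarrow> z' (\<tau>' T) = z (Suc (\<tau> T))" for T
      using zM A\<tau>[of T] by (auto simp: z'_def \<tau>'_def Suc_leI)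
    ultimately have bwd: "(\<Sum>T\<in>A. d T y (z (Suc (\<tau> T)))) \<le> C * real (Suc M + card A)" by simp
    have "d T (z (\<tau> T)) (z (Suc (\<tau> T))) \<le>
        d T (z 0) (z (\<tau> T)) + d T x y + d T y (z (Suc (\<tau> T))) + 2 * \<kappa>" if "T \<in> A" for T
      using d_tri4[OF AI(1)[OF that] zX x y zX, of "\<tau> T" "Suc (\<tau> T)"]
        d_sym[OF AI(1)[OF that] x zX, of "\<tau> T"] z0 by simp
    then have "(\<Sum>T\<in>A. d T (z (\<tau> T)) (z (Suc (\<tau> T)))) \<le>
        (\<Sum>T\<in>A. d T (z 0) (z (\<tau> T)) + d T x y + d T y (z (Suc (\<tau> T))) + 2 * \<kappa>)"
      by (rule sum_mono)
    also have "\<dots> = (\<Sum>T\<in>A. d T (z 0) (z (\<tau> T))) + (\<Sum>T\<in>A. d T x y) +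
        (\<Sum>T\<in>A. d T y (z (Suc (\<tau> T)))) + 2 * \<kappa> * card A"
      by (simp add: sum.distrib)
    also have "\<dots> \<le> rel_sum s x y + (2 * C * real (Suc M + card A) + (s + 2 * \<kappa>) * real (card A))"
      using fwd bwd sum_le_rel_sum[OF x y s finA] AI by (auto simp: subset_eq algebra_simps)
    also have "2 * C * real (Suc M + card A) \<le> 2 * C * (2 * real (Suc M))"
      using C(1) cA by (intro mult_left_mono) auto
    also have "(s + 2 * \<kappa>) * real (card A) \<le> (s + 2 * \<kappa>) * real (Suc M)"
      using s k1 cA by (intro mult_left_mono) auto
    finally have "(\<Sum>T\<in>A. d T (z (\<tau> T)) (z (Suc (\<tau> T)))) \<le>
        rel_sum s x y + (4 * C + s + 2 * \<kappa>) * real (Suc M)" by (simp add: algebra_simps)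
    moreover have "(\<Sum>i<length ps. jump (fst (ps ! i)) (vertex x ps i) (vertex x ps (Suc i))) =
        (\<Sum>i<M. jump (fst (ps ! i)) (z i) (z (Suc i)))"
      unfolding M_def z_def by (rule sum.cong) auto
    ultimately show ?thesis using sum_eq by (simp add: M_def)
  qed
  show ?thesis
  proof (rule exI[of _ "4 * C + s + 2 * \<kappa>"], intro conjI allI impI)
    show "0 \<le> 4 * C + s + 2 * \<kappa>" using C(1) s k1 by linarith
  qed (rule bound)
qed

text \<open>One level costs three operations: \<open>split_path\<close> isolates the jumps,
  \<open>lazy_path\<close> leaves one per domain, \<open>subdivide_path\<close> removes them. At
  level 0 nothing is required of a step, and a single one suffices.\<close>

lemma short_paths:
  assumes s: "18 * \<kappa> \<le> s"
  shows "\<exists>R C. 3 * \<kappa> \<le> R \<and> 0 \<le> C \<and> (\<forall>x\<in>X. \<forall>y\<in>X. \<exists>ps. path k R x ps y \<and> fst ` set ps \<subseteq> {None} \<and>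
     real (length ps) \<le> C * (1 + rel_sum s x y))"
proof (induction k)
  case 0
  show ?case
  proof (rule exI[of _ "3 * \<kappa>"], rule exI[of _ "1::real"], intro conjI ballI)
    fix x y assume "x \<in> X" "y \<in> X"
    then show "\<exists>ps. path 0 (3 * \<kappa>) x ps y \<and> fst ` set ps \<subseteq> {None} \<and>
        real (length ps) \<le> 1 * (1 + rel_sum s x y)"
      using rel_sum_nonneg[of s x y] by (intro exI[of _ "[(None, y)]"]) (simp add: step_def)
  qed simp_all
next
  case (Suc k)
  then obtain R C where R: "3 * \<kappa> \<le> R" "0 \<le> C" and IH: "\<forall>x\<in>X. \<forall>y\<in>X. \<exists>ps. path k R x ps y \<and>
      fst ` set ps \<subseteq> {None} \<and> real (length ps) \<le> C * (1 + rel_sum s x y)" by blast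
  obtain R1' M where R1': "\<forall>x ps y. path k R x ps y \<longrightarrow> fst ` set ps \<subseteq> {None} \<longrightarrow>
     (\<exists>qs. path (Suc k) R1' x qs y \<and> length qs \<le> M * length ps)"
    using split_path[OF R(1)] by blast
  have k1: "1 \<le> \<kappa>" by (rule kappa)
  define R1 where "R1 = max R1' (3 * \<kappa>)"
  have R1: "3 * \<kappa> \<le> R1" by (simp add: R1_def)
  define R2 where "R2 = R1 + nearc R1 + 2 * gatec + 2 * \<kappa>"
  have R2: "3 * \<kappa> \<le> R2"
    using R1 nearc_nonneg[of R1] gatec_nonneg k1 by (simp add: R2_def)
  define R3 where "R3 = R2 + nearc R2 + 2 * gatec + 3 * \<kappa>"
  have R3: "3 * \<kappa> \<le> R3"
    using R2 nearc_nonneg[of R2] gatec_nonneg k1 by (simp add: R3_def)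
  obtain D where D: "0 \<le> D" "\<forall>x ps y. path (Suc k) R2 x ps y \<longrightarrow> x \<in> X \<longrightarrow>
     distinct (filter (\<lambda>l. l \<noteq> None) (map fst ps)) \<longrightarrow>
     (\<Sum>i<length ps. jump (fst (ps ! i)) (vertex x ps i) (vertex x ps (Suc i)))
       \<le> rel_sum s x y + D * real (Suc (length ps))"
    using jump_sum_bound[OF R2 s, of k] by blast
  \<comment> \<open>Here \<open>1\<close> is the coefficient of the sum in the bound on the jumps,
    \<open>\<kappa> + 2\<close> the cost of subdivision per step, \<open>D\<close> the drift per
    step, and \<open>M * C + 2\<close> bounds \<open>Suc (length us)\<close>.\<close>
  define C' where "C' = 1 + (\<kappa> + 2 + D) * (M * C + 2)"
  have C': "0 \<le> C'" using k1 D(1) R(2) by (simp add: C'_def)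
  have "\<exists>ps. path (Suc k) R3 x ps y \<and> fst ` set ps \<subseteq> {None} \<and>
      real (length ps) \<le> C' * (1 + rel_sum s x y)" if X: "x \<in> X" "y \<in> X" for x y
  proof -
    let ?S = "rel_sum s x y"
    have S0: "0 \<le> ?S" by (rule rel_sum_nonneg)
    obtain ps where ps: "path k R x ps y" "fst ` set ps \<subseteq> {None}" "real (length ps) \<le> C * (1 + ?S)"
      using IH X by blast
    obtain qs where qs: "path (Suc k) R1' x qs y" "length qs \<le> M * length ps"
      using R1' ps by blast
    have "path (Suc k) R1 x qs y" by (rule path_mono[OF qs(1)]) (simp add: R1_def)
    from lazy_path[OF R1 this X(1)] obtain us where us: "path (Suc k) R2 x us y"
      "length us = Suc (length qs)" "distinct (filter (\<lambda>l. l \<noteq> None) (map fst us))"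
      unfolding R2_def by blast
    from subdivide_path[OF R2 us(1)] obtain vs where vs: "path (Suc k) R3 x vs y"
      "fst ` set vs \<subseteq> {None}" "real (length vs) \<le> (\<kappa> + 2) * length us +
       (\<Sum>i<length us. jump (fst (us ! i)) (vertex x us i) (vertex x us (Suc i)))"
      unfolding R3_def by blast
    have "real (length qs) \<le> real (M * length ps)" using qs(2) by (simp only: of_nat_le_iff)
    also have "\<dots> \<le> real M * (C * (1 + ?S))"
      using ps(3) by (simp add: mult_left_mono)
    finally have "real (Suc (length us)) \<le> real M * (C * (1 + ?S)) + 2 * (1 + ?S)"
      using us(2) S0 by simp
    also have "\<dots> = (M * C + 2) * (1 + ?S)" by (simp add: algebra_simps)
    finally have lu: "real (Suc (length us)) \<le> (M * C + 2) * (1 + ?S)" .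
    have "real (length vs) \<le> (\<kappa> + 2) * length us + (?S + D * real (Suc (length us)))"
      using vs(3) D(2) us X by fastforce
    also have "\<dots> \<le> (\<kappa> + 2) * real (Suc (length us)) + (?S + D * real (Suc (length us)))"
      using k1 by simp
    also have "\<dots> = ?S + (\<kappa> + 2 + D) * real (Suc (length us))" by (simp add: algebra_simps)
    also have "\<dots> \<le> (1 + ?S) + (\<kappa> + 2 + D) * ((M * C + 2) * (1 + ?S))"
      using lu k1 D(1) by (intro add_mono mult_left_mono) auto
    also have "\<dots> = C' * (1 + ?S)" by (simp add: C'_def algebra_simps)
    finally show ?thesis using vs by blast
  qed
  then show ?case using R3 C' by (intro exI[of _ R3] exI[of _ C']) simp
qed

text \<open>All levels are below \<open>n\<close>, so unlabelled steps at stage \<open>n\<close> are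
  small in every domain.\<close>

lemma chain_bound:
  assumes s: "18 * \<kappa> \<le> s"
  shows "\<exists>R C. 0 \<le> C \<and> (\<forall>x\<in>X. \<forall>y\<in>X. \<exists>p m. p 0 = x \<and> p m = y \<and> (\<forall>i\<le>m. p i \<in> X) \<and>
     (\<forall>i<m. \<forall>V\<in>I. d V (p i) (p (Suc i)) \<le> R) \<and> real m \<le> C * (1 + rel_sum s x y))"
proof -
  obtain R C where R: "0 \<le> C" "\<forall>x\<in>X. \<forall>y\<in>X. \<exists>ps. path n R x ps y \<and> fst ` set ps \<subseteq> {None} \<and>
     real (length ps) \<le> C * (1 + rel_sum s x y)" using short_paths[OF s] by blast
  have "\<exists>p m. p 0 = x \<and> p m = y \<and> (\<forall>i\<le>m. p i \<in> X) \<and>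
     (\<forall>i<m. \<forall>V\<in>I. d V (p i) (p (Suc i)) \<le> R) \<and> real m \<le> C * (1 + rel_sum s x y)"
    if X: "x \<in> X" "y \<in> X" for x y
  proof -
    obtain ps where ps: "path n R x ps y" "fst ` set ps \<subseteq> {None}"
      "real (length ps) \<le> C * (1 + rel_sum s x y)" using R(2) X by blast
    have st: "step n R None (vertex x ps i) (vertex x ps (Suc i))" if "i < length ps" for i
    proof -
      have "fst (ps ! i) = None" using ps(2) nth_mem[OF that] by blast
      then show ?thesis using path_nth[OF ps(1) that] by simp
    qed
    have vX: "vertex x ps i \<in> X" if "i \<le> length ps" for i
    proof (cases "i = length ps")
      case True
      then show ?thesis using path_last[OF ps(1)] X by simp
    next
      case False
      then show ?thesis using st[of i] that by (simp add: step_def)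
    qed
    have "d V (vertex x ps i) (vertex x ps (Suc i)) \<le> R" if "i < length ps" "V \<in> I" for i V
      using st[OF that(1)] lev_bound[OF that(2)] that(2) by (auto simp: step_def)
    then show ?thesis
      using vX path_last[OF ps(1)] ps(3)
      by (intro exI[of _ "vertex x ps"] exI[of _ "length ps"]) simp
  qed
  then show ?thesis using R(1) by blast
qed

end

section \<open>Hierarchical spaces are coarse hierarchies\<close>

lemma enn2real_set_dist_le:
  assumes "a \<in> A" "b \<in> B" "0 \<le> d a b"
  shows "enn2real (set_dist d A B) \<le> d a b"
proof (rule enn2real_leI[OF assms(3)])
  show "set_dist d A B \<le> ennreal (d a b)"
    unfolding set_dist_def using assms by (intro INF_lower2[of a] INF_lower2[of b]) auto
qed

text \<open>The infimum need not be attained, whence the slack 1; it is finite because both sets are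
  nonempty.\<close>

lemma set_dist_witness:
  assumes "A \<noteq> {}" "B \<noteq> {}" and d: "\<And>a b. a \<in> A \<Longrightarrow> b \<in> B \<Longrightarrow> 0 \<le> d a b"
  obtains a b where "a \<in> A" "b \<in> B" "d a b \<le> enn2real (set_dist d A B) + 1"
proof -
  obtain a0 b0 where "a0 \<in> A" "b0 \<in> B" using assms by blast
  then have "set_dist d A B \<le> ennreal (d a0 b0)"
    unfolding set_dist_def by (intro INF_lower2[of a0] INF_lower2[of b0]) auto
  then have "set_dist d A B < top"
    using ennreal_less_top le_less_trans by blast
  then have "set_dist d A B = ennreal (enn2real (set_dist d A B))" by simp
  also have "\<dots> < ennreal (enn2real (set_dist d A B) + 1)"
    by (simp add: ennreal_less_iff)
  finally have "(INF a\<in>A. INF b\<in>B. ennreal (d a b)) < ennreal (enn2real (set_dist d A B) + 1)"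
    unfolding set_dist_def .
  then obtain a b where "a \<in> A" "b \<in> B" "ennreal (d a b) < ennreal (enn2real (set_dist d A B) + 1)"
    by (auto simp: INF_less_iff)
  then show thesis
    using d[of a b] by (intro that[of a b]) (auto simp: ennreal_less_iff simp del: ennreal_plus)
qed

text \<open>The infimum over an empty family is infinite, so a finite bound on a distance carries
  nonemptiness.\<close>

lemma set_dist_nonempty:
  assumes "set_dist d A B \<le> ennreal c"
  shows "A \<noteq> {}" "B \<noteq> {}"
proof -
  have "set_dist d A B \<noteq> top" using assms by (auto simp: top_unique)
  then show "A \<noteq> {}" "B \<noteq> {}"
    by (auto simp: set_dist_def top_unique)
qed

lemma le_set_diam:
  assumes "set_diam d A \<le> ennreal c" "0 \<le> c" "a \<in> A" "b \<in> A"
  shows "d a b \<le> c"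
proof -
  have "ennreal (d a b) \<le> set_diam d A"
    unfolding set_diam_def using assms by (intro SUP_upper2[of a] SUP_upper2[of b]) auto
  also have "\<dots> \<le> ennreal c" by (rule assms)
  finally show ?thesis using assms(2) by (simp add: ennreal_le_iff)
qed

context Metric_space begin

text \<open>Passing through \<open>B\<close> costs its diameter and the slack of two nearly optimal
  pairs.\<close>

lemma set_dist_triangle:
  assumes "A \<subseteq> M" "B \<subseteq> M" "C \<subseteq> M" and ne: "A \<noteq> {}" "B \<noteq> {}" "C \<noteq> {}"
    and B: "set_diam d B \<le> ennreal \<xi>" "0 \<le> \<xi>"
  shows "enn2real (set_dist d A C) \<le> enn2real (set_dist d A B) + enn2real (set_dist d B C) + (\<xi> + 2)"
proof -
  obtain a b where ab: "a \<in> A" "b \<in> B" "d a b \<le> enn2real (set_dist d A B) + 1"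
    using set_dist_witness[of A B d] ne by auto
  obtain b' c where bc: "b' \<in> B" "c \<in> C" "d b' c \<le> enn2real (set_dist d B C) + 1"
    using set_dist_witness[of B C d] ne by auto
  have "enn2real (set_dist d A C) \<le> d a c"
    using enn2real_set_dist_le[of a A c C d] ab bc by simp
  also have "\<dots> \<le> d a b + d b c" using triangle[of a b c] ab bc assms by auto
  also have "d b c \<le> d b b' + d b' c" using triangle[of b b' c] ab bc assms by auto
  also have "d b b' \<le> \<xi>" by (rule le_set_diam[OF B ab(2) bc(1)])
  finally show ?thesis using ab bc by simp
qed

lemma set_dist_commute: "set_dist d A B = set_dist d B A"
  unfolding set_dist_def using commute by (subst INF_commute) simp

end

section \<open>Levels, orthogonal families and markers\<close>

definition dmark :: "('x, 's, 'c) hierarchy \<Rightarrow> 's \<Rightarrow> 's \<Rightarrow> 'x \<Rightarrow> real" where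
  "dmark H V U x = enn2real (set_dist (dC H V) (proj H V x) (rho H U V))"

definition chain_above :: "('x, 's, 'c) hierarchy \<Rightarrow> 's \<Rightarrow> 's set \<Rightarrow> bool" where
  "chain_above H V A \<longleftrightarrow> A \<subseteq> {W \<in> idx H. pnest H V W} \<and> (\<forall>U\<in>A. \<forall>W\<in>A. nest H U W \<or> nest H W U)"

text \<open>The chains lie strictly above \<open>V\<close>, so the maximal element has level 0, and
  adding \<open>V\<close> to a chain gives a level below the complexity.\<close>

definition level :: "('x, 's, 'c) hierarchy \<Rightarrow> 's \<Rightarrow> nat" where
  "level H V = Max (card ` Collect (chain_above H V))"

locale nested_hierarchy =
  fixes H :: "('x, 's, 'c) hierarchy" and \<xi> :: real and n :: nat
  assumes nesting: "nesting H \<xi>" and orthogonality: "orthogonality H"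
    and complexity: "finite_complexity H n"
begin

lemma nest_refl: "V \<in> idx H \<Longrightarrow> nest H V V"
  and nest_antisym: "V \<in> idx H \<Longrightarrow> W \<in> idx H \<Longrightarrow> nest H V W \<Longrightarrow> nest H W V \<Longrightarrow> V = W"
  and nest_trans: "U \<in> idx H \<Longrightarrow> V \<in> idx H \<Longrightarrow> W \<in> idx H \<Longrightarrow> nest H U V \<Longrightarrow> nest H V W \<Longrightarrow> nest H U W"
  using nesting unfolding nesting_def by blast+

lemma chain_above_card:
  assumes V: "V \<in> idx H" and A: "chain_above H V A"
  shows "finite A" "card A < n"
proof -
  have sub: "insert V A \<subseteq> idx H" and above: "\<forall>W\<in>A. pnest H V W"
    using V A by (auto simp: chain_above_def)
  have "\<forall>U\<in>insert V A. \<forall>W\<in>insert V A. nest H U W \<or> nest H W U"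
    using A above nest_refl[OF V] by (auto simp: chain_above_def pnest_def)
  then have "finite (insert V A) \<and> card (insert V A) \<le> n"
    using complexity sub unfolding finite_complexity_def by meson
  moreover have "V \<notin> A" using above by (auto simp: pnest_def)
  ultimately show "finite A" "card A < n" by auto
qed

lemma chain_above_cards:
  assumes V: "V \<in> idx H"
  shows "finite (card ` Collect (chain_above H V))" "card ` Collect (chain_above H V) \<noteq> {}"
proof -
  have "card ` Collect (chain_above H V) \<subseteq> {..<n}"
    using chain_above_card(2)[OF V] by auto
  then show "finite (card ` Collect (chain_above H V))" by (rule finite_subset) simp
  have "chain_above H V {}" by (simp add: chain_above_def)
  then show "card ` Collect (chain_above H V) \<noteq> {}" by blast
qed

lemma level_bound: "V \<in> idx H \<Longrightarrow> level H V < n"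
  using Max_in[OF chain_above_cards] chain_above_card(2) unfolding level_def by fastforce

lemma level_less:
  assumes V: "V \<in> idx H" and W: "W \<in> idx H" and VW: "nest H V W" "V \<noteq> W"
  shows "level H W < level H V"
proof -
  obtain A where A: "chain_above H W A" "level H W = card A"
    using Max_in[OF chain_above_cards[OF W]] unfolding level_def by auto
  have up: "U \<in> idx H" "pnest H W U" if "U \<in> A" for U
    using A that by (auto simp: chain_above_def)
  have "pnest H V U" if "U \<in> A" for U
    using nest_trans[OF V W up(1)[OF that] VW(1)] nest_antisym[OF V W VW(1)] VW(2) up(2)[OF that]
    by (auto simp: pnest_def)
  then have "chain_above H V (insert W A)"
    using A(1) W VW nest_refl[OF W] up by (auto simp: chain_above_def pnest_def)
  then have "card (insert W A) \<le> level H V"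
    using Max_ge[OF chain_above_cards(1)[OF V]] unfolding level_def by auto
  moreover have "W \<notin> A" using up by (auto simp: pnest_def)
  ultimately show ?thesis using A(2) chain_above_card(1)[OF W A(1)] by simp
qed

text \<open>The axiom only provides a unique maximal element. Ascending from any domain lowers the
  level, hence ends there.\<close>

lemma nest_top:
  assumes "idx H \<noteq> {}"
  shows "\<exists>S\<in>idx H. \<forall>V\<in>idx H. nest H V S"
proof -
  from assms nesting obtain S where S: "S \<in> idx H"
    "\<And>W. W \<in> idx H \<Longrightarrow> (\<forall>V\<in>idx H. \<not> pnest H W V) \<Longrightarrow> W = S"
    unfolding nesting_def by blast
  have "nest H V S" if "V \<in> idx H" for V
    using that
  proof (induction "level H V" arbitrary: V rule: less_induct)
    case less
    show ?case
    proof (cases "\<exists>W\<in>idx H. pnest H V W")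
      case True
      then obtain W where W: "W \<in> idx H" "nest H V W" "V \<noteq> W" by (auto simp: pnest_def)
      then show ?thesis
        using less.hyps[OF level_less[OF less.prems W] W(1)] nest_trans[OF less.prems W(1) S(1) W(2)]
        by blast
    next
      case False
      then show ?thesis using S(2)[OF less.prems] nest_refl[OF S(1)] by auto
    qed
  qed
  with S show ?thesis by blast
qed

lemma orth_sym: "V \<in> idx H \<Longrightarrow> W \<in> idx H \<Longrightarrow> orth H V W \<Longrightarrow> orth H W V"
  and orth_nest: "U \<in> idx H \<Longrightarrow> V \<in> idx H \<Longrightarrow> W \<in> idx H \<Longrightarrow> nest H V W \<Longrightarrow> orth H W U \<Longrightarrow> orth H V U"
  and orth_not_nest: "V \<in> idx H \<Longrightarrow> W \<in> idx H \<Longrightarrow> orth H V W \<Longrightarrow> \<not> nest H V W"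
  using orthogonality unfolding orthogonality_def by blast+

text \<open>Each orthogonal container strictly decreases in the nesting order.\<close>

lemma orth_card_level:
  assumes "finite A" "A \<noteq> {}" "A \<subseteq> idx H" "pairwise (orth H) A" "T \<in> idx H" "\<And>V. V \<in> A \<Longrightarrow> nest H V T"
  shows "level H T + card A \<le> n"
  using assms
proof (induction A arbitrary: T rule: finite_ne_induct)
  case (singleton U)
  then show ?case using level_bound[of T] by simp
next
  case (insert U A)
  have UT: "U \<in> below H T" using insert.prems by (auto simp: below_def)
  have A: "V \<in> below H T" "orth H V U" if "V \<in> A" for V
    using insert.prems insert.hyps that by (auto simp: below_def pairwise_def)
  have "{V \<in> below H T. orth H V U} \<noteq> {}" using A insert.hyps by blast
  with orthogonality insert.prems UT obtain W where W: "W \<in> below H T - {T}"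
    "\<forall>V\<in>below H T. orth H V U \<longrightarrow> nest H V W"
    unfolding orthogonality_def by meson
  then have WI: "W \<in> idx H" "nest H W T" "W \<noteq> T" by (auto simp: below_def)
  have "level H W + card A \<le> n"
  proof (rule insert.IH)
    show "pairwise (orth H) A" using insert.prems(2) by (rule pairwise_mono) auto
  qed (use insert.prems WI A W in auto)
  then show ?case
    using level_less[OF WI(1) insert.prems(3) WI(2,3)] insert.hyps by simp
qed

lemma orth_card:
  assumes "finite A" "A \<subseteq> idx H" "pairwise (orth H) A"
  shows "card A \<le> n"
proof (cases "A = {}")
  case False
  then obtain S where "S \<in> idx H" "\<forall>V\<in>idx H. nest H V S" using nest_top assms by blast
  then have "level H S + card A \<le> n"
    using assms(2) by (intro orth_card_level[OF assms(1) False assms(2,3)]) auto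
  then show ?thesis by simp
qed simp

text \<open>Ensures that \<open>rho H U V\<close> is a nonempty bounded set wherever it is compared
  with \<open>rho H W V\<close>.\<close>

lemma marks_nest:
  assumes I: "U \<in> idx H" "W \<in> idx H" "V \<in> idx H" and UW: "nest H U W"
    and m: "marks (nest H) (orth H) W V" and o: "\<not> orth H V U"
  shows "marks (nest H) (orth H) U V"
proof (cases "nest H W V \<and> W \<noteq> V")
  case True
  then show ?thesis
    using nest_trans[OF I UW] nest_antisym[OF I(3,2)] UW by (auto simp: marks_def)
next
  case False
  then have t: "\<not> nest H V W" using m by (auto simp: marks_def transversal_def)
  then have "\<not> nest H V U" using nest_trans[OF I(3,1,2) _ UW] by blast
  moreover have "U \<noteq> V" using t UW by blast
  moreover have "\<not> orth H U V" using o orth_sym I by blast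
  ultimately show ?thesis by (auto simp: marks_def transversal_def)
qed

end

section \<open>The axioms of a hierarchical space in coarse form\<close>

lemma hierarchical_coarse:
  assumes H: "hierarchical_space H"
  obtains lev n \<kappa> where
    "coarse_hierarchy (pts H) (idx H) (nest H) (orth H) lev n (dproj H) (dmark H) \<kappa>"
    "\<And>x y. x \<in> pts H \<Longrightarrow> y \<in> pts H \<Longrightarrow> \<exists>p m. p 0 = x \<and> p m = y \<and> (\<forall>i. p i \<in> pts H) \<and>
       (\<forall>i. \<forall>V\<in>idx H. dproj H V (p i) (p (Suc i)) \<le> \<kappa>) \<and> real m \<le> \<kappa> * dX H x y + \<kappa>"
proof -
  obtain q where q: "quasigeodesic_space q (pts H) (dX H)"
    using H unfolding hierarchical_space_def by blast
  have geo: "geodesic_space (cspace H W) (dC H W)" if "W \<in> idx H" for W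
    using H that unfolding hierarchical_space_def by blast
  obtain \<xi> K \<kappa>\<^sub>0 lam E where nn: "0 \<le> \<xi>" "0 \<le> K" "0 \<le> \<kappa>\<^sub>0" "1 \<le> lam" "max \<xi> \<kappa>\<^sub>0 \<le> E"
    and pr: "projections H \<xi> K" and ne: "nesting H \<xi>" and og: "orthogonality H"
    and co: "consistency H \<xi> \<kappa>\<^sub>0" and ll: "large_links H lam E"
    using H unfolding hierarchical_space_def by (elim conjE exE bexE) blast
  obtain n where fc: "finite_complexity H n" using H unfolding hierarchical_space_def by blast
  obtain \<alpha> where \<alpha>: "0 \<le> \<alpha>" "partial_realization H \<alpha>" using H unfolding hierarchical_space_def by blast
  interpret nested_hierarchy H \<xi> n by standard (fact ne og fc)+
  let ?X = "pts H" and ?I = "idx H"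
  let ?mk = "marks (nest H) (orth H)"
  \<comment> \<open>Besides the constants of the axioms, this covers \<open>K * (2 * q) + K\<close>
    for steps along a quasigeodesic, \<open>q * q\<close> for its length, and
    \<open>2 * K + 3\<close> for steps of an interpolation.\<close>
  define \<kappa> where "\<kappa> = \<xi> + \<kappa>\<^sub>0 + lam + E + \<alpha> + 2 * K + 3 * K * q + q * q + q + 4"
  have q1: "1 \<le> q" using q by (simp add: quasigeodesic_space_def)
  have E0: "0 \<le> E" using nn by simp
  have Kq: "0 \<le> K * q" "1 \<le> q * q" using nn q1 mult_mono[of 1 q 1 q] by auto
  have kb: "\<xi> + 2 \<le> \<kappa>" "\<kappa>\<^sub>0 + \<xi> + 2 \<le> \<kappa>" "\<kappa>\<^sub>0 \<le> \<kappa>" "lam \<le> \<kappa>" "E \<le> \<kappa>" "\<alpha> + 1 \<le> \<kappa>" "1 \<le> \<kappa>" "3 \<le> \<kappa>"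
    "2 * K + 3 \<le> \<kappa>" "K * (2 * q) + K \<le> \<kappa>" "q * q + 1 \<le> \<kappa>" "q \<le> \<kappa>"
    using nn E0 Kq q1 \<alpha>(1) unfolding \<kappa>_def by (auto simp: algebra_simps)
  have MX: "Metric_space ?X (dX H)" using q by (simp add: quasigeodesic_space_def)
  have MC: "Metric_space (cspace H W) (dC H W)" if "W \<in> ?I" for W
    using geo[OF that] by (simp add: geodesic_space_def)
  have dC0: "0 \<le> dC H W a b" if "W \<in> ?I" for W a b using MC[OF that] by (rule Metric_space.nonneg)
  have P: "proj H W x \<noteq> {}" "proj H W x \<subseteq> cspace H W" "set_diam (dC H W) (proj H W x) \<le> ennreal \<xi>"
    if "W \<in> ?I" "x \<in> ?X" for W x
    using pr that unfolding projections_def by blast+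
  have lip: "dproj H W x y \<le> K * dX H x y + K" if "W \<in> ?I" "x \<in> ?X" "y \<in> ?X" for W x y
    using pr that unfolding projections_def by blast
  have mk: "?mk U V \<longleftrightarrow> pnest H U V \<or> transverse H U V" for U V
    by (simp add: marks_def transversal_def pnest_def transverse_def)
  have rho: "rho H U V \<subseteq> cspace H V" "set_diam (dC H V) (rho H U V) \<le> ennreal \<xi>"
    if "U \<in> ?I" "V \<in> ?I" "?mk U V" for U V
    using ne co that unfolding mk nesting_def consistency_def by blast+
  have rho_close: "set_dist (dC H V) (rho H U V) (rho H W V) \<le> ennreal \<kappa>\<^sub>0"
    if "U \<in> ?I" "W \<in> ?I" "V \<in> ?I" "nest H U W" "?mk W V" "\<not> orth H V U" for U V W
    using co that unfolding mk consistency_def by blast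
  \<comment> \<open>Nonemptiness is hidden in consistency: with \<open>U\<close> nested in itself,
    the last clause bounds the distance of the marker to itself, and this distance would be infinite
    for an empty set.\<close>
  have rho_ne: "rho H U V \<noteq> {}" if UV: "U \<in> ?I" "V \<in> ?I" "?mk U V" for U V
  proof -
    have "\<not> orth H V U"
      using UV(3) orth_sym[OF UV(2,1)] orth_not_nest[OF UV(1,2)]
      by (auto simp: marks_def transversal_def)
    from set_dist_nonempty(1)[OF rho_close[OF UV(1,1,2) nest_refl[OF UV(1)] UV(3) this]]
    show ?thesis .
  qed
  have chain: "\<exists>p m. p 0 = x \<and> p m = y \<and> (\<forall>i. p i \<in> ?X) \<and>
       (\<forall>i. \<forall>V\<in>?I. dproj H V (p i) (p (Suc i)) \<le> \<kappa>) \<and> real m \<le> \<kappa> * dX H x y + \<kappa>"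
    if X: "x \<in> ?X" "y \<in> ?X" for x y
  proof -
    obtain L \<gamma> where L: "quasigeodesic q ?X (dX H) L \<gamma>" "\<gamma> 0 = x" "\<gamma> L = y"
      using q X unfolding quasigeodesic_space_def by blast
    have L0: "0 \<le> L" using L by (simp add: quasigeodesic_def)
    \<comment> \<open>The quasigeodesic is sampled at integer times and stopped at \<open>L\<close>;
      consecutive samples are at distance at most \<open>2 * q\<close>.\<close>
    define p where "p i = \<gamma> (min (real i) L)" for i
    have pX: "p i \<in> ?X" for i using L L0 by (auto simp: p_def quasigeodesic_def)
    have "dproj H V (p i) (p (Suc i)) \<le> \<kappa>" if V: "V \<in> ?I" for V i
    proof -
      have "dX H (p i) (p (Suc i)) \<le> q * \<bar>min (real i) L - min (real (Suc i)) L\<bar> + q"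
      proof -
        have "min (real i) L \<in> {0..L}" "min (real (Suc i)) L \<in> {0..L}" using L0 by auto
        then show ?thesis using L(1) unfolding quasigeodesic_def p_def by blast
      qed
      also have "\<dots> \<le> q * 1 + q" using q1 by (intro add_mono mult_left_mono) auto
      finally have "K * dX H (p i) (p (Suc i)) \<le> K * (2 * q)" using nn by (intro mult_left_mono) auto
      then show ?thesis using lip[OF V pX pX, of i "Suc i"] kb by linarith
    qed
    moreover have "min (real (nat \<lceil>L\<rceil>)) L = L" by (rule min_absorb2) linarith
    then have "p 0 = x" "p (nat \<lceil>L\<rceil>) = y" using L L0 by (simp_all add: p_def)
    moreover have "real (nat \<lceil>L\<rceil>) \<le> \<kappa> * dX H x y + \<kappa>"
    proof -
      have "\<bar>0 - L\<bar> / q - q \<le> dX H (\<gamma> 0) (\<gamma> L)" 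
      proof -
        have "0 \<in> {0..L}" "L \<in> {0..L}" using L0 by auto
        then show ?thesis using L(1) unfolding quasigeodesic_def by blast
      qed
      then have "L / q \<le> dX H x y + q" using L L0 by simp
      then have "L \<le> (dX H x y + q) * q" using q1 by (simp add: pos_divide_le_eq)
      moreover have "q * dX H x y \<le> \<kappa> * dX H x y"
        using kb Metric_space.nonneg[OF MX] by (intro mult_right_mono) auto
      ultimately show ?thesis using L0 kb by (simp add: algebra_simps) linarith
    qed
    ultimately show ?thesis using pX by blast
  qed
  have dist_le: "dproj H W x y \<le> dC H W a b"
    if "W \<in> ?I" "a \<in> proj H W x" "b \<in> proj H W y" for W x y a b
    unfolding dproj_def using enn2real_set_dist_le[OF that(2,3)] dC0[OF that(1)] by blast
  have interp: "\<exists>p m. p 0 = x \<and> p m = y \<and> (\<forall>i. p i \<in> ?X) \<and>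
       (\<forall>i. dproj H T (p i) (p (Suc i)) \<le> \<kappa>) \<and> real m \<le> dproj H T x y + \<kappa>"
    if T: "T \<in> ?I" and X: "x \<in> ?X" "y \<in> ?X" for T x y
  proof -
    interpret M: Metric_space "cspace H T" "dC H T" by (rule MC[OF T])
    obtain a b where ab: "a \<in> proj H T x" "b \<in> proj H T y" "dC H T a b \<le> dproj H T x y + 1"
      using set_dist_witness[of "proj H T x" "proj H T y" "dC H T"] P(1)[OF T] X
      unfolding dproj_def by auto
    have abC: "a \<in> cspace H T" "b \<in> cspace H T" using ab P(2)[OF T] X by blast+
    obtain L \<gamma> where L: "geodesic (cspace H T) (dC H T) L \<gamma>" "\<gamma> 0 = a" "\<gamma> L = b"
      using geo[OF T] abC unfolding geodesic_space_def by blast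
    have L0: "0 \<le> L" using L by (simp add: geodesic_def)
    have \<gamma>C: "\<gamma> t \<in> cspace H T" if "t \<in> {0..L}" for t using L that by (auto simp: geodesic_def)
    have \<gamma>d: "dC H T (\<gamma> s) (\<gamma> t) = \<bar>s - t\<bar>" if "s \<in> {0..L}" "t \<in> {0..L}" for s t
      using L(1) that unfolding geodesic_def by blast
    have "a \<in> proj_image H T" "b \<in> proj_image H T" using ab X by (auto simp: proj_image_def)
    then have qc: "\<gamma> ` {0..L} \<subseteq> nbhd (cspace H T) (dC H T) K (proj_image H T)"
      using pr T L unfolding projections_def quasiconvex_def by blast
    \<comment> \<open>Quasiconvexity of the image gives points of the space that project near the
      geodesic. At the final time the choice is \<open>y\<close> itself, so that the chain ends
      exactly there.\<close>
    have "\<exists>w\<in>?X. (\<exists>c\<in>proj H T w. dC H T (\<gamma> t) c \<le> K + 1) \<and> (t = L \<longrightarrow> w = y)" if t: "t \<in> {0..L}" for t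
    proof (cases "t = L")
      case True
      then have "dC H T (\<gamma> t) b \<le> K + 1" using L abC nn by simp
      then show ?thesis using X ab by blast
    next
      case False
      have sd: "set_dist (dC H T) {\<gamma> t} (proj_image H T) \<le> ennreal K"
        using qc t unfolding nbhd_def by blast
      obtain c where c: "c \<in> proj_image H T"
        "dC H T (\<gamma> t) c \<le> enn2real (set_dist (dC H T) {\<gamma> t} (proj_image H T)) + 1"
        using set_dist_witness[of "{\<gamma> t}" "proj_image H T" "dC H T"] \<open>a \<in> proj_image H T\<close>
        by auto
      then have "dC H T (\<gamma> t) c \<le> K + 1" using enn2real_leI[OF nn(2) sd] by linarith
      with c(1) False show ?thesis by (auto simp: proj_image_def)
    qed
    then obtain h c where h: "\<And>t. t \<in> {0..L} \<Longrightarrow> h t \<in> ?X" "\<And>t. t \<in> {0..L} \<Longrightarrow> c t \<in> proj H T (h t)"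
      "\<And>t. t \<in> {0..L} \<Longrightarrow> dC H T (\<gamma> t) (c t) \<le> K + 1" "h L = y"
      using L0 by (metis atLeastAtMost_iff order_refl)
    have hC: "c t \<in> cspace H T" if "t \<in> {0..L}" for t using h(1,2)[OF that] P(2)[OF T] by blast
    \<comment> \<open>The extra vertex \<open>x\<close> in front is needed because the point chosen
      at time 0 need not be \<open>x\<close>.\<close>
    define p where "p i = (case i of 0 \<Rightarrow> x | Suc i \<Rightarrow> h (min (real i) L))" for i
    have tI: "min (real i) L \<in> {0..L}" for i using L0 by auto
    have "p i \<in> ?X" for i using X h(1)[OF tI] by (auto simp: p_def split: nat.splits)
    moreover have "dproj H T (p i) (p (Suc i)) \<le> \<kappa>" for i
    proof (cases i)
      case 0
      have "dproj H T x (h 0) \<le> dC H T a (c 0)"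
        by (rule dist_le[OF T ab(1) h(2)]) (use L0 in auto)
      also have "\<dots> \<le> K + 1" using h(3)[of 0] L L0 by auto
      finally show ?thesis using 0 kb nn L0 by (simp add: p_def)
    next
      case (Suc j)
      let ?s = "min (real j) L" and ?t = "min (real (Suc j)) L"
      have "dproj H T (h ?s) (h ?t) \<le> dC H T (c ?s) (c ?t)"
        by (rule dist_le[OF T h(2)[OF tI] h(2)[OF tI]])
      also have "\<dots> \<le> dC H T (c ?s) (\<gamma> ?s) + dC H T (\<gamma> ?s) (c ?t)"
        by (rule M.triangle[OF hC[OF tI] \<gamma>C[OF tI] hC[OF tI]])
      also have "dC H T (\<gamma> ?s) (c ?t) \<le> dC H T (\<gamma> ?s) (\<gamma> ?t) + dC H T (\<gamma> ?t) (c ?t)"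
        by (rule M.triangle[OF \<gamma>C[OF tI] \<gamma>C[OF tI] hC[OF tI]])
      also have "dC H T (\<gamma> ?s) (\<gamma> ?t) = \<bar>?s - ?t\<bar>" by (rule \<gamma>d[OF tI tI])
      finally have "dproj H T (h ?s) (h ?t) \<le> (K + 1) + (1 + (K + 1))"
        using h(3)[OF tI, of j] h(3)[OF tI, of "Suc j"] M.commute[of "c ?s" "\<gamma> ?s"] by linarith
      then show ?thesis using Suc kb by (simp add: p_def)
    qed
    moreover have "min (real (nat \<lceil>L\<rceil>)) L = L" by (rule min_absorb2) linarith
    then have "p 0 = x" "p (Suc (nat \<lceil>L\<rceil>)) = y" using h(4) by (simp_all add: p_def)
    moreover have "real (Suc (nat \<lceil>L\<rceil>)) \<le> dproj H T x y + \<kappa>"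
    proof -
      have "L = dC H T a b" using \<gamma>d[of 0 L] L L0 by auto
      then show ?thesis using ab(3) kb L0 by linarith
    qed
    ultimately show ?thesis by blast
  qed
  have "coarse_hierarchy ?X ?I (nest H) (orth H) (level H) n (dproj H) (dmark H) \<kappa>"
  proof
    show "1 \<le> \<kappa>" by (rule kb)
    show "card A \<le> n" if "finite A" "A \<subseteq> ?I" "pairwise (orth H) A" for A by (rule orth_card[OF that])
    show "0 \<le> dproj H V x y" for V x y by (simp add: dproj_def)
    show "dproj H V x x = 0" if V: "V \<in> ?I" "x \<in> ?X" for V x
    proof -
      obtain a where a: "a \<in> proj H V x" using P(1)[OF V] by blast
      then have "a \<in> cspace H V" using P(2)[OF V] by blast
      then have "dC H V a a = 0" using Metric_space.mdist_zero[OF MC[OF V(1)]] by blast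
      then show ?thesis using dist_le[OF V(1) a a] by (simp add: dproj_def order_antisym)
    qed
    show "dproj H V x y = dproj H V y x" if V: "V \<in> ?I" "x \<in> ?X" "y \<in> ?X" for V x y
      unfolding dproj_def using Metric_space.set_dist_commute[OF MC[OF V(1)]] by metis
    show "dproj H V x z \<le> dproj H V x y + dproj H V y z + \<kappa>"
      if V: "V \<in> ?I" "x \<in> ?X" "y \<in> ?X" "z \<in> ?X" for V x y z
      using Metric_space.set_dist_triangle[OF MC[OF V(1)] P(2)[OF V(1,2)] P(2)[OF V(1,3)] P(2)[OF V(1,4)]
          P(1)[OF V(1,2)] P(1)[OF V(1,3)] P(1)[OF V(1,4)] P(3)[OF V(1,3)] nn(1)] kb
      unfolding dproj_def by simp
    show "dproj H V x y \<le> dmark H V U x + dmark H V U y + \<kappa>"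
      if U: "U \<in> ?I" "V \<in> ?I" "?mk U V" and X: "x \<in> ?X" "y \<in> ?X" for U V x y
      using Metric_space.set_dist_triangle[OF MC[OF U(2)] P(2)[OF U(2) X(1)] rho(1)[OF U] P(2)[OF U(2) X(2)]
          P(1)[OF U(2) X(1)] rho_ne[OF U] P(1)[OF U(2) X(2)] rho(2)[OF U] nn(1)] kb
        Metric_space.set_dist_commute[OF MC[OF U(2)], of "rho H U V" "proj H V y"]
      unfolding dproj_def dmark_def by simp
    show "dmark H V U y \<le> dmark H V U x + dproj H V x y + \<kappa>"
      if U: "U \<in> ?I" "V \<in> ?I" "?mk U V" and X: "x \<in> ?X" "y \<in> ?X" for U V x y
      using Metric_space.set_dist_triangle[OF MC[OF U(2)] P(2)[OF U(2) X(2)] P(2)[OF U(2) X(1)] rho(1)[OF U]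
          P(1)[OF U(2) X(2)] P(1)[OF U(2) X(1)] rho_ne[OF U] P(3)[OF U(2) X(1)] nn(1)] kb
        Metric_space.set_dist_commute[OF MC[OF U(2)], of "proj H V x" "proj H V y"]
      unfolding dproj_def dmark_def by simp
    show "\<bar>dmark H V U x - dmark H V W x\<bar> \<le> \<kappa>"
      if I: "U \<in> ?I" "W \<in> ?I" "V \<in> ?I" and UW: "nest H U W" "?mk W V" "\<not> orth H V U" and X: "x \<in> ?X"
      for U W V x
    proof -
      have m: "?mk U V" by (rule marks_nest[OF I UW])
      have c: "enn2real (set_dist (dC H V) (rho H U V) (rho H W V)) \<le> \<kappa>\<^sub>0"
        by (rule enn2real_leI[OF nn(3) rho_close[OF I UW]])
      have "dmark H V W x \<le> dmark H V U x + enn2real (set_dist (dC H V) (rho H U V) (rho H W V)) + (\<xi> + 2)"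
        unfolding dmark_def
        by (rule Metric_space.set_dist_triangle[OF MC[OF I(3)] P(2)[OF I(3) X] rho(1)[OF I(1,3) m]
          rho(1)[OF I(2,3) UW(2)] P(1)[OF I(3) X] rho_ne[OF I(1,3) m] rho_ne[OF I(2,3) UW(2)]
          rho(2)[OF I(1,3) m] nn(1)])
      moreover have "dmark H V U x \<le> dmark H V W x + enn2real (set_dist (dC H V) (rho H W V) (rho H U V)) + (\<xi> + 2)"
        unfolding dmark_def
        by (rule Metric_space.set_dist_triangle[OF MC[OF I(3)] P(2)[OF I(3) X] rho(1)[OF I(2,3) UW(2)]
          rho(1)[OF I(1,3) m] P(1)[OF I(3) X] rho_ne[OF I(2,3) UW(2)] rho_ne[OF I(1,3) m]
          rho(2)[OF I(2,3) UW(2)] nn(1)])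
      ultimately show ?thesis
        using c kb Metric_space.set_dist_commute[OF MC[OF I(3)], of "rho H W V" "rho H U V"]
        by (simp add: abs_le_iff)
    qed
    show "dmark H W V x \<le> \<kappa> \<or> dmark H V W x \<le> \<kappa>"
      if I: "V \<in> ?I" "W \<in> ?I" "transversal (nest H) (orth H) V W" "x \<in> ?X" for V W x
    proof -
      have "transverse H V W" using I by (simp add: transversal_def transverse_def)
      then have "min (set_dist (dC H W) (proj H W x) (rho H V W))
          (set_dist (dC H V) (proj H V x) (rho H W V)) \<le> ennreal \<kappa>\<^sub>0"
        using co I unfolding consistency_def by blast
      then have "dmark H W V x \<le> \<kappa>\<^sub>0 \<or> dmark H V W x \<le> \<kappa>\<^sub>0"
        unfolding dmark_def min_le_iff_disj using enn2real_leI[OF nn(3)] by blast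
      then show ?thesis using kb by linarith
    qed
    show "\<exists>\<T>\<subseteq>?I. finite \<T> \<and> real (card \<T>) \<le> \<kappa> * dproj H W x y + \<kappa> \<and>
         (\<forall>T\<in>\<T>. nest H T W \<and> T \<noteq> W \<and> dmark H W T x \<le> \<kappa> * dproj H W x y + \<kappa>) \<and>
         (\<forall>T\<in>?I. nest H T W \<and> T \<noteq> W \<longrightarrow> (\<exists>T'\<in>\<T>. nest H T T') \<or> dproj H T x y < \<kappa>)"
      if I: "W \<in> ?I" "x \<in> ?X" "y \<in> ?X" for W x y
    proof -
      let ?N = "lam * dproj H W x y + lam"
      have d0: "0 \<le> dproj H W x y" by (simp add: dproj_def)
      have N: "0 \<le> ?N" "?N \<le> \<kappa> * dproj H W x y + \<kappa>"
        using nn kb d0 by (auto intro!: add_mono mult_right_mono add_nonneg_nonneg)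
      obtain \<T> where \<T>: "\<T> \<subseteq> below H W - {W}" "finite \<T>" "int (card \<T>) \<le> \<lfloor>?N\<rfloor>"
        "\<forall>T\<in>below H W - {W}. (\<exists>T'\<in>\<T>. T \<in> below H T') \<or> dproj H T x y < E"
        "\<forall>T\<in>\<T>. set_dist (dC H W) (proj H W x) (rho H T W) \<le> ennreal ?N"
        using ll[unfolded large_links_def Let_def, THEN bspec, THEN bspec, THEN bspec, OF I]
        by (elim exE conjE)
      have "real (card \<T>) \<le> ?N" using \<T>(3) by linarith
      moreover have "dmark H W T x \<le> ?N" if "T \<in> \<T>" for T
        unfolding dmark_def using enn2real_leI[OF N(1)] \<T>(5) that by blast
      moreover have "(\<exists>T'\<in>\<T>. nest H T T') \<or> dproj H T x y < \<kappa>"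
        if "T \<in> ?I" "nest H T W" "T \<noteq> W" for T
      proof -
        have "T \<in> below H W - {W}" using that by (simp add: below_def)
        then have "(\<exists>T'\<in>\<T>. T \<in> below H T') \<or> dproj H T x y < E" using \<T>(4) by blast
        then show ?thesis using kb by (auto simp: below_def)
      qed
      ultimately show ?thesis
        using \<T>(1,2) N(2) by (intro exI[of _ \<T>]) (force simp: below_def)
    qed
    show "\<exists>x\<in>?X. \<forall>V\<in>A. dproj H V x (e V) \<le> \<kappa> \<and> (\<forall>W\<in>?I. ?mk V W \<longrightarrow> dmark H W V x \<le> \<kappa>)"
      if A: "A \<subseteq> ?I" "pairwise (orth H) A" and e: "\<And>V. V \<in> A \<Longrightarrow> e V \<in> ?X" for A e
    proof -
      define p where "p V = (SOME a. a \<in> proj H V (e V))" for V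
      have p: "p V \<in> proj H V (e V)" if "V \<in> A" for V
        unfolding p_def using P(1)[of V "e V"] A e that some_in_eq by blast
      then have "\<forall>V\<in>A. p V \<in> proj_image H V" using e by (auto simp: proj_image_def)
      moreover have "\<forall>V\<in>A. \<forall>W\<in>A. V \<noteq> W \<longrightarrow> orth H V W" using A(2) by (auto simp: pairwise_def)
      ultimately have "\<exists>x\<in>?X. \<forall>V\<in>A. set_dist (dC H V) (proj H V x) {p V} \<le> ennreal \<alpha> \<and>
           (\<forall>W\<in>?I. pnest H V W \<or> transverse H W V \<longrightarrow>
              set_dist (dC H W) (proj H W x) (rho H V W) \<le> ennreal \<alpha>)"
        using \<alpha>(2)[unfolded partial_realization_def, THEN spec, THEN spec, of A p] A(1) by simp
      then obtain x where x: "x \<in> ?X" "\<And>V. V \<in> A \<Longrightarrow> set_dist (dC H V) (proj H V x) {p V} \<le> ennreal \<alpha>"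
        "\<And>V W. V \<in> A \<Longrightarrow> W \<in> ?I \<Longrightarrow> pnest H V W \<or> transverse H W V \<Longrightarrow>
           set_dist (dC H W) (proj H W x) (rho H V W) \<le> ennreal \<alpha>" by blast
      have "dproj H V x (e V) \<le> \<kappa>" if V: "V \<in> A" for V
      proof -
        have VI: "V \<in> ?I" using V A by blast
        obtain a where a: "a \<in> proj H V x"
          "dC H V a (p V) \<le> enn2real (set_dist (dC H V) (proj H V x) {p V}) + 1"
          by (rule set_dist_witness[of "proj H V x" "{p V}" "dC H V"])
            (use P(1)[OF VI x(1)] dC0[OF VI] in auto)
        then have "dC H V a (p V) \<le> \<alpha> + 1" using enn2real_leI[OF \<alpha>(1) x(2)[OF V]] by linarith
        then show ?thesis using dist_le[OF VI a(1) p[OF V]] kb by linarith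
      qed
      moreover have "dmark H W V x \<le> \<kappa>" if "V \<in> A" "W \<in> ?I" "?mk V W" for V W
      proof -
        have VI: "V \<in> ?I" using that A by blast
        have "pnest H V W \<or> transverse H W V"
          using that(3) orth_sym[OF that(2) VI] unfolding mk by (auto simp: transverse_def)
        from enn2real_leI[OF \<alpha>(1) x(3)[OF that(1,2) this]] show ?thesis
          using kb unfolding dmark_def by linarith
      qed
      ultimately show ?thesis using x(1) by blast
    qed
    show "\<exists>p m. p 0 = x \<and> p m = y \<and> (\<forall>i. p i \<in> ?X) \<and> (\<forall>i. \<forall>V\<in>?I. dproj H V (p i) (p (Suc i)) \<le> \<kappa>)"
      if "x \<in> ?X" "y \<in> ?X" for x y using chain[OF that] by blast
  qed (fact nest_refl nest_trans nest_top orth_sym orth_nest orth_not_nest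
      level_less level_bound interp)+
  then show thesis using that chain by blast
qed

section \<open>The distance formula for hierarchical spaces\<close>

theorem theorem6p10:
  fixes H :: "('x, 's, 'c) hierarchy"
  assumes "relatively_hierarchically_hyperbolic H"
  shows "\<exists>s\<^sub>0::real. \<forall>s\<ge>s\<^sub>0. \<exists>C\<ge>0. \<exists>K\<ge>1. \<forall>x\<in>pts H. \<forall>y\<in>pts H.
           (\<lambda>U. threshold s (dproj H U x y)) summable_on idx H \<and>
           coarse_eq K C (dX H x y) (\<Sum>\<^sub>\<infinity>U\<in>idx H. threshold s (dproj H U x y))"
proof -
  have H: "hierarchical_space H"
    using assms by (simp add: relatively_hierarchically_hyperbolic_def)
  obtain lev n \<kappa> where coarse: "coarse_hierarchy (pts H) (idx H) (nest H) (orth H) lev n (dproj H) (dmark H) \<kappa>"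
    and chain: "\<And>x y. x \<in> pts H \<Longrightarrow> y \<in> pts H \<Longrightarrow> \<exists>p m. p 0 = x \<and> p m = y \<and> (\<forall>i. p i \<in> pts H) \<and>
       (\<forall>i. \<forall>V\<in>idx H. dproj H V (p i) (p (Suc i)) \<le> \<kappa>) \<and> real m \<le> \<kappa> * dX H x y + \<kappa>"
    using hierarchical_coarse[OF H] by blast
  interpret coarse_hierarchy "pts H" "idx H" "nest H" "orth H" lev n "dproj H" "dmark H" \<kappa>
    by (rule coarse)
  have "Metric_space (pts H) (dX H)"
    using H by (auto simp: hierarchical_space_def quasigeodesic_space_def)
  then interpret M: Metric_space "pts H" "dX H" .
  have un: "uniqueness H" using H by (simp add: hierarchical_space_def)
  show ?thesis
  \<comment> \<open>The threshold is the one from the counting of middle points; among the constants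
    below, only those derived from \<open>chain_bound\<close> depend on \<open>s\<close>.\<close>
  proof (rule exI[of _ "18 * \<kappa>"], intro allI impI)
    fix s :: real assume s: "18 * \<kappa> \<le> s"
    obtain R C where C: "0 \<le> C" "\<forall>x\<in>pts H. \<forall>y\<in>pts H. \<exists>p m. p 0 = x \<and> p m = y \<and> (\<forall>i\<le>m. p i \<in> pts H) \<and>
     (\<forall>i<m. \<forall>V\<in>idx H. dproj H V (p i) (p (Suc i)) \<le> R) \<and> real m \<le> C * (1 + rel_sum s x y)"
      using chain_bound[OF s] by blast
    \<comment> \<open>No domain sees a step of the short chain at distance
      \<open>max 0 R + 1\<close>, so uniqueness bounds the length of each step in the space.\<close>
    have "0 \<le> max 0 R + 1" by simp
    then obtain \<theta> where \<theta>: "\<forall>x\<in>pts H. \<forall>y\<in>pts H. \<theta> \<le> dX H x y \<longrightarrow> (\<exists>V\<in>idx H. max 0 R + 1 \<le> dproj H V x y)"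
      using un unfolding uniqueness_def by blast
    define \<theta>' where "\<theta>' = max \<theta> 0"
    define B where "B = 4 * \<kappa> * real (n * n)"
    have B0: "0 \<le> B" using kappa by (simp add: B_def)
    \<comment> \<open>One pair of constants serves both inequalities: \<open>C * \<theta>'\<close>
      and \<open>1\<close> come from the short chain, \<open>B * \<kappa>\<close> and
      \<open>B * (\<kappa> + 1)\<close> from the quasigeodesic.\<close>
    define K where "K = 1 + C * \<theta>' + B * \<kappa>"
    define C' where "C' = 1 + B * (\<kappa> + 1)"
    have nn: "0 \<le> C * \<theta>'" "0 \<le> B * \<kappa>" "0 \<le> B * (\<kappa> + 1)"
      using C(1) B0 kappa by (auto simp: \<theta>'_def)
    have K: "1 \<le> K" "C * \<theta>' \<le> K" "B * \<kappa> \<le> K" "1 \<le> C'" "B * (\<kappa> + 1) \<le> C'"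
      using nn unfolding K_def C'_def by linarith+
    have formula: "\<forall>x\<in>pts H. \<forall>y\<in>pts H.
           (\<lambda>U. threshold s (dproj H U x y)) summable_on idx H \<and>
           coarse_eq K C' (dX H x y) (\<Sum>\<^sub>\<infinity>U\<in>idx H. threshold s (dproj H U x y))"
    proof (intro conjI ballI)
      fix x y assume X: "x \<in> pts H" "y \<in> pts H"
      let ?f = "\<lambda>U. threshold s (dproj H U x y)" and ?S = "{U \<in> idx H. s \<le> dproj H U x y}"
      have fin: "finite ?S" by (rule finite_relevant[OF X s])
      \<comment> \<open>Terms below the threshold vanish, so the infinite sum is the finite sum over
        \<open>?S\<close>.\<close>
      have "?f summable_on idx H \<longleftrightarrow> ?f summable_on ?S"
        by (rule summable_on_cong_neutral) (auto simp: threshold_def)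
      then show "?f summable_on idx H" using fin by simp
      have "infsum ?f (idx H) = infsum ?f ?S"
        by (rule infsum_cong_neutral) (auto simp: threshold_def)
      also have "\<dots> = rel_sum s x y"
        using fin by (simp add: rel_sum_def threshold_def)
      finally have inf: "infsum ?f (idx H) = rel_sum s x y" .
      have S0: "0 \<le> rel_sum s x y" by (rule rel_sum_nonneg)
      obtain p m where pm: "p 0 = x \<and> p m = y \<and> (\<forall>i\<le>m. p i \<in> pts H) \<and>
          (\<forall>i<m. \<forall>V\<in>idx H. dproj H V (p i) (p (Suc i)) \<le> R) \<and> real m \<le> C * (1 + rel_sum s x y)"
        using bspec[OF bspec[OF C(2) X(1)] X(2)] by (elim exE)
      have p: "p 0 = x" "p m = y" "\<And>i. i \<le> m \<Longrightarrow> p i \<in> pts H"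
        "\<And>i V. i < m \<Longrightarrow> V \<in> idx H \<Longrightarrow> dproj H V (p i) (p (Suc i)) \<le> R" "real m \<le> C * (1 + rel_sum s x y)"
        using pm by simp_all
      have step: "dX H (p i) (p (Suc i)) \<le> \<theta>'" if i: "i < m" for i
      proof (rule ccontr)
        assume "\<not> ?thesis"
        then have "\<theta> \<le> dX H (p i) (p (Suc i))" by (simp add: \<theta>'_def)
        moreover have "p i \<in> pts H" "p (Suc i) \<in> pts H" using p(3) i by auto
        ultimately obtain V where "V \<in> idx H" "max 0 R + 1 \<le> dproj H V (p i) (p (Suc i))"
          using \<theta> by blast
        then show False using p(4)[OF i] by fastforce
      qed
      have "dX H (p 0) (p m) \<le> dX H (p 0) (p 0) + \<theta>' * real (m - 0)"
      proof (rule steps_bound)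
        fix i assume "i < m"
        then show "dX H (p 0) (p (Suc i)) \<le> dX H (p 0) (p i) + \<theta>'"
          using M.triangle[OF p(3) p(3) p(3), of 0 i "Suc i"] step[of i] by simp
      qed simp
      then have "dX H x y \<le> \<theta>' * real m" using p X by simp
      also have "\<dots> \<le> \<theta>' * (C * (1 + rel_sum s x y))"
        using p(5) by (intro mult_left_mono) (auto simp: \<theta>'_def)
      also have "\<dots> \<le> K * (1 + rel_sum s x y)"
        using mult_right_mono[OF K(2), of "1 + rel_sum s x y"] S0 by (simp add: mult_ac)
      finally have "inverse K * dX H x y \<le> inverse K * (K * (1 + rel_sum s x y))"
        using K(1) by (intro mult_left_mono) auto
      then have lower: "inverse K * dX H x y - C' \<le> rel_sum s x y"
        using K by (simp add: mult.assoc[symmetric])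
      obtain p' m' where pm': "p' 0 = x \<and> p' m' = y \<and> (\<forall>i. p' i \<in> pts H) \<and>
          (\<forall>i. \<forall>V\<in>idx H. dproj H V (p' i) (p' (Suc i)) \<le> \<kappa>) \<and> real m' \<le> \<kappa> * dX H x y + \<kappa>"
        using chain[OF X] by (elim exE)
      have p': "p' 0 = x" "p' m' = y" "\<And>i. p' i \<in> pts H"
        "\<And>i V. V \<in> idx H \<Longrightarrow> dproj H V (p' i) (p' (Suc i)) \<le> \<kappa>" "real m' \<le> \<kappa> * dX H x y + \<kappa>"
        using pm' by simp_all
      have "rel_sum s x y \<le> 4 * \<kappa> * (real (n * n) * real (Suc m'))"
        using relevant_sum(2)[of p' s m'] p' s by (simp add: rel_sum_def)
      also have "\<dots> = B * real (Suc m')" by (simp add: B_def)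
      also have "\<dots> \<le> B * (\<kappa> * dX H x y + \<kappa> + 1)"
        using p'(5) B0 by (intro mult_left_mono) auto
      also have "\<dots> = B * \<kappa> * dX H x y + B * (\<kappa> + 1)" by (simp add: algebra_simps)
      also have "\<dots> \<le> K * dX H x y + C'"
        using K by (intro add_mono mult_right_mono) auto
      finally show "coarse_eq K C' (dX H x y) (infsum ?f (idx H))"
        using lower unfolding inf coarse_eq_def by simp
    qed
    show "\<exists>C\<ge>0. \<exists>K\<ge>1. \<forall>x\<in>pts H. \<forall>y\<in>pts H.
           (\<lambda>U. threshold s (dproj H U x y)) summable_on idx H \<and>
           coarse_eq K C (dX H x y) (\<Sum>\<^sub>\<infinity>U\<in>idx H. threshold s (dproj H U x y))"
    proof (rule exI[of _ C'], rule conjI, goal_cases)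
      case 1
      show ?case using K(4) by simp
    next
      case 2
      show ?case by (rule exI[of _ K]) (rule conjI[OF K(1) formula])
    qed
  qed
qed

end
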